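(* Let $M$ be a smooth Riemannian manifold and let $X$ be a z-KROK random field on $M$ with values in $\mathbb{R}^k$. Let $S$ be a smooth manifold and let $\varphi:S\to M$ be a smooth map such that almost surely $\varphi$ is transverse to $X^{-1}(0)$. Then $X\circ\varphi$ is a z-KROK random field on $S$ with values in $\mathbb{R}^k$ and $$\zeta_{X\circ\varphi}(q)=d_q\varphi^*\big(\zeta_X(\varphi(q))\big)\qquad\text{for all }q\in S,$$ where $d_q\varphi^*:\Lambda^kT^*_{\varphi(q)}M\to\Lambda^kT_q^*S$ is the linear pull-back map.
   Context: Random fields. $M$ is a smooth manifold, possibly non-compact, with Riemannian metric $g$. $C^1(M,\mathbb{R}^k)$ carries the weak Whitney topology; a random field $X$ is a measurable map from a probability space into it; $[Y]$ denotes the law of a random element $Y$. For $f\in C^1(M,\mathbb{R}^k)$ let $J_pf:=\|d_pf^1\wedge\cdots\wedge d_pf^k\|$, with the norm on $\Lambda^kT^*_pM$ induced by $g$ through $\langle v_1\wedge\dots\wedge v_k,w_1\wedge\dots\wedge w_k\rangle=\det(\langle v_i,w_j\rangle)_{i,j}$. A regular conditional probability of $X$ given $X(p)$ is a map $(x,B)\mapsto\mu(p,x)(B)$ ($x\in\mathbb{R}^k$, $B\subset C^1(M,\mathbb{R}^k)$ Borel) such that each $\mu(p,x)$ is a Borel probability measure, $x\mapsto\mu(p,x)(B)$ is Borel, and $\mathbb{P}\{X\in B,\,X(p)\in V\}=\int_V\mu(p,x)(B)\,d[X(p)](x)$ for all Borel $B$ and $V\subset\mathbb{R}^k$. $X$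 is z-KROK if: (i) $X$ is a random element of $C^1(M,\mathbb{R}^k)$; (ii) almost surely $0$ is a regular value of $X$; (iii) for every $p\in M$ the law of $X(p)$ is absolutely continuous with density $\rho_{X(p)}:\mathbb{R}^k\to[0,+\infty)$; (iv) $(p,x)\mapsto\rho_{X(p)}(x)$ on $M\times\mathbb{R}^k$ is continuous at $(p,0)$ for all $p\in M$; (v) there are regular conditional probabilities $\mu(p,\cdot)$ of $X$ given $X(p)$, $p\in M$, such that the measures $J_p\cdot\mu(p,x)$, $B\mapsto\int_BJ_pf\,d\mu(p,x)(f)$, are finite and $(p,x)\mapsto J_p\cdot\mu(p,x)$, with values in the finite positive Borel measures on $C^1(M,\mathbb{R}^k)$ with the weak topology (tested on bounded continuous functions), is continuous at $(p,0)$ for all $p\in M$. This notion does not depend on the choice of Riemannian metric, so it makes sense on $S$ (with any metric). With this $\mu$, write $\mathbb{E}\{\Phi(X)\,|\,X(p)=0\}:=\int\Phi\,d\mu(p,0)$. Zonoid section. A zonoid in a finite dimensional vector space is a Hausdorff limit of finite Minkowski sums of segments; a convex body $K$ is determined by its support function $h_K(u)=\sup_{x\in K}\langle u,x\rangle$ on the dual space. For a z-KROK field $X$, $\zeta_X(p):=\mathbb{E}\{[0,d_pX^1\wedge\cdots\wedge d_pX^k]\,|\,X(p)=0\}\,\rho_{X(p)}(0)$ is the zonoid in $\Lambda^kT_p^*M$ with support function $u\mapsto\rho_{X(p)}(0)\,\mathbb{E}\{\max\{0,\langle d_pX^1\wedge\cdots\wedge d_pX^k,u\rangle\}\,|\,X(p)=0\}$,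 $u\in\Lambda^kT_pM$; it does not depend on the metric. For $S$ and $X\circ\varphi$ the definition is the same. *)

theory Defs
  imports "HOL-Probability.Probability"
begin

section \<open>Finite-dimensional model spaces\<close>

text \<open>
  The class of finite-dimensional real inner product spaces.  Unlike
  \<^class>\<open>euclidean_space\<close> it does not exclude dimension \<open>0\<close>, so that manifolds of every
  dimension \<open>m \<ge> 0\<close> can be modelled on such a type.
\<close>

class finite_dim_inner = real_inner +
  assumes finite_spanning_set: "\<exists>B. finite B \<and> (\<forall>x. \<exists>c. x = (\<Sum>b\<in>B. c b *\<^sub>R b))"

instance euclidean_space \<subseteq> finite_dim_inner
  by standard (metis finite_Basis euclidean_representation)

text \<open>
  \<open>C\<^sup>n\<close> and smooth functions on an open subset of a finite-dimensional space, by means of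
  iterated directional derivatives of differentiable functions.
\<close>

fun Ck_on :: "nat \<Rightarrow> ('e::real_normed_vector \<Rightarrow> 'f::real_normed_vector) \<Rightarrow> 'e set \<Rightarrow> bool" where
  "Ck_on 0 f S \<longleftrightarrow> continuous_on S f"
| "Ck_on (Suc n) f S \<longleftrightarrow> (\<forall>x\<in>S. f differentiable at x) \<and>
     (\<forall>v. Ck_on n (\<lambda>x. frechet_derivative f (at x) v) S)"

definition smooth_on :: "('e::real_normed_vector \<Rightarrow> 'f::real_normed_vector) \<Rightarrow> 'e set \<Rightarrow> bool" where
  "smooth_on f S \<longleftrightarrow> (\<forall>n. Ck_on n f S)"


section \<open>Smooth manifolds\<close>

text \<open>
  A manifold is a type carrying a Hausdorff second countable topology, together with a smooth
  atlas.  A chart is a pair of an open domain and a map from it to the model space; the map is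
  only relevant on the domain.  The atlas need not be maximal.
\<close>

type_synonym ('a, 'e) chart = "'a set \<times> ('a \<Rightarrow> 'e)"

abbreviation chart_inv :: "('a, 'e) chart \<Rightarrow> 'e \<Rightarrow> 'a" where
  "chart_inv c \<equiv> inv_into (fst c) (snd c)"

definition smooth_atlas ::
  "('a::{t2_space, second_countable_topology}, 'e::finite_dim_inner) chart set \<Rightarrow> bool" where
  "smooth_atlas A \<longleftrightarrow>
     (\<Union>c\<in>A. fst c) = UNIV \<and>
     (\<forall>c\<in>A. open (fst c) \<and> open (snd c ` fst c) \<and>
        homeomorphism (fst c) (snd c ` fst c) (snd c) (chart_inv c)) \<and>
     (\<forall>c\<in>A. \<forall>d\<in>A. smooth_on (snd d \<circ> chart_inv c) (snd c ` (fst c \<inter> fst d)))"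

definition smooth_map ::
  "('s::{t2_space, second_countable_topology}, 'f::finite_dim_inner) chart set \<Rightarrow>
   ('a::{t2_space, second_countable_topology}, 'e::finite_dim_inner) chart set \<Rightarrow>
   ('s \<Rightarrow> 'a) \<Rightarrow> bool" where
  "smooth_map A' A \<phi> \<longleftrightarrow> continuous_on UNIV \<phi> \<and>
     (\<forall>c\<in>A'. \<forall>d\<in>A. smooth_on (snd d \<circ> \<phi> \<circ> chart_inv c) (snd c ` (fst c \<inter> \<phi> -` fst d)))"

text \<open>
  The tangent space at \<open>p\<close> is the model space, via the coordinates of one chart around \<open>p\<close>
  that is chosen once and for all.  \<open>from_chart A c p\<close> takes the coordinates of a tangent
  vector in another chart \<open>c\<close> around \<open>p\<close> to the coordinates in the chosen one.
\<close>

definition chart_at :: "('a, 'e) chart set \<Rightarrow> 'a \<Rightarrow> ('a, 'e) chart" where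
  "chart_at A p = (SOME c. c \<in> A \<and> p \<in> fst c)"

definition from_chart ::
  "('a, 'e::real_normed_vector) chart set \<Rightarrow> ('a, 'e) chart \<Rightarrow> 'a \<Rightarrow> 'e \<Rightarrow> 'e" where
  "from_chart A c p = frechet_derivative (snd (chart_at A p) \<circ> chart_inv c) (at (snd c p))"

definition dfun ::
  "('a, 'e::real_normed_vector) chart set \<Rightarrow> ('a \<Rightarrow> 'v::real_normed_vector) \<Rightarrow> 'a \<Rightarrow> 'e \<Rightarrow> 'v" where
  "dfun A f p = frechet_derivative (f \<circ> chart_inv (chart_at A p)) (at (snd (chart_at A p) p))"

definition dmap ::
  "('s, 'f::real_normed_vector) chart set \<Rightarrow> ('a, 'e::real_normed_vector) chart set \<Rightarrow>
   ('s \<Rightarrow> 'a) \<Rightarrow> 's \<Rightarrow> 'f \<Rightarrow> 'e" where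
  "dmap A' A \<phi> q = frechet_derivative (snd (chart_at A (\<phi> q)) \<circ> \<phi> \<circ> chart_inv (chart_at A' q))
     (at (snd (chart_at A' q) q))"

definition riemannian_metric ::
  "('a, 'e::real_normed_vector) chart set \<Rightarrow> ('a \<Rightarrow> 'e \<Rightarrow> 'e \<Rightarrow> real) \<Rightarrow> bool" where
  "riemannian_metric A g \<longleftrightarrow>
     (\<forall>p. bilinear (g p) \<and> (\<forall>v w. g p v w = g p w v) \<and> (\<forall>v. v \<noteq> 0 \<longrightarrow> 0 < g p v v)) \<and>
     (\<forall>c\<in>A. \<forall>v w. smooth_on
        (\<lambda>x. g (chart_inv c x) (from_chart A c (chart_inv c x) v) (from_chart A c (chart_inv c x) w))
        (snd c ` fst c))"

text \<open>
  Velocities at \<open>p\<close> of \<open>C\<^sup>1\<close> curves lying in \<open>Z\<close>; this is the tangent space of \<open>Z\<close> whenever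
  \<open>Z\<close> is a \<open>C\<^sup>1\<close> submanifold.
\<close>

definition tangent_space_of ::
  "('a, 'e::real_normed_vector) chart set \<Rightarrow> 'a set \<Rightarrow> 'a \<Rightarrow> 'e set" where
  "tangent_space_of A Z p = {v. \<exists>\<gamma> \<epsilon>. 0 < \<epsilon> \<and> \<gamma> 0 = p \<and>
     \<gamma> ` {-\<epsilon><..<\<epsilon>} \<subseteq> Z \<inter> fst (chart_at A p) \<and>
     Ck_on 1 (snd (chart_at A p) \<circ> \<gamma>) {-\<epsilon><..<\<epsilon>} \<and>
     (snd (chart_at A p) \<circ> \<gamma> has_vector_derivative v) (at (0::real))}"

definition transverse ::
  "('s, 'f::real_normed_vector) chart set \<Rightarrow> ('a, 'e::real_normed_vector) chart set \<Rightarrow>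
   ('s \<Rightarrow> 'a) \<Rightarrow> 'a set \<Rightarrow> bool" where
  "transverse A' A \<phi> Z \<longleftrightarrow> (\<forall>q. \<phi> q \<in> Z \<longrightarrow>
     {u + v | u v. u \<in> range (dmap A' A \<phi> q) \<and> v \<in> tangent_space_of A Z (\<phi> q)} = UNIV)"

definition regular_value ::
  "('a, 'e::real_normed_vector) chart set \<Rightarrow> ('a \<Rightarrow> 'v::real_normed_vector) \<Rightarrow> 'v \<Rightarrow> bool" where
  "regular_value A f y \<longleftrightarrow> (\<forall>p. f p = y \<longrightarrow> surj (dfun A f p))"


section \<open>Exterior forms\<close>

definition alternating_multilinear :: "(('k \<Rightarrow> 'e::real_vector) \<Rightarrow> real) \<Rightarrow> bool" where
  "alternating_multilinear \<alpha> \<longleftrightarrow>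
     (\<forall>v i. linear (\<lambda>x. \<alpha> (v(i := x)))) \<and>
     (\<forall>v i j. i \<noteq> j \<longrightarrow> v i = v j \<longrightarrow> \<alpha> v = 0)"

text \<open>
  \<open>\<Lambda>\<^sup>k E\<^sup>*\<close> as the space of alternating multilinear forms on \<open>E\<close> with slots indexed by a finite
  type of cardinality \<open>k\<close>.
\<close>

typedef (overloaded) ('e::real_vector, 'k) altform =
  "{\<alpha> :: ('k \<Rightarrow> 'e) \<Rightarrow> real. alternating_multilinear \<alpha>}"
  morphisms altform_apply Altform
  by (rule exI[of _ "\<lambda>_. 0"]) (simp add: alternating_multilinear_def linear_zero)

setup_lifting type_definition_altform

instantiation altform :: (real_vector, type) real_vector
begin

lift_definition zero_altform :: "('a, 'b) altform" is "\<lambda>_. 0"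
  by (simp add: alternating_multilinear_def linear_zero)

lift_definition plus_altform :: "('a, 'b) altform \<Rightarrow> ('a, 'b) altform \<Rightarrow> ('a, 'b) altform"
  is "\<lambda>\<alpha> \<beta> v. \<alpha> v + \<beta> v"
  unfolding alternating_multilinear_def by (auto intro!: linear_compose_add)

lift_definition minus_altform :: "('a, 'b) altform \<Rightarrow> ('a, 'b) altform \<Rightarrow> ('a, 'b) altform"
  is "\<lambda>\<alpha> \<beta> v. \<alpha> v - \<beta> v"
  unfolding alternating_multilinear_def by (auto intro!: linear_compose_sub)

lift_definition uminus_altform :: "('a, 'b) altform \<Rightarrow> ('a, 'b) altform"
  is "\<lambda>\<alpha> v. - \<alpha> v"
  unfolding alternating_multilinear_def by (auto intro!: linear_compose_neg)

lift_definition scaleR_altform :: "real \<Rightarrow> ('a, 'b) altform \<Rightarrow> ('a, 'b) altform"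
  is "\<lambda>r \<alpha> v. r * \<alpha> v"
  unfolding alternating_multilinear_def
  by (auto intro!: linear_compose_scale_right simp flip: real_scaleR_def)

instance
  by standard (transfer, auto simp: algebra_simps)+

end

lemma altform_bounded:
  fixes \<alpha> :: "('k::finite \<Rightarrow> 'e::finite_dim_inner) \<Rightarrow> real"
  assumes \<alpha>: "alternating_multilinear \<alpha>"
  obtains C where "0 \<le> C" "\<And>v. \<bar>\<alpha> v\<bar> \<le> C * (\<Prod>i\<in>UNIV. norm (v i))"
proof -
  have lin: "linear (\<lambda>x. \<alpha> (v(i := x)))" for v i
    using \<alpha> by (simp add: alternating_multilinear_def)
  obtain B0 :: "'e set" where B0: "finite B0" "\<And>x. \<exists>c. x = (\<Sum>b\<in>B0. c b *\<^sub>R b)"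
    using finite_spanning_set by blast
  have "x \<in> span B0" for x
  proof -
    obtain c where "x = (\<Sum>b\<in>B0. c b *\<^sub>R b)" using B0(2) by blast
    then show ?thesis by (simp add: span_base span_scale span_sum)
  qed
  then have "span B0 = UNIV" by blast
  with basis_orthogonal[OF B0(1)] obtain B :: "'e set" where
    B: "finite B" "span B = UNIV" "pairwise orthogonal B"
    by metis
  have expand: "x = (\<Sum>b\<in>B - {0}. ((x \<bullet> b) / (norm b)\<^sup>2) *\<^sub>R b)" for x
  proof -
    have "x \<in> span (B - {0})" using B(2) by (simp add: span_delete_0)
    then obtain c where c: "x = (\<Sum>b\<in>B - {0}. c b *\<^sub>R b)"
      using span_finite[of "B - {0}"] B(1) by auto
    have "x \<bullet> a = c a * (norm a)\<^sup>2" if "a \<in> B - {0}" for a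
    proof -
      have "x \<bullet> a = (\<Sum>b\<in>B - {0}. c b * (b \<bullet> a))"
        by (subst c) (simp add: inner_sum_left)
      also have "\<dots> = (\<Sum>b\<in>B - {0}. if b = a then c a * (norm a)\<^sup>2 else 0)"
        using B(3) that
        by (intro sum.cong) (auto simp: pairwise_def orthogonal_def power2_norm_eq_inner)
      also have "\<dots> = c a * (norm a)\<^sup>2" using that B(1) by simp
      finally show ?thesis .
    qed
    then have "(\<Sum>b\<in>B - {0}. ((x \<bullet> b) / (norm b)\<^sup>2) *\<^sub>R b) = (\<Sum>b\<in>B - {0}. c b *\<^sub>R b)"
      by (intro sum.cong) auto
    with c show ?thesis by simp
  qed
  have "\<exists>C\<ge>0. \<forall>v. (\<forall>i. i \<notin> F \<longrightarrow> v i \<in> B) \<longrightarrow> \<bar>\<alpha> v\<bar> \<le> C * (\<Prod>i\<in>F. norm (v i))"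
    if "finite F" for F :: "'k set"
    using that
  proof (induction F rule: finite_induct)
    case empty
    have fin: "finite {v :: 'k \<Rightarrow> 'e. \<forall>i. v i \<in> B}"
      using finite_PiE[of "UNIV :: 'k set" "\<lambda>_. B"] B(1) by (simp add: PiE_def Pi_def)
    have "\<bar>\<alpha> v\<bar> \<le> (\<Sum>w | \<forall>i. w i \<in> B. \<bar>\<alpha> w\<bar>)" if "\<forall>i. v i \<in> B" for v
      using that fin by (intro member_le_sum) auto
    then show ?case
      by (intro exI[of _ "\<Sum>w | \<forall>i. w i \<in> B. \<bar>\<alpha> w\<bar>"]) (auto intro: sum_nonneg)
  next
    case (insert j F)
    then obtain C where C: "0 \<le> C"
      "\<And>v. (\<forall>i. i \<notin> F \<longrightarrow> v i \<in> B) \<Longrightarrow> \<bar>\<alpha> v\<bar> \<le> C * (\<Prod>i\<in>F. norm (v i))"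
      by blast
    define D where "D = (\<Sum>b\<in>B - {0}. C / norm b)"
    have "\<bar>\<alpha> v\<bar> \<le> D * (\<Prod>i\<in>insert j F. norm (v i))"
      if v: "\<forall>i. i \<notin> insert j F \<longrightarrow> v i \<in> B" for v
    proof -
      let ?P = "\<Prod>i\<in>F. norm (v i)"
      have "\<alpha> v = \<alpha> (v(j := \<Sum>b\<in>B - {0}. ((v j \<bullet> b) / (norm b)\<^sup>2) *\<^sub>R b))"
        by (subst expand[symmetric]) simp
      also have "\<dots> = (\<Sum>b\<in>B - {0}. ((v j \<bullet> b) / (norm b)\<^sup>2) * \<alpha> (v(j := b)))"
        by (simp add: linear_sum[OF lin] linear_scale[OF lin])
      finally have "\<bar>\<alpha> v\<bar> \<le> (\<Sum>b\<in>B - {0}. \<bar>((v j \<bullet> b) / (norm b)\<^sup>2) * \<alpha> (v(j := b))\<bar>)"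
        by (simp only: sum_abs)
      also have "\<dots> \<le> (\<Sum>b\<in>B - {0}. C / norm b * (norm (v j) * ?P))"
      proof (rule sum_mono)
        fix b assume b: "b \<in> B - {0}"
        have "\<bar>\<alpha> (v(j := b))\<bar> \<le> C * (\<Prod>i\<in>F. norm ((v(j := b)) i))"
          using v b by (intro C(2)) auto
        also have "(\<Prod>i\<in>F. norm ((v(j := b)) i)) = ?P"
          using insert.hyps by (intro prod.cong) auto
        finally have 1: "\<bar>\<alpha> (v(j := b))\<bar> \<le> C * ?P" .
        have "\<bar>v j \<bullet> b\<bar> / (norm b)\<^sup>2 \<le> norm (v j) * norm b / (norm b)\<^sup>2"
          by (intro divide_right_mono Cauchy_Schwarz_ineq2) auto
        also have "\<dots> = norm (v j) / norm b" using b by (simp add: power2_eq_square)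
        finally have 2: "\<bar>v j \<bullet> b\<bar> / (norm b)\<^sup>2 \<le> norm (v j) / norm b" .
        have "\<bar>((v j \<bullet> b) / (norm b)\<^sup>2) * \<alpha> (v(j := b))\<bar>
            = (\<bar>v j \<bullet> b\<bar> / (norm b)\<^sup>2) * \<bar>\<alpha> (v(j := b))\<bar>"
          by (simp add: abs_mult)
        also have "\<dots> \<le> (norm (v j) / norm b) * (C * ?P)"
          by (intro mult_mono 1 2) auto
        finally show "\<bar>((v j \<bullet> b) / (norm b)\<^sup>2) * \<alpha> (v(j := b))\<bar>
            \<le> C / norm b * (norm (v j) * ?P)"
          by (simp add: mult_ac)
      qed
      also have "\<dots> = D * (\<Prod>i\<in>insert j F. norm (v i))"
        using insert.hyps by (simp add: D_def sum_distrib_right)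
      finally show ?thesis .
    qed
    moreover have "0 \<le> D" using C(1) by (auto simp: D_def intro!: sum_nonneg)
    ultimately show ?case by blast
  qed
  from this[of UNIV] that show ?thesis by auto
qed

lemma bdd_above_altform:
  fixes \<alpha> :: "('k::finite \<Rightarrow> 'e::finite_dim_inner) \<Rightarrow> real"
  assumes \<alpha>: "alternating_multilinear \<alpha>"
  shows "bdd_above (range (\<lambda>v. \<bar>\<alpha> v\<bar> / (\<Prod>i\<in>UNIV. norm (v i))))"
proof -
  obtain C where C: "0 \<le> C" "\<And>v. \<bar>\<alpha> v\<bar> \<le> C * (\<Prod>i\<in>UNIV. norm (v i))"
    using altform_bounded[OF \<alpha>] by blast
  have "\<bar>\<alpha> v\<bar> / (\<Prod>i\<in>UNIV. norm (v i)) \<le> C" for v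
  proof (cases "(\<Prod>i\<in>UNIV. norm (v i)) = 0")
    case True
    then show ?thesis using C(1) by (simp only: div_by_0)
  next
    case False
    then have "0 < (\<Prod>i\<in>UNIV. norm (v i))"
      using prod_nonneg[of UNIV "\<lambda>i. norm (v i)"]
      by (simp only: order.strict_iff_order norm_ge_zero simp_thms)
    then show ?thesis using C(2) by (simp only: pos_divide_le_eq)
  qed
  then show ?thesis by (auto intro!: bdd_aboveI)
qed

instantiation altform :: (finite_dim_inner, finite) real_normed_vector
begin

lift_definition norm_altform :: "('a, 'b) altform \<Rightarrow> real"
  is "\<lambda>\<alpha>. SUP v. \<bar>\<alpha> v\<bar> / (\<Prod>i\<in>UNIV. norm (v i))" .

definition dist_altform :: "('a, 'b) altform \<Rightarrow> ('a, 'b) altform \<Rightarrow> real"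
  where "dist_altform \<alpha> \<beta> = norm (\<alpha> - \<beta>)"

definition sgn_altform :: "('a, 'b) altform \<Rightarrow> ('a, 'b) altform"
  where "sgn_altform \<alpha> = \<alpha> /\<^sub>R norm \<alpha>"

definition uniformity_altform :: "(('a, 'b) altform \<times> ('a, 'b) altform) filter"
  where "uniformity_altform = (INF e\<in>{0 <..}. principal {(x, y). dist x y < e})"

definition open_altform :: "('a, 'b) altform set \<Rightarrow> bool"
  where "open_altform S = (\<forall>x\<in>S. \<forall>\<^sub>F (x', y) in uniformity. x' = x \<longrightarrow> y \<in> S)"

instance
proof
  fix \<alpha> \<beta> :: "('a, 'b) altform" and r :: real
  show "norm \<alpha> = 0 \<longleftrightarrow> \<alpha> = 0"
  proof transfer
    fix \<alpha> :: "('b \<Rightarrow> 'a) \<Rightarrow> real" assume \<alpha>: "alternating_multilinear \<alpha>"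
    show "(SUP v. \<bar>\<alpha> v\<bar> / (\<Prod>i\<in>UNIV. norm (v i))) = 0 \<longleftrightarrow> \<alpha> = (\<lambda>_. 0)"
    proof
      assume 0: "(SUP v. \<bar>\<alpha> v\<bar> / (\<Prod>i\<in>UNIV. norm (v i))) = 0"
      show "\<alpha> = (\<lambda>_. 0)"
      proof
        fix v
        show "\<alpha> v = 0"
        proof (cases "\<exists>i. v i = 0")
          case True
          then obtain i where "v i = 0" ..
          then have "v = v(i := 0)" by auto
          then show ?thesis
            using \<alpha> linear_0[of "\<lambda>x. \<alpha> (v(i := x))"]
            by (simp add: alternating_multilinear_def)
        next
          case False
          have "\<bar>\<alpha> v\<bar> / (\<Prod>i\<in>UNIV. norm (v i)) \<le> 0"
            using cSUP_upper[OF UNIV_I bdd_above_altform[OF \<alpha>], of v] 0 by simp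
          moreover have "(\<Prod>i\<in>UNIV. norm (v i)) > 0"
            using False by (intro prod_pos) auto
          ultimately show ?thesis by (simp add: divide_le_0_iff)
        qed
      qed
    qed simp
  qed
  show "norm (\<alpha> + \<beta>) \<le> norm \<alpha> + norm \<beta>"
  proof transfer
    fix \<alpha> \<beta> :: "('b \<Rightarrow> 'a) \<Rightarrow> real"
    assume \<alpha>: "alternating_multilinear \<alpha>" and \<beta>: "alternating_multilinear \<beta>"
    show "(SUP v. \<bar>\<alpha> v + \<beta> v\<bar> / (\<Prod>i\<in>UNIV. norm (v i)))
        \<le> (SUP v. \<bar>\<alpha> v\<bar> / (\<Prod>i\<in>UNIV. norm (v i))) + (SUP v. \<bar>\<beta> v\<bar> / (\<Prod>i\<in>UNIV. norm (v i)))"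
    proof (rule cSUP_least)
      fix v :: "'b \<Rightarrow> 'a"
      have "\<bar>\<alpha> v + \<beta> v\<bar> / (\<Prod>i\<in>UNIV. norm (v i))
          \<le> (\<bar>\<alpha> v\<bar> + \<bar>\<beta> v\<bar>) / (\<Prod>i\<in>UNIV. norm (v i))"
        by (intro divide_right_mono prod_nonneg abs_triangle_ineq) simp
      also have "\<dots> = \<bar>\<alpha> v\<bar> / (\<Prod>i\<in>UNIV. norm (v i)) + \<bar>\<beta> v\<bar> / (\<Prod>i\<in>UNIV. norm (v i))"
        by (simp add: add_divide_distrib)
      also have "\<dots> \<le> (SUP v. \<bar>\<alpha> v\<bar> / (\<Prod>i\<in>UNIV. norm (v i)))
          + (SUP v. \<bar>\<beta> v\<bar> / (\<Prod>i\<in>UNIV. norm (v i)))"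
        by (intro add_mono cSUP_upper UNIV_I bdd_above_altform \<alpha> \<beta>)
      finally show "\<bar>\<alpha> v + \<beta> v\<bar> / (\<Prod>i\<in>UNIV. norm (v i)) \<le> \<dots>" .
    qed simp
  qed
  show "norm (r *\<^sub>R \<alpha>) = \<bar>r\<bar> * norm \<alpha>"
  proof transfer
    fix r :: real and \<alpha> :: "('b \<Rightarrow> 'a) \<Rightarrow> real"
    assume \<alpha>: "alternating_multilinear \<alpha>"
    let ?f = "\<lambda>v. \<bar>\<alpha> v\<bar> / (\<Prod>i\<in>UNIV. norm (v i))"
    have "\<bar>r\<bar> * (SUP v. ?f v) = (SUP x\<in>range ?f. \<bar>r\<bar> * x)"
      by (rule continuous_at_Sup_mono)
        (auto intro!: monoI mult_left_mono continuous_intros bdd_above_altform[OF \<alpha>])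
    then show "(SUP v. \<bar>r * \<alpha> v\<bar> / (\<Prod>i\<in>UNIV. norm (v i))) = \<bar>r\<bar> * (SUP v. ?f v)"
      by (simp add: image_image abs_mult)
  qed
qed (rule dist_altform_def sgn_altform_def uniformity_altform_def open_altform_def)+

end

text \<open>
  The wedge product of covectors, \<open>(\<alpha>\<^sub>1 \<and> \<dots> \<and> \<alpha>\<^sub>k)(v\<^sub>1, \<dots>, v\<^sub>k) = det (\<alpha>\<^sub>i v\<^sub>j)\<close>, and the
  pull-back of forms, both for linear arguments.
\<close>

definition wedge :: "('k::finite \<Rightarrow> 'e::real_vector \<Rightarrow> real) \<Rightarrow> ('e, 'k) altform" where
  "wedge \<alpha> = Altform (\<lambda>v. det (\<chi> i j. \<alpha> i (v j)))"

definition pullback_form ::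
  "('f::real_vector \<Rightarrow> 'e::real_vector) \<Rightarrow> ('e, 'k) altform \<Rightarrow> ('f, 'k) altform" where
  "pullback_form L \<omega> = Altform (\<lambda>v. altform_apply \<omega> (\<lambda>i. L (v i)))"

text \<open>
  For an inner product \<open>b\<close> on \<open>E\<close>: the vector representing a covector, the induced inner
  product on \<open>E\<^sup>*\<close>, and the norm of \<open>\<alpha>\<^sub>1 \<and> \<dots> \<and> \<alpha>\<^sub>k\<close>, whose square is
  \<open>\<langle>\<alpha>\<^sub>1 \<and> \<dots> \<and> \<alpha>\<^sub>k, \<alpha>\<^sub>1 \<and> \<dots> \<and> \<alpha>\<^sub>k\<rangle> = det \<langle>\<alpha>\<^sub>i, \<alpha>\<^sub>j\<rangle>\<close>.
\<close>

definition sharp :: "('e \<Rightarrow> 'e \<Rightarrow> real) \<Rightarrow> ('e \<Rightarrow> real) \<Rightarrow> 'e" where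
  "sharp b \<alpha> = (THE a. \<forall>v. b a v = \<alpha> v)"

definition cometric :: "('e \<Rightarrow> 'e \<Rightarrow> real) \<Rightarrow> ('e \<Rightarrow> real) \<Rightarrow> ('e \<Rightarrow> real) \<Rightarrow> real" where
  "cometric b \<alpha> \<beta> = b (sharp b \<alpha>) (sharp b \<beta>)"

definition wedge_norm :: "('e \<Rightarrow> 'e \<Rightarrow> real) \<Rightarrow> ('k::finite \<Rightarrow> 'e \<Rightarrow> real) \<Rightarrow> real" where
  "wedge_norm b \<alpha> = sqrt (det (\<chi> i j. cometric b (\<alpha> i) (\<alpha> j)))"


section \<open>Zonoids\<close>

definition hausdorff_dist :: "'v::metric_space set \<Rightarrow> 'v set \<Rightarrow> real" where
  "hausdorff_dist K L = max (SUP x\<in>K. infdist x L) (SUP y\<in>L. infdist y K)"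

text \<open>Finite Minkowski sums of segments.\<close>

definition zonotope :: "'v::real_normed_vector set \<Rightarrow> bool" where
  "zonotope Z \<longleftrightarrow> (\<exists>(n::nat) a b.
     Z = {\<Sum>i<n. x i | x. \<forall>i<n. x i \<in> closed_segment (a i) (b i)})"

definition zonoid :: "'v::real_normed_vector set \<Rightarrow> bool" where
  "zonoid K \<longleftrightarrow> K \<noteq> {} \<and> compact K \<and>
     (\<exists>Z. (\<forall>n. zonotope (Z n)) \<and> (\<lambda>n. hausdorff_dist (Z n) K) \<longlonglongrightarrow> 0)"

definition support_function :: "'v::real_normed_vector set \<Rightarrow> ('v \<Rightarrow>\<^sub>L real) \<Rightarrow> real" where
  "support_function K u = (SUP x\<in>K. blinfun_apply u x)"


section \<open>The space of \<open>C\<^sup>1\<close> maps\<close>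

definition C1_maps ::
  "('a, 'e::real_normed_vector) chart set \<Rightarrow> ('a \<Rightarrow> 'v::real_normed_vector) set" where
  "C1_maps A = {f. \<forall>c\<in>A. Ck_on 1 (f \<circ> chart_inv c) (snd c ` fst c)}"

definition whitney_nbhd ::
  "('a, 'e::real_normed_vector) chart set \<Rightarrow> ('a \<Rightarrow> 'v::real_normed_vector) \<Rightarrow>
   ('a, 'e) chart \<Rightarrow> 'a set \<Rightarrow> real \<Rightarrow> ('a \<Rightarrow> 'v) set" where
  "whitney_nbhd A f c K \<epsilon> = {h \<in> C1_maps A. \<forall>p\<in>K.
     norm (h p - f p) < \<epsilon> \<and>
     onorm (\<lambda>v. frechet_derivative (h \<circ> chart_inv c) (at (snd c p)) v
              - frechet_derivative (f \<circ> chart_inv c) (at (snd c p)) v) < \<epsilon>}"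

text \<open>
  The weak Whitney (compact-open \<open>C\<^sup>1\<close>) topology, given by its standard subbasis: \<open>C\<^sup>1\<close>-closeness
  on compact subsets of chart domains.
\<close>

definition weak_whitney ::
  "('a::topological_space, 'e::real_normed_vector) chart set \<Rightarrow>
   ('a \<Rightarrow> 'v::real_normed_vector) topology" where
  "weak_whitney A = topology_generated_by
     {whitney_nbhd A f c K \<epsilon> | f c K \<epsilon>.
        f \<in> C1_maps A \<and> c \<in> A \<and> compact K \<and> K \<subseteq> fst c \<and> 0 < \<epsilon>}"

definition C1_borel ::
  "('a::topological_space, 'e::real_normed_vector) chart set \<Rightarrow>
   ('a \<Rightarrow> 'v::real_normed_vector) measure" where
  "C1_borel A = sigma (C1_maps A) {U. openin (weak_whitney A) U}"


section \<open>z-KROK fields and their zonoid sections\<close>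

text \<open>The covectors \<open>d\<^sub>pf\<^sup>i\<close> of a map \<open>f\<close> with values in \<open>\<real>\<^sup>k\<close>.\<close>

definition dcomp ::
  "('a, 'e::real_normed_vector) chart set \<Rightarrow> ('a \<Rightarrow> real ^ 'k::finite) \<Rightarrow> 'a \<Rightarrow> 'k \<Rightarrow> 'e \<Rightarrow> real" where
  "dcomp A f p i v = dfun A f p v $ i"

definition jac ::
  "('a, 'e::real_normed_vector) chart set \<Rightarrow> ('a \<Rightarrow> 'e \<Rightarrow> 'e \<Rightarrow> real) \<Rightarrow> 'a \<Rightarrow>
   ('a \<Rightarrow> real ^ 'k::finite) \<Rightarrow> real" where
  "jac A g p f = wedge_norm (g p) (dcomp A f p)"

definition jac_measure ::
  "('a, 'e::real_normed_vector) chart set \<Rightarrow> ('a \<Rightarrow> 'e \<Rightarrow> 'e \<Rightarrow> real) \<Rightarrow> 'a \<Rightarrow>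
   ('a \<Rightarrow> real ^ 'k::finite) measure \<Rightarrow> ('a \<Rightarrow> real ^ 'k) measure" where
  "jac_measure A g p \<nu> = density \<nu> (\<lambda>f. ennreal (jac A g p f))"

text \<open>A regular conditional probability of \<open>X\<close>, with values in \<open>N\<close>, given \<open>Y\<close>.\<close>

definition regular_cond_prob ::
  "'w measure \<Rightarrow> 'b measure \<Rightarrow> ('w \<Rightarrow> 'b) \<Rightarrow> ('w \<Rightarrow> 'y::topological_space) \<Rightarrow>
   ('y \<Rightarrow> 'b measure) \<Rightarrow> bool" where
  "regular_cond_prob P N X Y \<kappa> \<longleftrightarrow>
     (\<forall>y. prob_space (\<kappa> y) \<and> sets (\<kappa> y) = sets N) \<and>
     (\<forall>B\<in>sets N. (\<lambda>y. emeasure (\<kappa> y) B) \<in> borel_measurable borel \<and>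
        (\<forall>V\<in>sets borel. emeasure P {\<omega> \<in> space P. X \<omega> \<in> B \<and> Y \<omega> \<in> V} =
           (\<integral>\<^sup>+ y\<in>V. emeasure (\<kappa> y) B \<partial>distr P borel Y)))"

text \<open>
  Continuity at \<open>z\<close> of a family of finite measures on the Borel sets of a topology, for the
  weak topology on measures.
\<close>

definition weakly_isCont :: "'b topology \<Rightarrow> ('z::t2_space \<Rightarrow> 'b measure) \<Rightarrow> 'z \<Rightarrow> bool" where
  "weakly_isCont T \<nu> z \<longleftrightarrow>
     (\<forall>h. continuous_map T euclideanreal h \<and> bounded (h ` topspace T) \<longrightarrow>
        isCont (\<lambda>z. \<integral>f. h f \<partial>\<nu> z) z)"

text \<open>
  \<open>X\<close> is z-KROK, witnessed by the densities \<open>\<rho> p\<close> of \<open>X(p)\<close> and the regular conditional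
  probabilities \<open>\<mu> p\<close> of \<open>X\<close> given \<open>X(p)\<close>.
\<close>

definition zKROK_with ::
  "('a::{t2_space, second_countable_topology}, 'e::finite_dim_inner) chart set \<Rightarrow>
   ('a \<Rightarrow> 'e \<Rightarrow> 'e \<Rightarrow> real) \<Rightarrow> 'w measure \<Rightarrow> ('w \<Rightarrow> 'a \<Rightarrow> real ^ 'k::finite) \<Rightarrow>
   ('a \<Rightarrow> real ^ 'k \<Rightarrow> real) \<Rightarrow> ('a \<Rightarrow> real ^ 'k \<Rightarrow> ('a \<Rightarrow> real ^ 'k) measure) \<Rightarrow> bool" where
  "zKROK_with A g P X \<rho> \<mu> \<longleftrightarrow>
     X \<in> P \<rightarrow>\<^sub>M C1_borel A \<and>
     (AE \<omega> in P. regular_value A (X \<omega>) 0) \<and>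
     (\<forall>p. (\<forall>x. 0 \<le> \<rho> p x) \<and> distributed P lborel (\<lambda>\<omega>. X \<omega> p) (\<lambda>x. ennreal (\<rho> p x))) \<and>
     (\<forall>p. isCont (\<lambda>(p, x). \<rho> p x) (p, 0)) \<and>
     (\<forall>p. regular_cond_prob P (C1_borel A) X (\<lambda>\<omega>. X \<omega> p) (\<mu> p)) \<and>
     (\<forall>p x. finite_measure (jac_measure A g p (\<mu> p x))) \<and>
     (\<forall>p. weakly_isCont (weak_whitney A) (\<lambda>(p, x). jac_measure A g p (\<mu> p x)) (p, 0))"

definition zKROK ::
  "('a::{t2_space, second_countable_topology}, 'e::finite_dim_inner) chart set \<Rightarrow>
   ('a \<Rightarrow> 'e \<Rightarrow> 'e \<Rightarrow> real) \<Rightarrow> 'w measure \<Rightarrow> ('w \<Rightarrow> 'a \<Rightarrow> real ^ 'k::finite) \<Rightarrow> bool" where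
  "zKROK A g P X \<longleftrightarrow> (\<exists>\<rho> \<mu>. zKROK_with A g P X \<rho> \<mu>)"

text \<open>
  The zonoid section: the zonoid in \<open>\<Lambda>\<^sup>k T\<^sub>p\<^sup>*M\<close> with support function
  \<open>u \<mapsto> \<rho>(p,0) E[max 0 \<langle>dX\<^sup>1 \<and> \<dots> \<and> dX\<^sup>k, u\<rangle> | X(p) = 0]\<close>, where \<open>\<Lambda>\<^sup>k T\<^sub>pM\<close> is the dual of
  \<open>\<Lambda>\<^sup>k T\<^sub>p\<^sup>*M\<close>.  The right-hand side is the same for all witnesses \<open>\<rho>\<close>, \<open>\<mu>\<close>, so the
  quantification over them amounts to fixing any one of them.
\<close>

definition zonoid_section ::
  "('a::{t2_space, second_countable_topology}, 'e::finite_dim_inner) chart set \<Rightarrow>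
   ('a \<Rightarrow> 'e \<Rightarrow> 'e \<Rightarrow> real) \<Rightarrow> 'w measure \<Rightarrow> ('w \<Rightarrow> 'a \<Rightarrow> real ^ 'k::finite) \<Rightarrow>
   'a \<Rightarrow> ('e, 'k) altform set" where
  "zonoid_section A g P X p = (THE K. zonoid K \<and>
     (\<forall>\<rho> \<mu>. zKROK_with A g P X \<rho> \<mu> \<longrightarrow>
        (\<forall>u. support_function K u =
           \<rho> p 0 * (\<integral>f. max 0 (blinfun_apply u (wedge (dcomp A f p))) \<partial>\<mu> p 0))))"

end

theory Submission
  imports Defs
begin

text \<open>
  The conditional laws of \<open>X \<circ> \<phi>\<close> are the push-forwards of those of \<open>X\<close> under \<open>f \<mapsto> f \<circ> \<phi>\<close>, so
  everything reduces to the weak continuity of \<open>J\<^sub>q(f \<circ> \<phi>) \<mu>(\<phi> q, x)(df)\<close>.  Near any \<open>q\<close> there is a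
  bound \<open>J\<^sub>q(f \<circ> \<phi>) \<le> C J\<^sub>p f\<close> with \<open>p = \<phi> q\<close>, and for \<open>\<delta> > 0\<close>
  \<open>J\<^sub>q(f \<circ> \<phi>) = (J\<^sub>q(f \<circ> \<phi>) / (J\<^sub>p f + \<delta>)) J\<^sub>p f + O(\<delta>)\<close> uniformly in \<open>f\<close>.  The quotient is
  bounded and jointly continuous in \<open>(q, f)\<close>, hence can be tested against the weakly continuous
  measures \<open>J\<^sub>p \<mu>(p, x)\<close>, and the error is uniformly small because the \<open>\<mu>(p, x)\<close> are
  probabilities.  The formula for the zonoids then follows on the level of support functions from
  \<open>d(X\<^sup>1 \<circ> \<phi>) \<and> \<dots> \<and> d(X\<^sup>k \<circ> \<phi>) = \<phi>\<^sup>*(dX\<^sup>1 \<and> \<dots> \<and> dX\<^sup>k)\<close>.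
\<close>

section \<open>Finite-dimensional linear algebra\<close>

text \<open>Continuity is assumed for \<open>J_p \<mu>(p,x)\<close> only, so every limit has to be
  rewritten as an integral of a bounded continuous function against these measures. Dividing by
  \<open>J_p f\<close> fails where it vanishes, hence \<open>\<delta>\<close>; and the quotient
  still moves with \<open>q\<close> while weak convergence tests fixed functions, hence a separate
  argument through its oscillation in \<open>q\<close>. The zonoid section is described through all
  admissible densities and kernels at once. These are determined almost everywhere only; continuity
  at \<open>x = 0\<close> pins down the value there if \<open>\<rho>(p,0) > 0\<close>, and if
  \<open>\<rho>(p,0) = 0\<close> the support function is 0 anyway. Tangent vectors are written in a
  chart chosen separately at every point, and this choice may jump. Limits are therefore taken in
  one fixed chart, and Jacobians are carried over by the isometry between the two descriptions.
  Forms carry a supremum norm instead of a Euclidean one, so compactness and separation of convex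
  sets go through finite coordinate systems.\<close>

lemma linear_factors_through_coordinates:
  fixes l :: "'i \<Rightarrow> 'v::real_vector \<Rightarrow> real" and u :: "'v \<Rightarrow> 'w::real_vector"
  assumes "finite F" "\<And>i. i \<in> F \<Longrightarrow> linear (l i)" "linear u" "subspace W"
    and "\<And>x. x \<in> W \<Longrightarrow> \<forall>i\<in>F. l i x = 0 \<Longrightarrow> u x = 0"
  shows "\<exists>d. \<forall>x\<in>W. u x = (\<Sum>i\<in>F. l i x *\<^sub>R d i)"
  using assms
proof (induction F arbitrary: W rule: finite_induct)
  case empty
  then show ?case by auto
next
  case (insert j F)
  have lj: "linear (l j)" and li: "\<And>i. i \<in> F \<Longrightarrow> linear (l i)"
    using insert.prems(1) by auto
  \<comment> \<open>The induction descends to the hyperplane \<open>l j = 0\<close> of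
    \<open>W\<close>, which is why a general subspace is carried along. A vector \<open>y\<close> of
    \<open>W\<close> with \<open>l j y = 1\<close> then determines the one missing
    coefficient.\<close>
  let ?W = "W \<inter> {x. l j x = 0}"
  have "subspace ?W"
    using insert.prems(3) lj
    by (auto simp: subspace_def linear_add linear_scale linear_0)
  then obtain d where d: "\<And>x. x \<in> ?W \<Longrightarrow> u x = (\<Sum>i\<in>F. l i x *\<^sub>R d i)"
    using insert.IH[of ?W] li insert.prems(2,4) by auto
  show ?case
  proof (cases "\<exists>y\<in>W. l j y \<noteq> 0")
    case False
    then show ?thesis using d insert.hyps by (intro exI[of _ d]) auto
  next
    case True
    then obtain y0 where y0: "y0 \<in> W" "l j y0 \<noteq> 0" by blast
    define y where "y = (1 / l j y0) *\<^sub>R y0"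
    have y: "y \<in> W" "l j y = 1"
      using y0 insert.prems(3) lj by (auto simp: y_def subspace_def linear_scale)
    define e where "e = u y - (\<Sum>i\<in>F. l i y *\<^sub>R d i)"
    have "u x = (\<Sum>i\<in>insert j F. l i x *\<^sub>R (d(j := e)) i)" if x: "x \<in> W" for x
    proof -
      have "x - l j x *\<^sub>R y \<in> ?W"
        using x y insert.prems(3) lj by (auto simp: subspace_diff subspace_scale linear_diff linear_scale)
      then have "u (x - l j x *\<^sub>R y) = (\<Sum>i\<in>F. l i (x - l j x *\<^sub>R y) *\<^sub>R d i)" by (rule d)
      also have "\<dots> = (\<Sum>i\<in>F. l i x *\<^sub>R d i - l j x *\<^sub>R (l i y *\<^sub>R d i))"
        using li by (intro sum.cong refl) (simp add: linear_diff linear_scale algebra_simps)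
      also have "\<dots> = (\<Sum>i\<in>F. l i x *\<^sub>R d i) - l j x *\<^sub>R (\<Sum>i\<in>F. l i y *\<^sub>R d i)"
        by (simp add: sum_subtractf scaleR_sum_right)
      finally have "u x = (\<Sum>i\<in>F. l i x *\<^sub>R d i) + l j x *\<^sub>R e"
        using insert.prems(2) by (simp add: linear_diff linear_scale e_def algebra_simps)
      moreover have "(\<Sum>i\<in>F. l i x *\<^sub>R (d(j := e)) i) = (\<Sum>i\<in>F. l i x *\<^sub>R d i)"
        using insert.hyps by (intro sum.cong) auto
      ultimately show ?thesis using insert.hyps by simp
    qed
    then show ?thesis by blast
  qed
qed

text \<open>The \<open>d i\<close> need not be independent, nor the \<open>l i\<close> dual to them:
  forms are described below by their values on all tuples of basis vectors, which is a redundant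
  system. The locale gives Heine-Borel and automatic boundedness of linear maps on a type that is
  only a normed space.\<close>

locale finite_coordinates =
  fixes F :: "'i set" and l :: "'i \<Rightarrow> 'v::real_normed_vector \<Rightarrow> real" and d :: "'i \<Rightarrow> 'v"
  assumes finite_F: "finite F"
    and bounded_linear_coord: "\<And>i. i \<in> F \<Longrightarrow> bounded_linear (l i)"
    and expand: "\<And>x. x = (\<Sum>i\<in>F. l i x *\<^sub>R d i)"

text \<open>The box is a Minkowski sum of the segments from \<open>- r\<close> to \<open>r\<close>
  in the directions \<open>d i\<close>, added one at a time; this works for dependent
  \<open>d i\<close> as well.\<close>

lemma compact_coordinate_box:
  fixes d :: "'i \<Rightarrow> 'v::real_normed_vector"
  assumes "finite F"
  shows "compact {\<Sum>i\<in>F. c i *\<^sub>R d i | c. \<forall>i\<in>F. \<bar>c i\<bar> \<le> r}"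
  using assms
proof (induction F rule: finite_induct)
  case empty
  have "{\<Sum>i\<in>{}. c i *\<^sub>R d i | c. \<forall>i\<in>{}. \<bar>c i\<bar> \<le> r} = {0}" by auto
  then show ?case by simp
next
  case (insert j F)
  let ?B = "{\<Sum>i\<in>F. c i *\<^sub>R d i | c. \<forall>i\<in>F. \<bar>c i\<bar> \<le> r}"
  have eq: "{\<Sum>i\<in>insert j F. c i *\<^sub>R d i | c. \<forall>i\<in>insert j F. \<bar>c i\<bar> \<le> r}
      = {x + y | x y. x \<in> (\<lambda>t. t *\<^sub>R d j) ` {-r..r} \<and> y \<in> ?B}" (is "?L = ?R")
  proof
    show "?L \<subseteq> ?R" using insert.hyps by (fastforce simp: abs_le_iff)
    show "?R \<subseteq> ?L"
    proof
      fix z assume "z \<in> ?R"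
      then obtain t c where z: "z = t *\<^sub>R d j + (\<Sum>i\<in>F. c i *\<^sub>R d i)" "t \<in> {-r..r}"
        "\<forall>i\<in>F. \<bar>c i\<bar> \<le> r" by blast
      have "(\<Sum>i\<in>F. (c(j := t)) i *\<^sub>R d i) = (\<Sum>i\<in>F. c i *\<^sub>R d i)"
        using insert.hyps by (intro sum.cong) auto
      then have "z = (\<Sum>i\<in>insert j F. (c(j := t)) i *\<^sub>R d i)" using z insert.hyps by simp
      moreover have "\<forall>i\<in>insert j F. \<bar>(c(j := t)) i\<bar> \<le> r" using z by (auto simp: abs_le_iff)
      ultimately show "z \<in> ?L" by blast
    qed
  qed
  have "compact ((\<lambda>t. t *\<^sub>R d j) ` {-r..r})"
    by (intro compact_continuous_image continuous_intros) auto
  from compact_sums[OF this insert.IH] show ?case unfolding eq .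
qed

context finite_coordinates
begin

text \<open>Bounded functionals have bounded values on \<open>S\<close>, so the expansion places
  \<open>S\<close> inside a compact coordinate box.\<close>

lemma compact_if_closed_bounded:
  fixes S :: "'v set"
  assumes "closed S" "bounded S"
  shows "compact S"
proof -
  obtain B where B: "\<And>x. x \<in> S \<Longrightarrow> norm x \<le> B" using assms(2) by (auto simp: bounded_iff)
  have "\<exists>r. \<forall>x\<in>S. \<bar>l i x\<bar> \<le> r" if i: "i \<in> F" for i
  proof -
    obtain C where C: "\<And>x. norm (l i x) \<le> norm x * C" "0 \<le> C"
      using bounded_linear.nonneg_bounded[OF bounded_linear_coord[OF i]] by auto
    have "\<bar>l i x\<bar> \<le> B * C" if "x \<in> S" for x
      using C(1)[of x] mult_right_mono[OF B[OF that] C(2)] by simp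
    then show ?thesis by blast
  qed
  then obtain r where r: "\<And>i x. i \<in> F \<Longrightarrow> x \<in> S \<Longrightarrow> \<bar>l i x\<bar> \<le> r i" by metis
  define R where "R = (\<Sum>i\<in>F. \<bar>r i\<bar>)"
  have "\<bar>l i x\<bar> \<le> R" if "i \<in> F" "x \<in> S" for i x
    using r[OF that] member_le_sum[OF that(1), of "\<lambda>i. \<bar>r i\<bar>"] finite_F by (auto simp: R_def)
  note R = this
  have "S \<subseteq> {\<Sum>i\<in>F. c i *\<^sub>R d i | c. \<forall>i\<in>F. \<bar>c i\<bar> \<le> R}"
  proof
    fix x assume "x \<in> S"
    then show "x \<in> {\<Sum>i\<in>F. c i *\<^sub>R d i | c. \<forall>i\<in>F. \<bar>c i\<bar> \<le> R}"
      using R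
      by (intro CollectI exI[of _ "\<lambda>i. l i x"] conjI expand) blast
  qed
  then have "S = S \<inter> {\<Sum>i\<in>F. c i *\<^sub>R d i | c. \<forall>i\<in>F. \<bar>c i\<bar> \<le> R}" by blast
  then show ?thesis
    using closed_Int_compact[OF assms(1) compact_coordinate_box[OF finite_F, of d R]] by simp
qed

lemma linear_expand:
  assumes "linear u"
  shows "u x = (\<Sum>i\<in>F. l i x *\<^sub>R u (d i))"
  by (subst expand) (simp add: linear_sum[OF assms] linear_scale[OF assms])

lemma bounded_linear_if_linear:
  fixes u :: "'v \<Rightarrow> 'w::real_normed_vector"
  assumes "linear u"
  shows "bounded_linear u"
proof -
  have "bounded_linear (\<lambda>x. \<Sum>i\<in>F. l i x *\<^sub>R u (d i))"
    by (intro bounded_linear_sum bounded_linear_scaleR_const bounded_linear_coord)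
  then show ?thesis by (simp flip: linear_expand[OF assms])
qed

end

text \<open>Gram-Schmidt for an arbitrary positive definite form, since a Riemannian metric is in
  general not the inner product of the model space.\<close>

lemma positive_definite_orthonormalization:
  fixes b :: "'v::real_vector \<Rightarrow> 'v \<Rightarrow> real"
  assumes b: "bilinear b" "\<And>v w. b v w = b w v" "\<And>v. v \<noteq> 0 \<Longrightarrow> 0 < b v v" and "finite B"
  shows "\<exists>E. finite E \<and> (\<forall>e\<in>E. \<forall>e'\<in>E. b e e' = (if e = e' then 1 else 0)) \<and> B \<subseteq> span E"
  using \<open>finite B\<close>
proof (induction B rule: finite_induct)
  case empty
  then show ?case by (intro exI[of _ "{}"]) auto
next
  case (insert a B)
  then obtain E where E: "finite E" "\<forall>e\<in>E. \<forall>e'\<in>E. b e e' = (if e = e' then 1 else 0)"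
    "B \<subseteq> span E" by blast
  have lin: "linear (b v)" "linear (\<lambda>x. b x v)" for v using b(1) by (auto simp: bilinear_def)
  \<comment> \<open>The \<open>b\<close>-orthogonal projection of \<open>a\<close> to the span of
    \<open>E\<close>; if it equals \<open>a\<close>, nothing has to be added.\<close>
  define p where "p = (\<Sum>e\<in>E. b a e *\<^sub>R e)"
  have p: "p \<in> span E" unfolding p_def by (intro span_sum span_scale span_base)
  have bp: "b p e = b a e" if "e \<in> E" for e
  proof -
    have "b p e = (\<Sum>e'\<in>E. b a e' * b e' e)"
      by (simp add: p_def linear_sum[OF lin(2)] linear_scale[OF lin(2)])
    also have "\<dots> = (\<Sum>e'\<in>E. if e' = e then b a e else 0)"
      using E(2) that by (intro sum.cong) auto
    finally show ?thesis using E(1) that by simp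
  qed
  show ?case
  proof (cases "a = p")
    case True
    then show ?thesis using E p by blast
  next
    case False
    define q where "q = (a - p) /\<^sub>R sqrt (b (a - p) (a - p))"
    have pos: "0 < b (a - p) (a - p)" using b(3) False by simp
    have "b q q = (1 / sqrt (b (a - p) (a - p)) * (1 / sqrt (b (a - p) (a - p)))) * b (a - p) (a - p)"
      unfolding q_def linear_scale[OF lin(1)] linear_scale[OF lin(2)] by (simp add: divide_inverse)
    then have qq: "b q q = 1" using pos by simp
    have qe: "b q e = 0" "b e q = 0" if "e \<in> E" for e
      using bp[OF that] b(2)[of e q]
      by (simp_all add: q_def linear_scale[OF lin(2)] linear_diff[OF lin(2)])
    have "a = sqrt (b (a - p) (a - p)) *\<^sub>R q + p" using pos by (simp add: q_def)
    moreover have "span E \<subseteq> span (insert q E)" by (intro span_mono) auto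
    ultimately have "a \<in> span (insert q E)"
      using p by (metis insertI1 span_add span_base span_scale subsetD)
    then show ?thesis
      using E qq qe \<open>span E \<subseteq> span (insert q E)\<close> by (intro exI[of _ "insert q E"]) auto
  qed
qed

text \<open>A set instead of an indexed family, with completeness stated as the expansion that is
  used throughout; in dimension 0 the empty set qualifies.\<close>

definition orthonormal_basis :: "('v::real_vector \<Rightarrow> 'v \<Rightarrow> real) \<Rightarrow> 'v set \<Rightarrow> bool" where
  "orthonormal_basis b E \<longleftrightarrow> finite E \<and> (\<forall>e\<in>E. \<forall>e'\<in>E. b e e' = (if e = e' then 1 else 0)) \<and>
     (\<forall>x. x = (\<Sum>e\<in>E. b x e *\<^sub>R e))"

definition inner_form :: "('v::real_vector \<Rightarrow> 'v \<Rightarrow> real) \<Rightarrow> bool" where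
  "inner_form b \<longleftrightarrow> bilinear b \<and> (\<forall>v w. b v w = b w v) \<and> (\<forall>v. v \<noteq> 0 \<longrightarrow> 0 < b v v)"

lemma orthonormal_basis_expand:
  assumes "orthonormal_basis b E"
  shows "x = (\<Sum>e\<in>E. b x e *\<^sub>R e)"
  using assms unfolding orthonormal_basis_def by blast

lemma inner_form_inner: "inner_form (inner :: 'v::real_inner \<Rightarrow> 'v \<Rightarrow> real)"
  unfolding inner_form_def
  by (auto simp: inner_commute bilinear_def intro: bounded_linear.linear bounded_linear_inner_left bounded_linear_inner_right)

lemma orthonormal_basis_exists:
  fixes b :: "'e::finite_dim_inner \<Rightarrow> 'e \<Rightarrow> real"
  assumes b: "inner_form b"
  obtains E where "orthonormal_basis b E"
proof -
  note b = b[unfolded inner_form_def]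
  have lin: "linear (b v)" "linear (\<lambda>x. b x v)" for v using b by (auto simp: bilinear_def)
  obtain B0 :: "'e set" where B0: "finite B0" "\<And>x. \<exists>c. x = (\<Sum>b\<in>B0. c b *\<^sub>R b)"
    using finite_spanning_set by blast
  obtain E where E: "finite E" "\<forall>e\<in>E. \<forall>e'\<in>E. b e e' = (if e = e' then 1 else 0)" "B0 \<subseteq> span E"
    using positive_definite_orthonormalization[of b B0] b B0(1) by blast
  have "x = (\<Sum>e\<in>E. b x e *\<^sub>R e)" for x
  proof -
    obtain c where "x = (\<Sum>b\<in>B0. c b *\<^sub>R b)" using B0(2) by blast
    then have "x \<in> span E" using E(3) by (simp add: span_scale span_sum subsetD)
    then obtain c where c: "x = (\<Sum>e\<in>E. c e *\<^sub>R e)" using span_finite[OF E(1)] by auto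
    have "b x e = c e" if "e \<in> E" for e
    proof -
      have "b x e = (\<Sum>e'\<in>E. c e' * b e' e)"
        by (simp add: c linear_sum[OF lin(2)] linear_scale[OF lin(2)])
      also have "\<dots> = (\<Sum>e'\<in>E. if e' = e then c e else 0)"
        using E(2) that by (intro sum.cong) auto
      finally show ?thesis using E(1) that by simp
    qed
    then show ?thesis using c by simp
  qed
  with E that show ?thesis unfolding orthonormal_basis_def by blast
qed

lemma finite_coordinates_inner:
  assumes "orthonormal_basis (inner :: 'e::real_inner \<Rightarrow> 'e \<Rightarrow> real) E"
  shows "finite_coordinates E (\<lambda>e x. x \<bullet> e) (\<lambda>e. e)"
proof (rule finite_coordinates.intro)
  show "finite E" using assms unfolding orthonormal_basis_def by blast
  show "x = (\<Sum>e\<in>E. (x \<bullet> e) *\<^sub>R e)" for x by (rule orthonormal_basis_expand[OF assms])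
qed (rule bounded_linear_inner_left)

text \<open>Constants obtained by counting tuples of basis vectors thereby become independent of the
  metric and of the point.\<close>

lemma orthonormal_basis_card:
  fixes b :: "'e::real_vector \<Rightarrow> 'e \<Rightarrow> real"
  assumes b: "bilinear b" and E: "orthonormal_basis b E"
  shows "card E = dim (UNIV :: 'e set)"
proof -
  have lin: "linear (\<lambda>x. b x v)" for v using b by (auto simp: bilinear_def)
  have fin: "finite E" using E by (simp add: orthonormal_basis_def)
  have "independent E"
  proof (rule independent_if_scalars_zero[OF fin])
    fix c e assume s: "(\<Sum>x\<in>E. c x *\<^sub>R x) = 0" and e: "e \<in> E"
    have "0 = b (\<Sum>x\<in>E. c x *\<^sub>R x) e" using s linear_0[OF lin] by simp
    also have "\<dots> = (\<Sum>e'\<in>E. c e' * b e' e)"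
      by (simp add: linear_sum[OF lin] linear_scale[OF lin])
    also have "\<dots> = (\<Sum>e'\<in>E. if e' = e then c e else 0)"
      using E e by (intro sum.cong) (auto simp: orthonormal_basis_def)
    finally show "c e = 0" using fin e by simp
  qed
  moreover have "x \<in> span E" for x
  proof -
    have "(\<Sum>e\<in>E. b x e *\<^sub>R e) \<in> span E" by (intro span_sum span_scale span_base)
    then show ?thesis by (subst orthonormal_basis_expand[OF E])
  qed
  ultimately show ?thesis by (intro dim_unique[symmetric]) auto
qed

lemma orthonormal_basis_parseval:
  assumes b: "bilinear b" and E: "orthonormal_basis b E"
  shows "b v w = (\<Sum>e\<in>E. b v e * b w e)" 
proof -
  have lin: "linear (b v)" for v using b by (auto simp: bilinear_def)
  show ?thesis
    by (subst orthonormal_basis_expand[OF E, of w])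
      (simp add: linear_sum[OF lin] linear_scale[OF lin] mult.commute)
qed

lemma compact_finite_dim:
  fixes S :: "'e::finite_dim_inner set"
  assumes "closed S" "bounded S"
  shows "compact S"
proof -
  obtain E :: "'e set" where "orthonormal_basis (inner) E"
    using orthonormal_basis_exists[OF inner_form_inner] .
  from finite_coordinates.compact_if_closed_bounded[OF finite_coordinates_inner[OF this] assms]
  show ?thesis .
qed

lemma bounded_linear_finite_dim:
  fixes u :: "'e::finite_dim_inner \<Rightarrow> 'w::real_normed_vector"
  assumes "linear u"
  shows "bounded_linear u"
proof -
  obtain E :: "'e set" where "orthonormal_basis (inner) E"
    using orthonormal_basis_exists[OF inner_form_inner] .
  from finite_coordinates.bounded_linear_if_linear[OF finite_coordinates_inner[OF this] assms]
  show ?thesis .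
qed

section \<open>Wedge products and their norm\<close>

abbreviation wedge_det :: "('k::finite \<Rightarrow> 'e \<Rightarrow> real) \<Rightarrow> ('k \<Rightarrow> 'e) \<Rightarrow> real" where
  "wedge_det \<alpha> v \<equiv> det (\<chi> i j. \<alpha> i (v j))"

abbreviation tuples :: "'e set \<Rightarrow> ('k \<Rightarrow> 'e) set" where
  "tuples E \<equiv> {I. \<forall>i. I i \<in> E}"

lemma orthonormal_basis_linear:
  assumes "orthonormal_basis b E" "linear u"
  shows "u v = (\<Sum>e\<in>E. b v e *\<^sub>R u e)"
proof -
  have "u v = u (\<Sum>e\<in>E. b v e *\<^sub>R e)"
    by (rule arg_cong[OF orthonormal_basis_expand[OF assms(1)]])
  then show ?thesis by (simp add: linear_sum[OF assms(2)] linear_scale[OF assms(2)])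
qed

lemma tuples_eq_PiE: "tuples E = PiE UNIV (\<lambda>_. E)"
  by (auto simp: PiE_def Pi_def)

lemma finite_tuples: "finite E \<Longrightarrow> finite (tuples E :: ('k::finite \<Rightarrow> 'e) set)"
  unfolding tuples_eq_PiE by (intro finite_PiE) auto

text \<open>The slots of the form index the columns of the matrix, whereas the multilinearity rules
  for \<open>det\<close> used below act on rows.\<close>

lemma wedge_det_rows: "wedge_det \<alpha> v = det (\<chi> j. \<chi> i. \<alpha> i (v j))"
  by (subst det_transpose[symmetric]) (simp add: transpose_def)

lemma alternating_multilinear_wedge_det:
  fixes \<alpha> :: "'k::finite \<Rightarrow> 'e::real_vector \<Rightarrow> real"
  assumes "\<And>i. linear (\<alpha> i)"
  shows "alternating_multilinear (wedge_det \<alpha>)"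
  unfolding alternating_multilinear_def
proof (intro conjI allI impI)
  fix v :: "'k \<Rightarrow> 'e" and m
  have eq: "(\<lambda>x. wedge_det \<alpha> (v(m := x)))
      = (\<lambda>x. det (\<chi> j. if j = m then (\<chi> i. \<alpha> i x) else (\<chi> i. \<alpha> i (v j))))"
    unfolding wedge_det_rows by (intro ext arg_cong[where f = det]) (simp add: vec_eq_iff)
  show "linear (\<lambda>x. wedge_det \<alpha> (v(m := x)))"
    unfolding eq
  proof (rule linearI)
    fix x y
    have "(\<chi> i. \<alpha> i (x + y)) = (\<chi> i. \<alpha> i x) + (\<chi> i. \<alpha> i y)"
      using assms by (simp add: vec_eq_iff linear_add)
    show "det (\<chi> j. if j = m then (\<chi> i. \<alpha> i (x + y)) else (\<chi> i. \<alpha> i (v j)))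
      = det (\<chi> j. if j = m then (\<chi> i. \<alpha> i x) else (\<chi> i. \<alpha> i (v j)))
        + det (\<chi> j. if j = m then (\<chi> i. \<alpha> i y) else (\<chi> i. \<alpha> i (v j)))"
      unfolding \<open>(\<chi> i. \<alpha> i (x + y)) = (\<chi> i. \<alpha> i x) + (\<chi> i. \<alpha> i y)\<close>
      by (rule det_row_add[of m "\<lambda>_. \<chi> i. \<alpha> i x" "\<lambda>_. \<chi> i. \<alpha> i y"])
  next
    fix c x
    have "(\<chi> i. \<alpha> i (c *\<^sub>R x)) = c *s (\<chi> i. \<alpha> i x)"
      using assms by (simp add: vec_eq_iff linear_scale)
    then show "det (\<chi> j. if j = m then (\<chi> i. \<alpha> i (c *\<^sub>R x)) else (\<chi> i. \<alpha> i (v j)))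
      = c *\<^sub>R det (\<chi> j. if j = m then (\<chi> i. \<alpha> i x) else (\<chi> i. \<alpha> i (v j)))"
      using det_row_mul[of m c "\<lambda>_. \<chi> i. \<alpha> i x" "\<lambda>j. \<chi> i. \<alpha> i (v j)"] by (simp only: real_scaleR_def)
  qed
next
  fix v :: "'k \<Rightarrow> 'e" and i j assume "i \<noteq> j" "v i = v j"
  then show "wedge_det \<alpha> v = 0"
    by (intro det_identical_columns[of i j]) (auto simp: column_def vec_eq_iff)
qed

section \<open>Evaluation, pull-back and coordinates of alternating forms\<close>

lemma wedge_apply:
  assumes "\<And>i. linear (\<alpha> i)"
  shows "altform_apply (wedge \<alpha>) v = wedge_det \<alpha> v"
proof -
  have "alternating_multilinear (wedge_det \<alpha>)" by (rule alternating_multilinear_wedge_det) (rule assms)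
  then show ?thesis unfolding wedge_def by (simp add: Altform_inverse)
qed

lemma pullback_form_apply:
  fixes L :: "'f::real_vector \<Rightarrow> 'e::real_vector" and \<omega> :: "('e, 'k) altform"
  assumes L: "linear L"
  shows "altform_apply (pullback_form L \<omega>) v = altform_apply \<omega> (\<lambda>i. L (v i))"
proof -
  have \<omega>: "alternating_multilinear (altform_apply \<omega>)" using altform_apply by blast
  have "alternating_multilinear (\<lambda>v. altform_apply \<omega> (\<lambda>i. L (v i)))"
    unfolding alternating_multilinear_def
  proof (intro conjI allI impI)
    fix v :: "'k \<Rightarrow> 'f" and m
    have "(\<lambda>x. altform_apply \<omega> (\<lambda>i. L ((v(m := x)) i)))
        = (\<lambda>x. altform_apply \<omega> ((\<lambda>i. L (v i))(m := x))) \<circ> L"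
      by (auto intro!: ext arg_cong[where f = "altform_apply \<omega>"])
    moreover have "linear (\<lambda>x. altform_apply \<omega> ((\<lambda>i. L (v i))(m := x)))"
      using \<omega> unfolding alternating_multilinear_def by blast
    ultimately show "linear (\<lambda>x. altform_apply \<omega> (\<lambda>i. L ((v(m := x)) i)))"
      using linear_compose[OF L] by simp
  next
    fix v :: "'k \<Rightarrow> 'f" and i j :: 'k assume "i \<noteq> j" "v i = v j"
    then show "altform_apply \<omega> (\<lambda>i. L (v i)) = 0"
      using \<omega> unfolding alternating_multilinear_def by simp
  qed
  then show ?thesis unfolding pullback_form_def by (simp add: Altform_inverse)
qed

lemma altform_eqI: "(\<And>v. altform_apply \<omega> v = altform_apply \<eta> v) \<Longrightarrow> \<omega> = \<eta>"
  by (rule iffD1[OF altform_apply_inject]) blast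

lemma pullback_form_wedge:
  assumes "linear L" "\<And>i. linear (\<alpha> i)"
  shows "pullback_form L (wedge \<alpha>) = wedge (\<lambda>i v. \<alpha> i (L v))"
proof (rule altform_eqI)
  fix v
  have "linear (\<lambda>v. \<alpha> i (L v))" for i using linear_compose[OF assms(1) assms(2)[of i]] by (simp add: o_def)
  then show "altform_apply (pullback_form L (wedge \<alpha>)) v = altform_apply (wedge (\<lambda>i v. \<alpha> i (L v))) v"
    using assms by (simp add: pullback_form_apply wedge_apply)
qed

lemma linear_pullback_form: "linear L \<Longrightarrow> linear (pullback_form L)"
  by (intro linearI altform_eqI)
    (simp_all add: pullback_form_apply plus_altform.rep_eq scaleR_altform.rep_eq)

lemma altform_apply_eq_0:
  assumes "v i = 0"
  shows "altform_apply \<omega> v = 0"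
proof -
  have "linear (\<lambda>x. altform_apply \<omega> (v(i := x)))"
    using altform_apply[of \<omega>] by (simp add: alternating_multilinear_def)
  then have "altform_apply \<omega> (v(i := 0)) = 0" using linear_0 by blast
  moreover have "v(i := 0) = v" using assms by auto
  ultimately show ?thesis by simp
qed

lemma altform_apply_le_norm:
  fixes \<omega> :: "('e::finite_dim_inner, 'k::finite) altform"
  shows "\<bar>altform_apply \<omega> v\<bar> \<le> norm \<omega> * (\<Prod>i\<in>UNIV. norm (v i))"
proof (cases "\<exists>i. v i = 0")
  case True
  then show ?thesis using altform_apply_eq_0[of v _ \<omega>] by (auto intro!: mult_nonneg_nonneg prod_nonneg)
next
  case False
  have "\<bar>altform_apply \<omega> v\<bar> / (\<Prod>i\<in>UNIV. norm (v i)) \<le> norm \<omega>"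
    unfolding norm_altform.rep_eq
    using altform_apply[of \<omega>] by (intro cSUP_upper UNIV_I bdd_above_altform) simp
  moreover have "(\<Prod>i\<in>UNIV. norm (v i)) > 0" using False by (intro prod_pos) auto
  ultimately show ?thesis by (simp add: divide_le_eq)
qed

lemma bounded_linear_altform_apply:
  "bounded_linear (\<lambda>\<omega> :: ('e::finite_dim_inner, 'k::finite) altform. altform_apply \<omega> v)"
  using altform_apply_le_norm[of _ v]
  by (intro bounded_linear_intro[of _ "\<Prod>i\<in>UNIV. norm (v i)"])
    (auto simp: plus_altform.rep_eq scaleR_altform.rep_eq)

text \<open>The slots are freed one at a time: those in \<open>F\<close> may hold arbitrary vectors,
  the others still hold basis vectors, and expanding one more slot in the basis enlarges
  \<open>F\<close>.\<close>

lemma altform_eq_0_if_basis: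
  fixes \<omega> :: "('e::real_vector, 'k::finite) altform"
  assumes E: "orthonormal_basis b E" and 0: "\<And>I. I \<in> tuples E \<Longrightarrow> altform_apply \<omega> I = 0"
  shows "\<omega> = 0"
proof -
  have "\<forall>v. (\<forall>i. i \<notin> F \<longrightarrow> v i \<in> E) \<longrightarrow> altform_apply \<omega> v = 0" if "finite F" for F :: "'k set"
    using that
  proof (induction F rule: finite_induct)
    case empty
    then show ?case using 0 by auto
  next
    case (insert j F)
    show ?case
    proof (intro allI impI)
      fix v :: "'k \<Rightarrow> 'e" assume v: "\<forall>i. i \<notin> insert j F \<longrightarrow> v i \<in> E"
      have lin: "linear (\<lambda>x. altform_apply \<omega> (v(j := x)))"
        using altform_apply[of \<omega>] by (simp add: alternating_multilinear_def)
      have "altform_apply \<omega> v = (\<Sum>e\<in>E. b (v j) e *\<^sub>R altform_apply \<omega> (v(j := e)))"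
        using orthonormal_basis_linear[OF E lin, of "v j"] by simp
      also have "\<dots> = 0" using v insert.IH by (intro sum.neutral) auto
      finally show "altform_apply \<omega> v = 0" .
    qed
  qed
  from this[of UNIV] show ?thesis
    by (intro altform_eqI) (simp add: zero_altform.rep_eq)
qed

text \<open>The evaluations on basis tuples have only the zero form in their common kernel, so the
  identity map factors through them. The tuples are not restricted to increasing ones.\<close>

lemma altform_coordinates:
  fixes b :: "'e::finite_dim_inner \<Rightarrow> 'e \<Rightarrow> real"
  assumes E: "orthonormal_basis b E"
  obtains d :: "('k::finite \<Rightarrow> 'e) \<Rightarrow> ('e, 'k) altform" where
    "finite_coordinates (tuples E) (\<lambda>I \<omega>. altform_apply \<omega> I) d"
proof -
  have fin: "finite (tuples E :: ('k \<Rightarrow> 'e) set)"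
    using E by (intro finite_tuples) (simp add: orthonormal_basis_def)
  have "\<exists>d. \<forall>x\<in>UNIV. (\<lambda>x. x) x = (\<Sum>I\<in>tuples E. altform_apply x I *\<^sub>R (d I :: ('e, 'k) altform))"
  proof (rule linear_factors_through_coordinates[OF fin])
    show "linear (\<lambda>x. altform_apply x I)" for I :: "'k \<Rightarrow> 'e"
      by (intro bounded_linear.linear bounded_linear_altform_apply)
  qed (use altform_eq_0_if_basis[OF E] in \<open>auto simp: linear_id[unfolded id_def]\<close>)
  then obtain d :: "('k \<Rightarrow> 'e) \<Rightarrow> ('e, 'k) altform" where
    "\<And>x. x = (\<Sum>I\<in>tuples E. altform_apply x I *\<^sub>R d I)" by blast
  with that[of d] fin bounded_linear_altform_apply show ?thesis
    by (auto intro!: finite_coordinates.intro)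
qed

lemma bounded_linear_pullback_form:
  fixes L :: "'f::finite_dim_inner \<Rightarrow> 'e::finite_dim_inner"
  assumes "linear L"
  shows "bounded_linear (pullback_form L :: ('e, 'k::finite) altform \<Rightarrow> ('f, 'k) altform)"
proof -
  obtain E :: "'e set" where "orthonormal_basis (inner) E"
    using orthonormal_basis_exists[OF inner_form_inner] .
  then obtain d :: "('k \<Rightarrow> 'e) \<Rightarrow> ('e, 'k) altform" where
    "finite_coordinates (tuples E) (\<lambda>I \<omega>. altform_apply \<omega> I) d"
    by (rule altform_coordinates)
  from finite_coordinates.bounded_linear_if_linear[OF this linear_pullback_form[OF assms]]
  show ?thesis .
qed

section \<open>Determinant identities: Cauchy-Binet, Hadamard and change of basis\<close>

lemma det_sum_rows:
  fixes a :: "'k::finite \<Rightarrow> 'e \<Rightarrow> real ^ 'k"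
  assumes fin: "finite E"
  shows "det (\<chi> i. sum (a i) E) = (\<Sum>I\<in>tuples E. det (\<chi> i. a i (I i)))"
proof -
  have "det (\<chi> i. sum (a i) E)
      = (\<Sum>p | p permutes UNIV. of_int (sign p) * (\<Prod>i\<in>UNIV. \<Sum>e\<in>E. a i e $ p i))"
    by (simp add: det_def)
  also have "\<dots> = (\<Sum>p | p permutes UNIV. \<Sum>I\<in>tuples E. of_int (sign p) * (\<Prod>i\<in>UNIV. a i (I i) $ p i))"
    using fin by (simp add: prod_sum_PiE tuples_eq_PiE sum_distrib_left)
  also have "\<dots> = (\<Sum>I\<in>tuples E. \<Sum>p | p permutes UNIV. of_int (sign p) * (\<Prod>i\<in>UNIV. a i (I i) $ p i))"
    by (rule sum.swap)
  finally show ?thesis by (simp add: det_def)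
qed

text \<open>
  Cauchy--Binet, summed over all tuples instead of increasing ones; this is where the
  factorial comes from.
\<close>

lemma cauchy_binet:
  fixes a :: "'k::finite \<Rightarrow> 'e \<Rightarrow> real"
  assumes fin: "finite E"
  shows "(\<Sum>I\<in>tuples E. (wedge_det a I)\<^sup>2) = fact CARD('k) * det (\<chi> i j. \<Sum>e\<in>E. a i e * a j e)"
proof -
  let ?D = "wedge_det a"
  let ?S = "{p :: 'k \<Rightarrow> 'k. p permutes UNIV}"
  let ?G = "det (\<chi> i j. \<Sum>e\<in>E. a i e * a j e)"
  have "?G = det (\<chi> i. sum (\<lambda>e. \<chi> j. a i e * a j e) E)"
    by (intro arg_cong[where f = det]) (simp add: vec_eq_iff)
  also have "\<dots> = (\<Sum>I\<in>tuples E. det (\<chi> i. (\<chi> j. a i (I i) * a j (I i))))"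
    by (rule det_sum_rows[OF fin])
  also have "\<dots> = (\<Sum>I\<in>tuples E. (\<Prod>i\<in>UNIV. a i (I i)) * ?D I)"
  proof (intro sum.cong refl)
    fix I :: "'k \<Rightarrow> 'e"
    have "det (\<chi> i. (\<chi> j. a i (I i) * a j (I i))) = det (\<chi> i. a i (I i) *s (\<chi> j. a j (I i)))"
      by (intro arg_cong[where f = det]) (simp add: vec_eq_iff)
    then show "det (\<chi> i. (\<chi> j. a i (I i) * a j (I i))) = (\<Prod>i\<in>UNIV. a i (I i)) * ?D I"
      unfolding wedge_det_rows by (simp add: det_rows_mul)
  qed
  finally have G: "?G = (\<Sum>I\<in>tuples E. (\<Prod>i\<in>UNIV. a i (I i)) * ?D I)" .
  \<comment> \<open>Replacing \<open>I\<close> by \<open>I \<circ> p\<close> leaves the total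
    unchanged but brings out \<open>sign p\<close>. Summed over all \<open>p\<close>, the remaining
    products form a second copy of the determinant by the Leibniz formula.\<close>
  have "?G = (\<Sum>I\<in>tuples E. of_int (sign p) * (\<Prod>i\<in>UNIV. a i (I (p i))) * ?D I)"
    if p: "p permutes UNIV" for p :: "'k \<Rightarrow> 'k"
  proof -
    have bij: "bij_betw (\<lambda>I. I \<circ> p) (tuples E :: ('k \<Rightarrow> 'e) set) (tuples E)"
    proof (rule bij_betwI[where g = "\<lambda>I. I \<circ> inv p"])
      show "I \<circ> p \<circ> inv p = I" "I \<circ> inv p \<circ> p = I" for I :: "'k \<Rightarrow> 'e"
        using permutes_inv_o[OF p] by (simp_all add: comp_assoc)
    qed auto
    have "?G = (\<Sum>I\<in>tuples E. (\<Prod>i\<in>UNIV. a i ((I \<circ> p) i)) * ?D (I \<circ> p))"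
      unfolding G by (rule sum.reindex_bij_betw[OF bij, symmetric])
    also have "\<dots> = (\<Sum>I\<in>tuples E. of_int (sign p) * (\<Prod>i\<in>UNIV. a i (I (p i))) * ?D I)"
    proof (intro sum.cong refl)
      fix I :: "'k \<Rightarrow> 'e"
      have "?D (I \<circ> p) = of_int (sign p) * ?D I"
        using det_permute_columns[OF p, of "\<chi> i j. a i (I j)"] by simp
      then show "(\<Prod>i\<in>UNIV. a i ((I \<circ> p) i)) * ?D (I \<circ> p)
          = of_int (sign p) * (\<Prod>i\<in>UNIV. a i (I (p i))) * ?D I" by simp
    qed
    finally show ?thesis .
  qed
  then have "(\<Sum>p\<in>?S. ?G) = (\<Sum>p\<in>?S. \<Sum>I\<in>tuples E. of_int (sign p) * (\<Prod>i\<in>UNIV. a i (I (p i))) * ?D I)"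
    by (intro sum.cong) auto
  also have "\<dots> = (\<Sum>I\<in>tuples E. \<Sum>p\<in>?S. of_int (sign p) * (\<Prod>i\<in>UNIV. a i (I (p i))) * ?D I)"
    by (rule sum.swap)
  also have "\<dots> = (\<Sum>I\<in>tuples E. (?D I)\<^sup>2)"
    by (intro sum.cong refl) (simp add: det_def power2_eq_square sum_distrib_right)
  also have "(\<Sum>p\<in>?S. ?G) = fact CARD('k) * ?G"
    using card_permutations[of "UNIV :: 'k set" "CARD('k)"] by simp
  finally show ?thesis by simp
qed

lemma inner_form_represents:
  assumes b: "inner_form b" and E: "orthonormal_basis b E" and \<alpha>: "linear \<alpha>"
  shows "b (\<Sum>e\<in>E. \<alpha> e *\<^sub>R e) v = \<alpha> v"
proof -
  have lin: "linear (\<lambda>x. b x v)" and sym: "b v w = b w v" for v w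
    using b by (auto simp: inner_form_def bilinear_def)
  have "\<alpha> v = (\<Sum>e\<in>E. b v e * \<alpha> e)" using orthonormal_basis_linear[OF E \<alpha>, of v] by simp
  then show ?thesis by (simp add: linear_sum[OF lin] linear_scale[OF lin] sym[of v] mult.commute)
qed

text \<open>Riesz representation in an orthonormal basis; positive definiteness makes the
  representing vector unique, so the \<open>THE\<close> in \<open>sharp\<close> is
  meaningful.\<close>

lemma inner_form_sharp:
  assumes b: "inner_form b" and E: "orthonormal_basis b E" and \<alpha>: "linear \<alpha>"
  shows "sharp b \<alpha> = (\<Sum>e\<in>E. \<alpha> e *\<^sub>R e)"
  unfolding sharp_def
proof (rule the_equality)
  have lin: "linear (\<lambda>x. b x v)" for v using b by (auto simp: inner_form_def bilinear_def)
  show *: "\<forall>v. b (\<Sum>e\<in>E. \<alpha> e *\<^sub>R e) v = \<alpha> v" using inner_form_represents[OF b E \<alpha>] by blast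
  fix a assume a: "\<forall>v. b a v = \<alpha> v"
  have 0: "b (a - (\<Sum>e\<in>E. \<alpha> e *\<^sub>R e)) v = 0" for v
    using a * by (simp add: linear_diff[OF lin])
  show "a = (\<Sum>e\<in>E. \<alpha> e *\<^sub>R e)"
  proof (rule ccontr)
    assume "a \<noteq> (\<Sum>e\<in>E. \<alpha> e *\<^sub>R e)"
    then have "0 < b (a - (\<Sum>e\<in>E. \<alpha> e *\<^sub>R e)) (a - (\<Sum>e\<in>E. \<alpha> e *\<^sub>R e))"
      using b unfolding inner_form_def by simp
    then show False using 0 by simp
  qed
qed

lemma sharp_eq:
  fixes b :: "'e::finite_dim_inner \<Rightarrow> 'e \<Rightarrow> real"
  assumes b: "inner_form b" and \<alpha>: "linear \<alpha>"
  shows "b (sharp b \<alpha>) v = \<alpha> v"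
proof -
  obtain E where E: "orthonormal_basis b E" using orthonormal_basis_exists[OF b] .
  show ?thesis unfolding inner_form_sharp[OF b E \<alpha>] by (rule inner_form_represents[OF b E \<alpha>])
qed

lemma cometric_orthonormal:
  assumes b: "inner_form b" and E: "orthonormal_basis b E" and \<alpha>: "linear \<alpha>" and \<beta>: "linear \<beta>"
  shows "cometric b \<alpha> \<beta> = (\<Sum>e\<in>E. \<alpha> e * \<beta> e)"
proof -
  have lin: "linear (b v)" "linear (\<lambda>x. b x v)" for v
    using b by (auto simp: inner_form_def bilinear_def)
  have fin: "finite E" and on: "\<And>e e'. e \<in> E \<Longrightarrow> e' \<in> E \<Longrightarrow> b e e' = (if e = e' then 1 else 0)"
    using E by (auto simp: orthonormal_basis_def)
  have "cometric b \<alpha> \<beta> = (\<Sum>e\<in>E. \<Sum>e'\<in>E. \<alpha> e * (\<beta> e' * b e e'))"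
    unfolding cometric_def inner_form_sharp[OF b E \<alpha>] inner_form_sharp[OF b E \<beta>]
      linear_sum[OF lin(2)] linear_scale[OF lin(2)] linear_sum[OF lin(1)] linear_scale[OF lin(1)]
    by (subst sum.swap) (simp add: sum_distrib_left mult_ac)
  also have "\<dots> = (\<Sum>e\<in>E. \<Sum>e'\<in>E. if e' = e then \<alpha> e * \<beta> e else 0)"
    by (intro sum.cong refl) (auto simp: on)
  finally show ?thesis using fin by simp
qed

text \<open>By Cauchy-Binet the Gram determinant is a sum of squares, so the square root is taken of
  a nonnegative number. Dividing by the factorial compensates for counting every set of basis
  vectors once per ordering.\<close>

lemma wedge_norm_orthonormal:
  fixes \<alpha> :: "'k::finite \<Rightarrow> 'e::finite_dim_inner \<Rightarrow> real"
  assumes b: "inner_form b" and E: "orthonormal_basis b E" and \<alpha>: "\<And>i. linear (\<alpha> i)"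
  shows "wedge_norm b \<alpha> = sqrt ((\<Sum>I\<in>tuples E. (wedge_det \<alpha> I)\<^sup>2) / fact CARD('k))"
proof -
  have "finite E" using E by (simp add: orthonormal_basis_def)
  then show ?thesis
    unfolding wedge_norm_def by (simp add: cometric_orthonormal[OF b E \<alpha> \<alpha>] cauchy_binet)
qed

lemma wedge_norm_nonneg:
  fixes \<alpha> :: "'k::finite \<Rightarrow> 'e::finite_dim_inner \<Rightarrow> real"
  assumes b: "inner_form b" and \<alpha>: "\<And>i. linear (\<alpha> i)"
  shows "0 \<le> wedge_norm b \<alpha>"
proof -
  obtain E where E: "orthonormal_basis b E" using orthonormal_basis_exists[OF b] .
  show ?thesis unfolding wedge_norm_orthonormal[OF b E \<alpha>] by (simp add: sum_nonneg)
qed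

lemma sqrt_prod: "sqrt (\<Prod>x\<in>A. f x) = (\<Prod>x\<in>A. sqrt (f x))"
  by (induction A rule: infinite_finite_induct) (auto simp: real_sqrt_mult)

text \<open>Expanding every slot in an orthonormal basis gives a scalar product indexed by tuples,
  which Cauchy-Schwarz splits; the factor of the vectors is a product by Parseval. The root of the
  factorial reflects the normalization of \<open>wedge_norm\<close> and is not sharp; only its
  finiteness matters.\<close>

lemma hadamard_bound:
  fixes \<alpha> :: "'k::finite \<Rightarrow> 'e::finite_dim_inner \<Rightarrow> real"
  assumes b: "inner_form b" and \<alpha>: "\<And>i. linear (\<alpha> i)"
  shows "\<bar>wedge_det \<alpha> v\<bar> \<le> sqrt (fact CARD('k)) * wedge_norm b \<alpha> * (\<Prod>i\<in>UNIV. sqrt (b (v i) (v i)))"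
proof -
  obtain E where E: "orthonormal_basis b E" using orthonormal_basis_exists[OF b] .
  have fin: "finite E" using E by (simp add: orthonormal_basis_def)
  have "(\<chi> i. \<alpha> i (v j)) = (\<Sum>e\<in>E. b (v j) e *s (\<chi> i. \<alpha> i e))" for j
    using orthonormal_basis_linear[OF E \<alpha>, of _ "v j"] by (simp add: vec_eq_iff)
  then have "wedge_det \<alpha> v = det (\<chi> j. \<Sum>e\<in>E. b (v j) e *s (\<chi> i. \<alpha> i e))"
    unfolding wedge_det_rows by simp
  also have "\<dots> = (\<Sum>I\<in>tuples E. (\<Prod>j\<in>UNIV. b (v j) (I j)) * wedge_det \<alpha> I)"
    unfolding det_sum_rows[OF fin] det_rows_mul wedge_det_rows ..
  finally have "\<bar>wedge_det \<alpha> v\<bar> = \<bar>\<Sum>I\<in>tuples E. (\<Prod>j\<in>UNIV. b (v j) (I j)) * wedge_det \<alpha> I\<bar>"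
    by simp
  also have "\<dots> \<le> (\<Sum>I\<in>tuples E. \<bar>\<Prod>j\<in>UNIV. b (v j) (I j)\<bar> * \<bar>wedge_det \<alpha> I\<bar>)"
    by (rule order_trans[OF sum_abs]) (simp add: abs_mult)
  also have "\<dots> \<le> L2_set (\<lambda>I. \<Prod>j\<in>UNIV. b (v j) (I j)) (tuples E) * L2_set (wedge_det \<alpha>) (tuples E)"
    by (rule L2_set_mult_ineq)
  also have "L2_set (\<lambda>I. \<Prod>j\<in>UNIV. b (v j) (I j)) (tuples E) = (\<Prod>i\<in>UNIV. sqrt (b (v i) (v i)))"
  proof -
    have "(\<Sum>I\<in>tuples E. (\<Prod>j\<in>UNIV. b (v j) (I j))\<^sup>2) = (\<Prod>j\<in>UNIV. \<Sum>e\<in>E. (b (v j) e)\<^sup>2)"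
      unfolding tuples_eq_PiE by (subst prod_sum_PiE) (use fin in \<open>auto simp: prod_power_distrib\<close>)
    also have "\<dots> = (\<Prod>j\<in>UNIV. b (v j) (v j))"
    proof (intro prod.cong refl)
      fix j :: 'k
      have "b (v j) (v j) = (\<Sum>e\<in>E. b (v j) e * b (v j) e)"
        by (rule orthonormal_basis_parseval[OF _ E]) (use b in \<open>simp add: inner_form_def\<close>)
      then show "(\<Sum>e\<in>E. (b (v j) e)\<^sup>2) = b (v j) (v j)" by (simp add: power2_eq_square)
    qed
    finally show ?thesis by (simp add: L2_set_def sqrt_prod)
  qed
  also have "L2_set (wedge_det \<alpha>) (tuples E) = sqrt (fact CARD('k)) * wedge_norm b \<alpha>"
    unfolding wedge_norm_orthonormal[OF b E \<alpha>] L2_set_def by (simp flip: real_sqrt_mult)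
  finally show ?thesis by (simp add: mult_ac)
qed

text \<open>Hadamard bounds each component of the pulled-back wedge on an orthonormal tuple, its
  factorial cancels against the normalization, and the number of tuples gives the power of the
  dimension. The metrics enter the constant through \<open>\<kappa>\<close> alone.\<close>

lemma wedge_norm_compose_le:
  fixes \<alpha> :: "'k::finite \<Rightarrow> 'e::finite_dim_inner \<Rightarrow> real" and L :: "'f::finite_dim_inner \<Rightarrow> 'e"
  assumes b: "inner_form b" and b': "inner_form b'" and \<alpha>: "\<And>i. linear (\<alpha> i)" and L: "linear L"
    and le: "\<And>v. b (L v) (L v) \<le> \<kappa>\<^sup>2 * b' v v" and "0 \<le> \<kappa>"
  shows "wedge_norm b' (\<lambda>i v. \<alpha> i (L v)) \<le> sqrt (real (dim (UNIV :: 'f set) ^ CARD('k))) * \<kappa> ^ CARD('k) * wedge_norm b \<alpha>"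
proof -
  obtain E where E: "orthonormal_basis b' E" using orthonormal_basis_exists[OF b'] .
  have fin: "finite E" and on: "\<And>e. e \<in> E \<Longrightarrow> b' e e = 1"
    using E by (auto simp: orthonormal_basis_def)
  have lin: "linear (\<lambda>v. \<alpha> i (L v))" for i using linear_compose[OF L \<alpha>] by (simp add: o_def)
  let ?w = "wedge_norm b \<alpha>"
  have w: "0 \<le> ?w" by (rule wedge_norm_nonneg[OF b \<alpha>])
  let ?c = "fact CARD('k) * (\<kappa> ^ CARD('k) * ?w)\<^sup>2 :: real"
  have "(wedge_det (\<lambda>i v. \<alpha> i (L v)) I)\<^sup>2 \<le> ?c" if I: "I \<in> tuples E" for I
  proof -
    have "\<bar>wedge_det \<alpha> (\<lambda>i. L (I i))\<bar> \<le> sqrt (fact CARD('k)) * ?w * (\<Prod>i\<in>UNIV. sqrt (b (L (I i)) (L (I i))))"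
      by (rule hadamard_bound[OF b \<alpha>])
    also have "(\<Prod>i\<in>UNIV. sqrt (b (L (I i)) (L (I i)))) \<le> (\<Prod>i\<in>(UNIV :: 'k set). \<kappa>)"
    proof (rule prod_mono)
      fix i :: 'k
      have "sqrt (b (L (I i)) (L (I i))) \<le> \<kappa>"
        using le[of "I i"] on[of "I i"] I \<open>0 \<le> \<kappa>\<close> by (intro real_le_lsqrt) auto
      moreover have "0 \<le> b (L (I i)) (L (I i))"
        using b by (cases "L (I i) = 0") (auto simp: inner_form_def bilinear_def linear_0 less_imp_le)
      ultimately show "0 \<le> sqrt (b (L (I i)) (L (I i))) \<and> sqrt (b (L (I i)) (L (I i))) \<le> \<kappa>" by simp
    qed
    finally have "\<bar>wedge_det \<alpha> (\<lambda>i. L (I i))\<bar> \<le> sqrt (fact CARD('k)) * ?w * (\<Prod>i\<in>(UNIV :: 'k set). \<kappa>)"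
      using w by (simp add: mult_left_mono)
    then have "\<bar>wedge_det \<alpha> (\<lambda>i. L (I i))\<bar> \<le> sqrt (fact CARD('k)) * (\<kappa> ^ CARD('k) * ?w)"
      by (simp add: mult_ac)
    then have "(wedge_det \<alpha> (\<lambda>i. L (I i)))\<^sup>2 \<le> (sqrt (fact CARD('k)) * (\<kappa> ^ CARD('k) * ?w))\<^sup>2"
      by (rule power2_le_iff_abs_le[THEN iffD2, rotated]) (use w \<open>0 \<le> \<kappa>\<close> in auto)
    then show ?thesis by (simp add: power_mult_distrib)
  qed
  then have "(\<Sum>I\<in>tuples E. (wedge_det (\<lambda>i v. \<alpha> i (L v)) I)\<^sup>2) \<le> (\<Sum>I\<in>(tuples E :: ('k \<Rightarrow> 'f) set). ?c)"
    by (intro sum_mono)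
  also have "\<dots> = real (dim (UNIV :: 'f set) ^ CARD('k)) * ?c"
    unfolding tuples_eq_PiE using orthonormal_basis_card[OF _ E] b'
    by (simp add: card_PiE inner_form_def)
  finally have "(\<Sum>I\<in>tuples E. (wedge_det (\<lambda>i v. \<alpha> i (L v)) I)\<^sup>2) / fact CARD('k)
      \<le> real (dim (UNIV :: 'f set) ^ CARD('k)) * (\<kappa> ^ CARD('k) * ?w)\<^sup>2"
    by (simp add: divide_le_eq mult_ac)
  then have "wedge_norm b' (\<lambda>i v. \<alpha> i (L v))
      \<le> sqrt (real (dim (UNIV :: 'f set) ^ CARD('k)) * (\<kappa> ^ CARD('k) * ?w)\<^sup>2)"
    unfolding wedge_norm_orthonormal[OF b' E lin] by (rule real_sqrt_le_mono)
  also have "\<dots> = sqrt (real (dim (UNIV :: 'f set) ^ CARD('k))) * \<kappa> ^ CARD('k) * ?w"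
    using w \<open>0 \<le> \<kappa>\<close> unfolding real_sqrt_mult by (simp add: real_sqrt_unique)
  finally show ?thesis .
qed

lemma inner_form_compose:
  assumes b: "inner_form b" and T: "linear T" "inj T"
  shows "inner_form (\<lambda>v w. b (T v) (T w))"
proof -
  have "linear (b x)" "linear (\<lambda>y. b y x)" for x using b by (auto simp: inner_form_def bilinear_def)
  then have "bilinear (\<lambda>v w. b (T v) (T w))"
    unfolding bilinear_def using linear_compose[OF T(1)] by (auto simp: o_def)
  moreover have "T v \<noteq> 0" if "v \<noteq> 0" for v
    using that T linear_injective_0[OF T(1)] by blast
  ultimately show ?thesis using b by (auto simp: inner_form_def)
qed

text \<open>The inverse of \<open>T\<close> carries an orthonormal basis of \<open>b\<close> to one
  of the transported form, and the cometric is a sum over such a basis. For \<open>T\<close> the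
  derivative of a change of charts this makes Jacobians computable in any chart.\<close>

lemma wedge_norm_bij:
  fixes \<alpha> :: "'k::finite \<Rightarrow> 'e::finite_dim_inner \<Rightarrow> real" and T :: "'e \<Rightarrow> 'e"
  assumes b: "inner_form b" and T: "linear T" "bij T" and \<alpha>: "\<And>i. linear (\<alpha> i)"
  shows "wedge_norm (\<lambda>v w. b (T v) (T w)) (\<lambda>i v. \<alpha> i (T v)) = wedge_norm b \<alpha>"
proof -
  let ?b = "\<lambda>v w. b (T v) (T w)"
  obtain E where E: "orthonormal_basis b E" using orthonormal_basis_exists[OF b] .
  have inj: "inj T" using T(2) by (rule bij_is_inj)
  obtain U where U: "linear U" "\<And>x. U (T x) = x" "\<And>x. T (U x) = x"
  proof -
    obtain U where U: "linear U" "U \<circ> T = id"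
      using linear_injective_left_inverse[OF T(1) inj] by blast
    have UT: "U (T x) = x" for x using U(2) by (simp add: fun_eq_iff)
    have "T (U x) = x" for x
    proof -
      obtain y where "x = T y" using T(2) by (blast elim: bij_pointE)
      then show ?thesis using UT by simp
    qed
    with U(1) UT show thesis by (rule that)
  qed
  have injU: "inj U" using U(3) by (rule inj_on_inverseI)
  have b': "inner_form ?b" by (rule inner_form_compose[OF b T(1) inj])
  have "orthonormal_basis ?b (U ` E)"
    unfolding orthonormal_basis_def
  proof (intro conjI allI ballI)
    show "finite (U ` E)" using E by (simp add: orthonormal_basis_def)
    show "?b e e' = (if e = e' then 1 else 0)" if "e \<in> U ` E" "e' \<in> U ` E" for e e'
      using that E injU by (auto simp: orthonormal_basis_def U inj_eq)
    show "x = (\<Sum>e\<in>U ` E. ?b x e *\<^sub>R e)" for x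
    proof -
      have "(\<Sum>e\<in>U ` E. ?b x e *\<^sub>R e) = (\<Sum>e\<in>E. b (T x) e *\<^sub>R U e)"
        by (subst sum.reindex) (use injU in \<open>auto simp: inj_on_def U\<close>)
      also have "\<dots> = U (\<Sum>e\<in>E. b (T x) e *\<^sub>R e)" by (simp add: linear_sum[OF U(1)] linear_scale[OF U(1)])
      also have "\<dots> = x" using orthonormal_basis_expand[OF E, of "T x"] U(2) by simp
      finally show ?thesis by simp
    qed
  qed
  note UE = this
  have lin: "linear (\<lambda>v. \<alpha> i (T v))" for i using linear_compose[OF T(1) \<alpha>] by (simp add: o_def)
  have "cometric ?b (\<lambda>v. \<alpha> i (T v)) (\<lambda>v. \<alpha> j (T v)) = cometric b (\<alpha> i) (\<alpha> j)" for i j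
  proof -
    have "cometric ?b (\<lambda>v. \<alpha> i (T v)) (\<lambda>v. \<alpha> j (T v)) = (\<Sum>e\<in>U ` E. \<alpha> i (T e) * \<alpha> j (T e))"
      by (rule cometric_orthonormal[OF b' UE lin lin])
    also have "\<dots> = (\<Sum>e\<in>E. \<alpha> i e * \<alpha> j e)"
      by (subst sum.reindex) (use injU in \<open>auto simp: inj_on_def U\<close>)
    also have "\<dots> = cometric b (\<alpha> i) (\<alpha> j)"
      by (rule cometric_orthonormal[OF b E \<alpha> \<alpha>, symmetric])
    finally show ?thesis .
  qed
  then show ?thesis unfolding wedge_norm_def by simp
qed


subsection \<open>Continuous dependence on the inner product\<close>

text \<open>In a basis orthonormal for the limit form, the Gram matrix of \<open>b z\<close> tends
  to the identity, and the coordinates \<open>y z\<close> of the vector representing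
  \<open>\<beta> z\<close> solve a linear system with this matrix. A perturbation estimate around
  the identity replaces its inversion.\<close>

lemma tendsto_cometric:
  fixes b0 :: "'e::finite_dim_inner \<Rightarrow> 'e \<Rightarrow> real"
  assumes b: "\<And>z. inner_form (b z)" and b0: "inner_form b0" and E: "orthonormal_basis b0 E"
    and bz: "\<And>v w. ((\<lambda>z. b z v w) \<longlongrightarrow> b0 v w) G"
    and \<alpha>: "\<And>z. linear (\<alpha> z)" "\<And>v. ((\<lambda>z. \<alpha> z v) \<longlongrightarrow> \<alpha>0 v) G" "linear \<alpha>0"
    and \<beta>: "\<And>z. linear (\<beta> z)" "\<And>v. ((\<lambda>z. \<beta> z v) \<longlongrightarrow> \<beta>0 v) G" "linear \<beta>0"
  shows "((\<lambda>z. cometric (b z) (\<alpha> z) (\<beta> z)) \<longlongrightarrow> cometric b0 \<alpha>0 \<beta>0) G"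
proof -
  have fin: "finite E" and on: "\<And>e e'. e \<in> E \<Longrightarrow> e' \<in> E \<Longrightarrow> b0 e e' = (if e = e' then 1 else 0)"
    using E by (auto simp: orthonormal_basis_def)
  define y where "y z e = b0 (sharp (b z) (\<beta> z)) e" for z e
  define \<eta> where "\<eta> z = (\<Sum>e\<in>E. \<Sum>e'\<in>E. \<bar>b z e' e - (if e' = e then 1 else 0)\<bar>)" for z
  define S where "S z = (\<Sum>e\<in>E. \<bar>y z e\<bar>)" for z
  define B where "B z = (\<Sum>e\<in>E. \<bar>\<beta> z e\<bar>)" for z
  let ?n = "real (card E)"
  \<comment> \<open>The system reads \<open>y z e = \<beta> z e\<close> up to the deviation of the
    Gram matrix from the identity, measured by \<open>\<eta> z\<close>.\<close>
  have diff: "\<bar>\<beta> z e - y z e\<bar> \<le> \<eta> z * S z" if e: "e \<in> E" for z e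
  proof -
    have lin: "linear (\<lambda>x. b z x e)" using b[of z] by (auto simp: inner_form_def bilinear_def)
    have "\<beta> z e = b z (sharp (b z) (\<beta> z)) e" by (rule sharp_eq[OF b \<beta>(1), symmetric])
    also have "\<dots> = (\<Sum>e'\<in>E. y z e' * b z e' e)"
      using orthonormal_basis_linear[OF E lin, of "sharp (b z) (\<beta> z)"] by (simp add: y_def)
    finally have "\<beta> z e - y z e = (\<Sum>e'\<in>E. y z e' * b z e' e) - (\<Sum>e'\<in>E. if e' = e then y z e else 0)"
      using fin e by simp
    also have "\<dots> = (\<Sum>e'\<in>E. y z e' * (b z e' e - (if e' = e then 1 else 0)))"
      unfolding sum_subtractf[symmetric] by (intro sum.cong) (auto simp: algebra_simps)
    also have "\<bar>\<dots>\<bar> \<le> (\<Sum>e'\<in>E. \<eta> z * \<bar>y z e'\<bar>)"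
    proof (rule order_trans[OF sum_abs], rule sum_mono)
      fix e' assume e': "e' \<in> E"
      have "\<bar>b z e' e - (if e' = e then 1 else 0)\<bar> \<le> (\<Sum>e'\<in>E. \<bar>b z e' e - (if e' = e then 1 else 0)\<bar>)"
        using fin e' by (intro member_le_sum) auto
      also have "\<dots> \<le> \<eta> z"
        unfolding \<eta>_def using fin e
        by (intro member_le_sum[of e E "\<lambda>e. \<Sum>e'\<in>E. \<bar>b z e' e - (if e' = e then 1 else 0)\<bar>"]) (auto intro: sum_nonneg)
      finally show "\<bar>y z e' * (b z e' e - (if e' = e then 1 else 0))\<bar> \<le> \<eta> z * \<bar>y z e'\<bar>"
        unfolding abs_mult by (subst mult.commute) (intro mult_right_mono, auto)
    qed
    finally show ?thesis by (simp add: S_def sum_distrib_left)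
  qed
  have \<eta>: "(\<eta> \<longlongrightarrow> 0) G"
  proof -
    have "((\<lambda>z. \<bar>b z e' e - (if e' = e then 1 else 0)\<bar>) \<longlongrightarrow> 0) G" if "e \<in> E" "e' \<in> E" for e e'
      using tendsto_rabs[OF tendsto_diff[OF bz[of e' e] tendsto_const[of "b0 e' e"]]] on[OF that(2,1)] by simp
    then show ?thesis unfolding \<eta>_def by (intro tendsto_null_sum) auto
  qed
  \<comment> \<open>Summing the deviations over \<open>E\<close> gives
    \<open>S z \<le> B z + n * \<eta> z * S z\<close> with \<open>n\<close> the size of
    \<open>E\<close>; for \<open>n * \<eta> z \<le> 1 / 2\<close> the last term is absorbed on the
    left.\<close>
  have S: "S z \<le> 2 * B z" if "?n * \<eta> z \<le> 1 / 2" for z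
  proof -
    have "\<bar>y z e\<bar> \<le> \<bar>\<beta> z e\<bar> + \<eta> z * S z" if "e \<in> E" for e
      using diff[OF that, of z] by linarith
    then have "(\<Sum>e\<in>E. \<bar>y z e\<bar>) \<le> (\<Sum>e\<in>E. \<bar>\<beta> z e\<bar> + \<eta> z * S z)" by (intro sum_mono)
    then have "S z \<le> (\<Sum>e\<in>E. \<bar>\<beta> z e\<bar> + \<eta> z * S z)" by (simp only: S_def)
    also have "\<dots> = B z + (?n * \<eta> z) * S z" by (simp add: sum.distrib B_def)
    also have "(?n * \<eta> z) * S z \<le> 1 / 2 * S z"
      using that by (intro mult_right_mono) (auto simp: S_def sum_nonneg)
    finally show ?thesis by simp
  qed
  have "((\<lambda>z. ?n * \<eta> z) \<longlongrightarrow> 0) G" using tendsto_mult_right_zero[OF \<eta>] by simp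
  then have ev: "\<forall>\<^sub>F z in G. ?n * \<eta> z < 1 / 2" by (rule order_tendstoD) simp
  have \<eta>0: "0 \<le> \<eta> z" for z by (auto simp: \<eta>_def intro!: sum_nonneg)
  have Bt: "(B \<longlongrightarrow> (\<Sum>e\<in>E. \<bar>\<beta>0 e\<bar>)) G" unfolding B_def by (intro tendsto_intros \<beta>)
  have y: "((\<lambda>z. y z e) \<longlongrightarrow> \<beta>0 e) G" if e: "e \<in> E" for e
  proof -
    have "((\<lambda>z. \<beta> z e - y z e) \<longlongrightarrow> 0) G"
    proof (rule Lim_null_comparison)
      show "\<forall>\<^sub>F z in G. norm (\<beta> z e - y z e) \<le> \<eta> z * (2 * B z)"
        using ev
      proof eventually_elim
        case (elim z)
        have "\<eta> z * S z \<le> \<eta> z * (2 * B z)" using S[of z] elim \<eta>0 by (intro mult_left_mono) auto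
        then show ?case using diff[OF e, of z] by simp
      qed
      show "((\<lambda>z. \<eta> z * (2 * B z)) \<longlongrightarrow> 0) G"
        using tendsto_mult[OF \<eta> tendsto_mult[OF tendsto_const[of 2] Bt]] by simp
    qed
    from tendsto_diff[OF \<beta>(2)[of e] this] show ?thesis by simp
  qed
  have "cometric (b z) (\<alpha> z) (\<beta> z) = (\<Sum>e\<in>E. y z e * \<alpha> z e)" for z
  proof -
    have "cometric (b z) (\<alpha> z) (\<beta> z) = \<alpha> z (sharp (b z) (\<beta> z))"
      unfolding cometric_def by (rule sharp_eq[OF b \<alpha>(1)])
    then show ?thesis using orthonormal_basis_linear[OF E \<alpha>(1), of _ "sharp (b z) (\<beta> z)"] by (simp add: y_def)
  qed
  moreover have "((\<lambda>z. \<Sum>e\<in>E. y z e * \<alpha> z e) \<longlongrightarrow> (\<Sum>e\<in>E. \<beta>0 e * \<alpha>0 e)) G"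
    by (intro tendsto_intros y \<alpha>)
  moreover have "cometric b0 \<alpha>0 \<beta>0 = (\<Sum>e\<in>E. \<beta>0 e * \<alpha>0 e)"
    using cometric_orthonormal[OF b0 E \<alpha>(3) \<beta>(3)] by (simp add: mult.commute)
  ultimately show ?thesis by simp
qed

lemma tendsto_det:
  fixes a :: "'z \<Rightarrow> 'k::finite \<Rightarrow> 'k \<Rightarrow> real"
  assumes "\<And>i j. ((\<lambda>z. a z i j) \<longlongrightarrow> a0 i j) G"
  shows "((\<lambda>z. det (\<chi> i j. a z i j)) \<longlongrightarrow> det (\<chi> i j. a0 i j)) G"
  unfolding det_def by (simp, intro tendsto_intros assms)

lemma tendsto_wedge_norm:
  fixes b0 :: "'e::finite_dim_inner \<Rightarrow> 'e \<Rightarrow> real" and \<alpha> :: "'z \<Rightarrow> 'k::finite \<Rightarrow> 'e \<Rightarrow> real"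
  assumes "\<And>z. inner_form (b z)" and b0: "inner_form b0"
    and "\<And>v w. ((\<lambda>z. b z v w) \<longlongrightarrow> b0 v w) G"
    and "\<And>z i. linear (\<alpha> z i)" "\<And>i v. ((\<lambda>z. \<alpha> z i v) \<longlongrightarrow> \<alpha>0 i v) G" "\<And>i. linear (\<alpha>0 i)"
  shows "((\<lambda>z. wedge_norm (b z) (\<alpha> z)) \<longlongrightarrow> wedge_norm b0 \<alpha>0) G"
proof -
  obtain E where E: "orthonormal_basis b0 E" using orthonormal_basis_exists[OF b0] .
  show ?thesis
    unfolding wedge_norm_def by (intro tendsto_real_sqrt tendsto_det tendsto_cometric[OF _ b0 E] assms)
qed

text \<open>Convergence of finitely many matrix entries becomes a comparison uniform in
  \<open>v\<close>: the quadratic forms differ by at most \<open>\<eta> z * b0 v v\<close>, and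
  \<open>\<eta> z < 1 / 2\<close> leaves room for the factor 2 in both directions.\<close>

lemma eventually_inner_form_bounds:
  fixes b0 :: "'e::finite_dim_inner \<Rightarrow> 'e \<Rightarrow> real"
  assumes b: "\<And>z. inner_form (b z)" and b0: "inner_form b0"
    and bz: "\<And>v w. ((\<lambda>z. b z v w) \<longlongrightarrow> b0 v w) G"
  shows "\<forall>\<^sub>F z in G. \<forall>v. b0 v v \<le> 2 * b z v v \<and> b z v v \<le> 2 * b0 v v"
proof -
  obtain E where E: "orthonormal_basis b0 E" using orthonormal_basis_exists[OF b0] .
  have fin: "finite E" and on: "\<And>e e'. e \<in> E \<Longrightarrow> e' \<in> E \<Longrightarrow> b0 e e' = (if e = e' then 1 else 0)"
    using E by (auto simp: orthonormal_basis_def)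
  define \<eta> where "\<eta> z = (\<Sum>e\<in>E. \<Sum>e'\<in>E. \<bar>b z e e' - b0 e e'\<bar>)" for z
  have "((\<lambda>z. \<bar>b z e e' - b0 e e'\<bar>) \<longlongrightarrow> 0) G" for e e'
    using tendsto_rabs[OF tendsto_diff[OF bz[of e e'] tendsto_const[of "b0 e e'"]]] by simp
  then have "(\<eta> \<longlongrightarrow> 0) G" unfolding \<eta>_def by (intro tendsto_null_sum) auto
  then have "\<forall>\<^sub>F z in G. \<eta> z < 1 / 2" by (rule order_tendstoD) simp
  moreover have "b0 v v \<le> 2 * b z v v \<and> b z v v \<le> 2 * b0 v v" if \<eta>: "\<eta> z < 1 / 2" for z v
  proof -
    have bil: "bilinear b0" using b0 by (simp add: inner_form_def)
    have pars: "b0 v v = (\<Sum>e\<in>E. b0 v e * b0 v e)" by (rule orthonormal_basis_parseval[OF bil E])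
    have coord: "\<bar>b0 v e\<bar> \<le> sqrt (b0 v v)" if "e \<in> E" for e
    proof -
      have "b0 v e * b0 v e \<le> b0 v v"
        unfolding pars using fin that by (intro member_le_sum[of e E "\<lambda>e. b0 v e * b0 v e"]) auto
      then show ?thesis by (intro real_le_rsqrt) (simp add: power2_eq_square)
    qed
    have nn: "0 \<le> b0 v v" unfolding pars by (intro sum_nonneg) auto
    have expand: "c v v = (\<Sum>e\<in>E. \<Sum>e'\<in>E. b0 v e * b0 v e' * c e e')" if c: "bilinear c" for c
    proof -
      have lin: "linear (\<lambda>x. c x v)" "linear (c x)" for x using c by (auto simp: bilinear_def)
      have "c v v = (\<Sum>e\<in>E. b0 v e * c e v)"
        using orthonormal_basis_linear[OF E lin(1), of v] by simp
      also have "\<dots> = (\<Sum>e\<in>E. b0 v e * (\<Sum>e'\<in>E. b0 v e' * c e e'))"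
        using orthonormal_basis_linear[OF E lin(2), of _ v] by (intro sum.cong) simp_all
      finally show ?thesis by (simp add: sum_distrib_left mult_ac)
    qed
    have "bilinear (b z)" using b[of z] by (simp add: inner_form_def)
    then have "b z v v - b0 v v = (\<Sum>e\<in>E. \<Sum>e'\<in>E. b0 v e * b0 v e' * (b z e e' - b0 e e'))"
      using expand[OF bil] expand[of "b z"] by (simp add: sum_subtractf right_diff_distrib)
    also have "\<bar>\<dots>\<bar> \<le> (\<Sum>e\<in>E. \<Sum>e'\<in>E. b0 v v * \<bar>b z e e' - b0 e e'\<bar>)"
    proof (intro order_trans[OF sum_abs] sum_mono)
      fix e e' assume e: "e \<in> E" "e' \<in> E"
      have "\<bar>b0 v e * b0 v e'\<bar> \<le> sqrt (b0 v v) * sqrt (b0 v v)"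
        unfolding abs_mult using nn by (intro mult_mono coord e) auto
      then show "\<bar>b0 v e * b0 v e' * (b z e e' - b0 e e')\<bar> \<le> b0 v v * \<bar>b z e e' - b0 e e'\<bar>"
        using nn by (simp add: abs_mult mult_right_mono)
    qed
    also have "\<dots> = \<eta> z * b0 v v" by (simp add: \<eta>_def sum_distrib_right sum_distrib_left mult.commute)
    also have "\<dots> \<le> 1 / 2 * b0 v v" using \<eta> nn by (intro mult_right_mono) auto
    finally have "\<bar>b z v v - b0 v v\<bar> \<le> 1 / 2 * b0 v v" .
    then have "b z v v - b0 v v \<le> 1 / 2 * b0 v v" "- (b z v v - b0 v v) \<le> 1 / 2 * b0 v v"
      by (simp_all only: abs_le_iff)
    then show ?thesis using nn by linarith
  qed
  ultimately show ?thesis by (auto elim: eventually_mono)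
qed

text \<open>The sum over \<open>E\<close> is the squared Hilbert-Schmidt norm of \<open>L\<close>,
  an upper bound for the squared operator norm by Cauchy-Schwarz. It involves finitely many vectors,
  so it varies continuously when \<open>L\<close> does so pointwise.\<close>

lemma inner_form_linear_image_le:
  fixes b' :: "'f::finite_dim_inner \<Rightarrow> 'f \<Rightarrow> real"
  assumes b: "inner_form (b :: 'e::finite_dim_inner \<Rightarrow> 'e \<Rightarrow> real)" and b': "inner_form b'" and E: "orthonormal_basis b' E"
    and L: "linear L"
  shows "b (L v) (L v) \<le> (\<Sum>e\<in>E. b (L e) (L e)) * b' v v"
proof -
  obtain D where D: "orthonormal_basis b D" using orthonormal_basis_exists[OF b] .
  have bil: "bilinear b" "bilinear b'" using b b' by (auto simp: inner_form_def)
  have lin: "linear (\<lambda>x. b x d)" for d using bil by (auto simp: bilinear_def)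
  have "b (L v) (L v) = (\<Sum>d\<in>D. (b (L v) d)\<^sup>2)"
    using orthonormal_basis_parseval[OF bil(1) D, of "L v" "L v"] by (simp add: power2_eq_square)
  also have "\<dots> \<le> (\<Sum>d\<in>D. (\<Sum>e\<in>E. (b' v e)\<^sup>2) * (\<Sum>e\<in>E. (b (L e) d)\<^sup>2))"
  proof (rule sum_mono)
    fix d
    have "linear (\<lambda>v. b (L v) d)" using linear_compose[OF L lin] by (simp add: o_def)
    then have "b (L v) d = (\<Sum>e\<in>E. b' v e * b (L e) d)"
      using orthonormal_basis_linear[OF E, of "\<lambda>v. b (L v) d" v] by simp
    then show "(b (L v) d)\<^sup>2 \<le> (\<Sum>e\<in>E. (b' v e)\<^sup>2) * (\<Sum>e\<in>E. (b (L e) d)\<^sup>2)"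
      by (simp add: Cauchy_Schwarz_ineq_sum)
  qed
  also have "\<dots> = b' v v * (\<Sum>e\<in>E. \<Sum>d\<in>D. (b (L e) d)\<^sup>2)"
  proof -
    have "(\<Sum>e\<in>E. (b' v e)\<^sup>2) = b' v v"
      unfolding orthonormal_basis_parseval[OF bil(2) E, of v v] by (simp add: power2_eq_square)
    then show ?thesis by (subst sum.swap) (simp add: sum_distrib_left)
  qed
  also have "(\<Sum>e\<in>E. \<Sum>d\<in>D. (b (L e) d)\<^sup>2) = (\<Sum>e\<in>E. b (L e) (L e))"
  proof (intro sum.cong refl)
    fix e
    show "(\<Sum>d\<in>D. (b (L e) d)\<^sup>2) = b (L e) (L e)"
      using orthonormal_basis_parseval[OF bil(1) D, of "L e" "L e"] by (simp add: power2_eq_square)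
  qed
  finally show ?thesis by (simp add: mult.commute)
qed

section \<open>Calculus in charts\<close>

abbreviation coord_deriv :: "('a, 'e::real_normed_vector) chart \<Rightarrow> ('a \<Rightarrow> 'v::real_normed_vector) \<Rightarrow> 'a \<Rightarrow> 'e \<Rightarrow> 'v" where
  "coord_deriv c f p \<equiv> frechet_derivative (f \<circ> chart_inv c) (at (snd c p))"

abbreviation map_deriv :: "('s, 'f::real_normed_vector) chart \<Rightarrow> ('a, 'e::real_normed_vector) chart \<Rightarrow>
    ('s \<Rightarrow> 'a) \<Rightarrow> 's \<Rightarrow> 'f \<Rightarrow> 'e" where
  "map_deriv c d \<phi> q \<equiv> frechet_derivative (snd d \<circ> \<phi> \<circ> chart_inv c) (at (snd c q))"

lemma chart_at:
  assumes "smooth_atlas A"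
  shows "chart_at A p \<in> A" "p \<in> fst (chart_at A p)"
proof -
  have "\<exists>c. c \<in> A \<and> p \<in> fst c" using assms unfolding smooth_atlas_def by blast
  from someI_ex[OF this] show "chart_at A p \<in> A" "p \<in> fst (chart_at A p)"
    unfolding chart_at_def by blast+
qed

lemma chart_props:
  assumes "smooth_atlas A" "c \<in> A"
  shows "open (fst c)" "open (snd c ` fst c)" "continuous_on (fst c) (snd c)"
    "continuous_on (snd c ` fst c) (chart_inv c)" "\<And>p. p \<in> fst c \<Longrightarrow> chart_inv c (snd c p) = p"
    "\<And>x. x \<in> snd c ` fst c \<Longrightarrow> chart_inv c x \<in> fst c"
proof -
  have *: "open (fst c) \<and> open (snd c ` fst c) \<and>
        homeomorphism (fst c) (snd c ` fst c) (snd c) (chart_inv c)"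
    using assms unfolding smooth_atlas_def by blast
  then show "open (fst c)" "open (snd c ` fst c)" "continuous_on (fst c) (snd c)"
    "continuous_on (snd c ` fst c) (chart_inv c)" "\<And>p. p \<in> fst c \<Longrightarrow> chart_inv c (snd c p) = p"
    "\<And>x. x \<in> snd c ` fst c \<Longrightarrow> chart_inv c x \<in> fst c"
    unfolding homeomorphism_def by auto
qed

lemma open_chart_image:
  assumes "smooth_atlas A" "c \<in> A" "open U" "U \<subseteq> fst c"
  shows "open (snd c ` U)"
proof -
  have "snd c ` U = chart_inv c -` U \<inter> snd c ` fst c"
    using chart_props(5)[OF assms(1,2)] assms(4) by (auto simp: image_iff subset_iff)
  then show ?thesis
    using chart_props(2,4)[OF assms(1,2)] assms(3) by (simp add: continuous_on_open_vimage)
qed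

lemma smooth_map_id: "smooth_atlas A \<Longrightarrow> smooth_map A A id"
  by (auto simp: smooth_atlas_def smooth_map_def)

text \<open>The two coordinate expressions agree only where \<open>\<psi>\<close> stays in the
  domain of \<open>d\<close>; this set is open, so the chain rule carries over. The case
  \<open>\<psi> = id\<close> covers changes of charts.\<close>

lemma has_derivative_chart_compose:
  assumes A': "smooth_atlas A'" "c \<in> A'" and A: "smooth_atlas A" "d \<in> A"
    and \<psi>: "continuous_on UNIV \<psi>" and q: "q \<in> fst c" "\<psi> q \<in> fst d"
    and L: "((snd d \<circ> \<psi> \<circ> chart_inv c) has_derivative L) (at (snd c q))"
    and D: "((f \<circ> chart_inv d) has_derivative D) (at (snd d (\<psi> q)))"
  shows "((f \<circ> \<psi> \<circ> chart_inv c) has_derivative (D \<circ> L)) (at (snd c q))"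
proof (rule has_derivative_transform_within_open)
  let ?U = "fst c \<inter> \<psi> -` fst d"
  have "open ?U" using chart_props(1)[OF A'] chart_props(1)[OF A] \<psi>
    by (metis Int_UNIV_right continuous_on_open_vimage open_Int open_UNIV)
  then show "open (snd c ` ?U)" by (rule open_chart_image[OF A']) blast
  show "snd c q \<in> snd c ` ?U" using q by blast
  have "((f \<circ> chart_inv d) has_derivative D) (at ((snd d \<circ> \<psi> \<circ> chart_inv c) (snd c q)))"
    using D chart_props(5)[OF A' q(1)] by simp
  from diff_chain_at[OF L this]
  show "((f \<circ> chart_inv d) \<circ> (snd d \<circ> \<psi> \<circ> chart_inv c) has_derivative (D \<circ> L)) (at (snd c q))" .
  show "((f \<circ> chart_inv d) \<circ> (snd d \<circ> \<psi> \<circ> chart_inv c)) x = (f \<circ> \<psi> \<circ> chart_inv c) x"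
    if "x \<in> snd c ` ?U" for x
    using that by (auto simp: chart_props(5)[OF A'] chart_props(5)[OF A])
qed

text \<open>The limit is along \<open>nhds p\<close>, not punctured, so that it can be composed with
  any function tending to \<open>p\<close>, also one that takes the value \<open>p\<close>.\<close>

lemma tendsto_chart:
  assumes "smooth_atlas A" "c \<in> A" "open U" "U \<subseteq> fst c" "p \<in> U" "continuous_on (snd c ` U) h"
  shows "((\<lambda>p. h (snd c p)) \<longlongrightarrow> h (snd c p)) (nhds p)"
proof -
  have "continuous_on U (snd c)" using chart_props(3)[OF assms(1,2)] assms(4) by (rule continuous_on_subset)
  from continuous_on_compose[OF this assms(6)] have "isCont (h \<circ> snd c) p"
    using assms(3,5) by (simp add: continuous_on_eq_continuous_at del: o_apply flip: o_def)
  then show ?thesis unfolding isCont_def o_def by (rule tendsto_at_iff_tendsto_nhds[THEN iffD1])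
qed

lemma smooth_map_deriv:
  assumes A': "smooth_atlas A'" "c \<in> A'" and A: "smooth_atlas A" "d \<in> A"
    and \<phi>: "smooth_map A' A \<phi>" and q: "q \<in> fst c" "\<phi> q \<in> fst d"
  shows "((snd d \<circ> \<phi> \<circ> chart_inv c) has_derivative map_deriv c d \<phi> q) (at (snd c q))"
    and "((\<lambda>q. map_deriv c d \<phi> q v) \<longlongrightarrow> map_deriv c d \<phi> q v) (nhds q)"
proof -
  let ?U = "fst c \<inter> \<phi> -` fst d"
  have cont: "continuous_on UNIV \<phi>" and "smooth_on (snd d \<circ> \<phi> \<circ> chart_inv c) (snd c ` ?U)"
    using \<phi> A'(2) A(2) by (auto simp: smooth_map_def)
  then have Ck: "Ck_on (Suc 0) (snd d \<circ> \<phi> \<circ> chart_inv c) (snd c ` ?U)" unfolding smooth_on_def by blast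
  have "(snd d \<circ> \<phi> \<circ> chart_inv c) differentiable at (snd c q)" using Ck q by (auto simp del: o_apply)
  then show "((snd d \<circ> \<phi> \<circ> chart_inv c) has_derivative map_deriv c d \<phi> q) (at (snd c q))"
    by (simp add: frechet_derivative_works)
  have "open ?U" using chart_props(1)[OF A'] chart_props(1)[OF A] cont
    by (metis Int_UNIV_right continuous_on_open_vimage open_Int open_UNIV)
  moreover have "continuous_on (snd c ` ?U) (\<lambda>x. frechet_derivative (snd d \<circ> \<phi> \<circ> chart_inv c) (at x) v)"
    using Ck by simp
  ultimately show "((\<lambda>q. map_deriv c d \<phi> q v) \<longlongrightarrow> map_deriv c d \<phi> q v) (nhds q)"
    using q by (intro tendsto_chart[OF A', of ?U]) (assumption | blast)+
qed

lemma C1_deriv: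
  assumes A: "smooth_atlas A" "c \<in> A" and f: "f \<in> C1_maps A" and p: "p \<in> fst c"
  shows "((f \<circ> chart_inv c) has_derivative coord_deriv c f p) (at (snd c p))"
    and "((\<lambda>p. coord_deriv c f p v) \<longlongrightarrow> coord_deriv c f p v) (nhds p)"
    and "(f \<longlongrightarrow> f p) (nhds p)"
proof -
  have Ck: "Ck_on (Suc 0) (f \<circ> chart_inv c) (snd c ` fst c)" using f A(2) by (simp add: C1_maps_def)
  then have "(f \<circ> chart_inv c) differentiable at (snd c p)" using p by (auto simp del: o_apply)
  then show *: "((f \<circ> chart_inv c) has_derivative coord_deriv c f p) (at (snd c p))"
    by (simp add: frechet_derivative_works)
  have "continuous_on (snd c ` fst c) (\<lambda>x. frechet_derivative (f \<circ> chart_inv c) (at x) v)"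
    using Ck by simp
  then show "((\<lambda>p. coord_deriv c f p v) \<longlongrightarrow> coord_deriv c f p v) (nhds p)"
    using p chart_props(1)[OF A] by (intro tendsto_chart[OF A, of "fst c"]) (assumption | blast)+
  have "continuous_on (snd c ` fst c) (f \<circ> chart_inv c)"
    using Ck by (auto intro!: continuous_at_imp_continuous_on differentiable_imp_continuous_within simp del: o_apply)
  then have "((\<lambda>p. (f \<circ> chart_inv c) (snd c p)) \<longlongrightarrow> (f \<circ> chart_inv c) (snd c p)) (nhds p)"
    using p chart_props(1)[OF A] by (intro tendsto_chart[OF A, of "fst c"]) auto
  moreover have "\<forall>\<^sub>F p in nhds p. (f \<circ> chart_inv c) (snd c p) = f p"
    using eventually_nhds_in_open[OF chart_props(1)[OF A] p]
    by eventually_elim (simp add: chart_props(5)[OF A])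
  ultimately show "(f \<longlongrightarrow> f p) (nhds p)"
    using chart_props(5)[OF A p] by (simp add: filterlim_cong)
qed

lemma linear_coord_deriv:
  assumes "smooth_atlas A" "c \<in> A" "f \<in> C1_maps A" "p \<in> fst c"
  shows "linear (coord_deriv c f p)"
  using C1_deriv(1)[OF assms] by (rule has_derivative_linear)

lemma coord_deriv_compose:
  assumes A': "smooth_atlas A'" "c \<in> A'" and A: "smooth_atlas A" "d \<in> A"
    and \<phi>: "smooth_map A' A \<phi>" and q: "q \<in> fst c" "\<phi> q \<in> fst d" and f: "f \<in> C1_maps A"
  shows "((f \<circ> \<phi> \<circ> chart_inv c) has_derivative (coord_deriv d f (\<phi> q) \<circ> map_deriv c d \<phi> q)) (at (snd c q))"
    and "coord_deriv c (f \<circ> \<phi>) q = coord_deriv d f (\<phi> q) \<circ> map_deriv c d \<phi> q"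
proof -
  have cont: "continuous_on UNIV \<phi>" using \<phi> by (simp add: smooth_map_def)
  show "((f \<circ> \<phi> \<circ> chart_inv c) has_derivative (coord_deriv d f (\<phi> q) \<circ> map_deriv c d \<phi> q)) (at (snd c q))"
    by (rule has_derivative_chart_compose[OF A' A cont q smooth_map_deriv(1)[OF A' A \<phi> q] C1_deriv(1)[OF A f q(2)]])
  from frechet_derivative_at[OF this]
  show "coord_deriv c (f \<circ> \<phi>) q = coord_deriv d f (\<phi> q) \<circ> map_deriv c d \<phi> q" by simp
qed

text \<open>The chain rule for the change from \<open>c\<close> to \<open>d\<close> and back, which
  is the identity on an open set of coordinates.\<close>

lemma map_deriv_id_inverse:
  assumes A: "smooth_atlas A" "c \<in> A" "d \<in> A" and p: "p \<in> fst c" "p \<in> fst d"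
  shows "map_deriv d c id p (map_deriv c d id p v) = v"
proof -
  have D: "((snd c \<circ> chart_inv d) has_derivative map_deriv d c id p) (at (snd d (id p)))"
    using smooth_map_deriv(1)[OF A(1,3) A(1,2) smooth_map_id[OF A(1)] p(2)] p by simp
  have L: "((snd d \<circ> id \<circ> chart_inv c) has_derivative map_deriv c d id p) (at (snd c p))"
    using smooth_map_deriv(1)[OF A(1,2) A(1,3) smooth_map_id[OF A(1)] p(1)] p by simp
  have "((snd c \<circ> id \<circ> chart_inv c) has_derivative (map_deriv d c id p \<circ> map_deriv c d id p)) (at (snd c p))"
    by (rule has_derivative_chart_compose[OF A(1,2) A(1,3) _ p(1) _ L D]) (use p in auto)
  moreover have "((snd c \<circ> id \<circ> chart_inv c) has_derivative (\<lambda>v. v)) (at (snd c p))"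
  proof (rule has_derivative_transform_within_open[OF has_derivative_ident chart_props(2)[OF A(1,2)]])
    show "snd c p \<in> snd c ` fst c" using p by blast
    show "x = (snd c \<circ> id \<circ> chart_inv c) x" if "x \<in> snd c ` fst c" for x
      using that chart_props(5)[OF A(1,2)] by auto
  qed
  ultimately have "map_deriv d c id p \<circ> map_deriv c d id p = (\<lambda>v. v)"
    by (rule has_derivative_unique)
  then show ?thesis by (simp add: fun_eq_iff)
qed

text \<open>A change of charts is the identity map read in two charts, so that the results on smooth
  maps apply to it.\<close>

lemma from_chart_eq: "from_chart A c p = map_deriv c (chart_at A p) id p"
  by (simp add: from_chart_def)

lemma from_chart_linear_bij:
  assumes A: "smooth_atlas A" "c \<in> A" and p: "p \<in> fst c"
  shows "linear (from_chart A c p)" "bij (from_chart A c p)"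
proof -
  note d = chart_at[OF A(1), of p]
  show "linear (from_chart A c p)"
    unfolding from_chart_eq
    by (rule has_derivative_linear[OF smooth_map_deriv(1)[OF A A(1) d(1) smooth_map_id[OF A(1)] p]]) (simp add: d)
  show "bij (from_chart A c p)"
    unfolding from_chart_eq
    by (rule bij_betw_byWitness[where f' = "map_deriv (chart_at A p) c id p"])
      (use map_deriv_id_inverse[OF A d(1) p d(2)] map_deriv_id_inverse[OF A(1) d(1) A(2) d(2) p] in auto)
qed

lemma coord_deriv_from_chart:
  assumes A: "smooth_atlas A" "c \<in> A" and p: "p \<in> fst c" and f: "f \<in> C1_maps A"
  shows "coord_deriv c f p v = dfun A f p (from_chart A c p v)"
proof -
  note d = chart_at[OF A(1), of p]
  show ?thesis
    using coord_deriv_compose(2)[OF A A(1) d(1) smooth_map_id[OF A(1)] p _ f] d(2)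
    by (simp add: dfun_def from_chart_eq fun_eq_iff)
qed

lemma dfun_compose:
  assumes "smooth_atlas A'" "smooth_atlas A" "smooth_map A' A \<phi>" "f \<in> C1_maps A"
  shows "dfun A' (f \<circ> \<phi>) q = dfun A f (\<phi> q) \<circ> dmap A' A \<phi> q"
  unfolding dfun_def dmap_def
  by (rule coord_deriv_compose(2)) (use assms chart_at in auto)

lemma linear_dfun:
  assumes "smooth_atlas A" "f \<in> C1_maps A"
  shows "linear (dfun A f p)"
  unfolding dfun_def by (rule linear_coord_deriv) (use assms chart_at in auto)

lemma linear_dmap:
  assumes "smooth_atlas A'" "smooth_atlas A" "smooth_map A' A \<phi>"
  shows "linear (dmap A' A \<phi> q)"
  unfolding dmap_def
  by (rule has_derivative_linear[OF smooth_map_deriv(1)]) (use assms chart_at in auto)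

lemma linear_vec_nth_compose: "linear (f :: 'e::real_vector \<Rightarrow> real ^ 'k) \<Longrightarrow> linear (\<lambda>v. f v $ i)"
  by (simp add: linear_iff)

lemma linear_dcomp:
  assumes "smooth_atlas A" "f \<in> C1_maps A"
  shows "linear (dcomp A f p i)"
  unfolding dcomp_def by (intro linear_vec_nth_compose linear_dfun assms)

lemma dcomp_compose:
  assumes "smooth_atlas A'" "smooth_atlas A" "smooth_map A' A \<phi>" "f \<in> C1_maps A"
  shows "dcomp A' (f \<circ> \<phi>) q = (\<lambda>i v. dcomp A f (\<phi> q) i (dmap A' A \<phi> q v))"
  by (simp add: dcomp_def fun_eq_iff dfun_compose[OF assms])

text \<open>Expanding the moving argument in a fixed finite basis reduces joint convergence to
  pointwise convergence. Linearity is required only eventually because coordinate derivatives are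
  meaningful only over the chart domain.\<close>

lemma tendsto_linear_apply:
  fixes T0 :: "'e::finite_dim_inner \<Rightarrow> 'w::real_normed_vector"
  assumes T: "\<forall>\<^sub>F z in G. linear (T z)" "\<And>v. ((\<lambda>z. T z v) \<longlongrightarrow> T0 v) G" "linear T0"
    and w: "(w \<longlongrightarrow> w0) G"
  shows "((\<lambda>z. T z (w z)) \<longlongrightarrow> T0 w0) G"
proof -
  obtain E :: "'e set" where E: "orthonormal_basis (inner) E"
    using orthonormal_basis_exists[OF inner_form_inner] .
  have "((\<lambda>z. \<Sum>e\<in>E. (w z \<bullet> e) *\<^sub>R T z e) \<longlongrightarrow> (\<Sum>e\<in>E. (w0 \<bullet> e) *\<^sub>R T0 e)) G"
    by (intro tendsto_intros assms)
  moreover have "\<forall>\<^sub>F z in G. (\<Sum>e\<in>E. (w z \<bullet> e) *\<^sub>R T z e) = T z (w z)"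
    using T(1) by eventually_elim (rule orthonormal_basis_linear[OF E, symmetric])
  ultimately show ?thesis
    using orthonormal_basis_linear[OF E T(3), of w0] by (simp add: filterlim_cong)
qed

lemma onorm_le_sum_basis:
  fixes T :: "'e::finite_dim_inner \<Rightarrow> 'w::real_normed_vector"
  assumes "linear T" and E: "orthonormal_basis (inner) E"
  shows "onorm T \<le> (\<Sum>e\<in>E. norm (T e))"
proof (rule onorm_bound)
  show "0 \<le> (\<Sum>e\<in>E. norm (T e))" by (intro sum_nonneg) auto
  fix x
  have "norm (T x) = norm (\<Sum>e\<in>E. (x \<bullet> e) *\<^sub>R T e)"
    using orthonormal_basis_linear[OF E assms(1), of x] by simp
  also have "\<dots> \<le> (\<Sum>e\<in>E. norm x * norm (T e))"
  proof (rule sum_norm_le)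
    fix e assume "e \<in> E"
    then have "norm e = 1" using E by (simp add: orthonormal_basis_def norm_eq_1)
    then have "\<bar>x \<bullet> e\<bar> \<le> norm x" using Cauchy_Schwarz_ineq2[of x e] by simp
    then show "norm ((x \<bullet> e) *\<^sub>R T e) \<le> norm x * norm (T e)" by (simp add: mult_right_mono)
  qed
  finally show "norm (T x) \<le> (\<Sum>e\<in>E. norm (T e)) * norm x" by (simp add: sum_distrib_left mult.commute)
qed

text \<open>The operator norm of the difference is at most the sum of its values on an orthonormal
  basis, which tends to 0; a strict inequality therefore survives.\<close>

lemma eventually_onorm_less:
  fixes T0 :: "'e::finite_dim_inner \<Rightarrow> 'w::real_normed_vector"
  assumes T: "\<forall>\<^sub>F z in G. linear (T z)" "\<And>v. ((\<lambda>z. T z v) \<longlongrightarrow> T0 v) G" "linear T0" and "onorm T0 < \<epsilon>"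
  shows "\<forall>\<^sub>F z in G. onorm (T z) < \<epsilon>"
proof -
  obtain E :: "'e set" where E: "orthonormal_basis (inner) E"
    using orthonormal_basis_exists[OF inner_form_inner] .
  have "((\<lambda>z. \<Sum>e\<in>E. norm (T z e - T0 e)) \<longlongrightarrow> (\<Sum>e\<in>E. norm (T0 e - T0 e))) G"
    by (intro tendsto_intros T)
  then have "\<forall>\<^sub>F z in G. (\<Sum>e\<in>E. norm (T z e - T0 e)) < \<epsilon> - onorm T0"
    by (rule order_tendstoD) (use assms(4) in simp)
  with T(1) show ?thesis
  proof eventually_elim
    case (elim z)
    have lin: "linear (\<lambda>v. T z v - T0 v)" using elim(1) T(3) by (rule linear_compose_sub)
    have "onorm (T z) = onorm (\<lambda>v. T0 v + (T z v - T0 v))" by simp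
    also have "\<dots> \<le> onorm T0 + onorm (\<lambda>v. T z v - T0 v)"
      by (intro onorm_triangle bounded_linear_finite_dim lin T)
    finally show ?case using onorm_le_sum_basis[OF lin E] elim(2) by linarith
  qed
qed

lemma compose_in_C1_maps:
  assumes A': "smooth_atlas A'" and A: "smooth_atlas A" and \<phi>: "smooth_map A' A \<phi>" and f: "f \<in> C1_maps A"
  shows "f \<circ> \<phi> \<in> C1_maps A'"
  unfolding C1_maps_def
proof (intro CollectI ballI)
  fix c assume c: "c \<in> A'"
  have cont: "continuous_on UNIV \<phi>" using \<phi> by (simp add: smooth_map_def)
  have diff: "(f \<circ> \<phi> \<circ> chart_inv c) differentiable at x" if "x \<in> snd c ` fst c" for x
  proof -
    from that obtain q where q: "q \<in> fst c" "x = snd c q" by blast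
    note d = chart_at[OF A, of "\<phi> q"]
    show ?thesis
      using coord_deriv_compose(1)[OF A' c A d(1) \<phi> q(1) d(2) f] q(2) by (auto simp: differentiable_def)
  qed
  \<comment> \<open>The image of the domain of \<open>c\<close> need not lie in one chart of
    \<open>A\<close>. Continuity is checked at each \<open>q\<close> in the chart around
    \<open>\<phi> q\<close>, where the chain rule holds on a neighbourhood.\<close>
  have "isCont (\<lambda>x. frechet_derivative (f \<circ> \<phi> \<circ> chart_inv c) (at x) v) x" if x: "x \<in> snd c ` fst c" for x v
  proof -
    from x obtain q where q: "q \<in> fst c" "x = snd c q" by blast
    let ?d = "chart_at A (\<phi> q)"
    note d = chart_at[OF A, of "\<phi> q"]
    have lim: "(\<phi> \<longlongrightarrow> \<phi> q) (nhds q)"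
      using cont by (simp add: continuous_on_eq_continuous_at isCont_def tendsto_at_iff_tendsto_nhds)
    have near: "\<forall>\<^sub>F q in nhds q. q \<in> fst c \<and> \<phi> q \<in> fst ?d"
      using eventually_nhds_in_open[OF chart_props(1)[OF A' c] q(1)]
        topological_tendstoD[OF lim chart_props(1)[OF A d(1)] d(2)]
      by eventually_elim simp
    have "((\<lambda>q'. coord_deriv ?d f (\<phi> q') (map_deriv c ?d \<phi> q' v)) \<longlongrightarrow>
        coord_deriv ?d f (\<phi> q) (map_deriv c ?d \<phi> q v)) (nhds q)"
    proof (rule tendsto_linear_apply)
      show "\<forall>\<^sub>F q' in nhds q. linear (coord_deriv ?d f (\<phi> q'))"
        using near by eventually_elim (use linear_coord_deriv[OF A d(1) f] in auto)
      show "((\<lambda>q'. coord_deriv ?d f (\<phi> q') v) \<longlongrightarrow> coord_deriv ?d f (\<phi> q) v) (nhds q)" for v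
        by (rule filterlim_compose[OF C1_deriv(2)[OF A d(1) f d(2)] lim])
    qed (rule linear_coord_deriv[OF A d(1) f d(2)] smooth_map_deriv(2)[OF A' c A d(1) \<phi> q(1) d(2)])+
    moreover have "\<forall>\<^sub>F q' in nhds q. coord_deriv ?d f (\<phi> q') (map_deriv c ?d \<phi> q' v) = coord_deriv c (f \<circ> \<phi>) q' v"
      using near by eventually_elim (use coord_deriv_compose(2)[OF A' c A d(1) \<phi> _ _ f] in auto)
    moreover have "coord_deriv ?d f (\<phi> q) (map_deriv c ?d \<phi> q v) = coord_deriv c (f \<circ> \<phi>) q v"
      using coord_deriv_compose(2)[OF A' c A d(1) \<phi> q(1) d(2) f] by simp
    ultimately have lim2: "((\<lambda>q'. coord_deriv c (f \<circ> \<phi>) q' v) \<longlongrightarrow> coord_deriv c (f \<circ> \<phi>) q v) (nhds q)"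
      by (simp add: filterlim_cong)
    have "isCont (chart_inv c) x"
      using chart_props(4)[OF A' c] x unfolding continuous_on_eq_continuous_at[OF chart_props(2)[OF A' c]] by blast
    then have "(chart_inv c \<longlongrightarrow> q) (at x)" using chart_props(5)[OF A' c q(1)] q(2) by (simp add: isCont_def)
    from filterlim_compose[OF lim2 this]
    have "((\<lambda>x. coord_deriv c (f \<circ> \<phi>) (chart_inv c x) v) \<longlongrightarrow> coord_deriv c (f \<circ> \<phi>) q v) (at x)" .
    moreover have "\<forall>\<^sub>F y in at x. coord_deriv c (f \<circ> \<phi>) (chart_inv c y) v
        = frechet_derivative (f \<circ> \<phi> \<circ> chart_inv c) (at y) v"
      using eventually_at_in_open'[OF chart_props(2)[OF A' c] x]
      by eventually_elim (auto simp: chart_props(5)[OF A' c])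
    ultimately show ?thesis unfolding isCont_def q(2) by (simp add: filterlim_cong)
  qed
  then show "Ck_on 1 (f \<circ> \<phi> \<circ> chart_inv c) (snd c ` fst c)"
    using diff by (auto simp del: o_apply intro!: continuous_at_imp_continuous_on)
qed

section \<open>The weak Whitney topology\<close>

lemma filterlim_fst_prod: "filterlim fst F (F \<times>\<^sub>F G)"
  and filterlim_snd_prod: "filterlim snd G (F \<times>\<^sub>F G)"
proof -
  show "filterlim fst F (F \<times>\<^sub>F G)"
    unfolding filterlim_iff
  proof (intro allI impI)
    fix P assume "eventually P F"
    from eventually_prodI[OF this eventually_True]
    show "\<forall>\<^sub>F x in F \<times>\<^sub>F G. P (fst x)" by simp
  qed
  show "filterlim snd G (F \<times>\<^sub>F G)"
    unfolding filterlim_iff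
  proof (intro allI impI)
    fix P assume "eventually P G"
    from eventually_prodI[OF eventually_True this]
    show "\<forall>\<^sub>F x in F \<times>\<^sub>F G. P (snd x)" by simp
  qed
qed

text \<open>A tube lemma in terms of filters: near each \<open>q\<close> one eventual condition on
  \<open>y\<close> suffices, and finitely many such neighbourhoods cover \<open>U\<close>.\<close>

lemma eventually_Ball_compact:
  assumes "compact U" and P: "\<And>q. q \<in> U \<Longrightarrow> \<forall>\<^sub>F z in nhds q \<times>\<^sub>F F. P (fst z) (snd z)"
  shows "\<forall>\<^sub>F y in F. \<forall>q\<in>U. P q y"
proof -
  have "\<exists>V Q. open V \<and> q \<in> V \<and> eventually Q F \<and> (\<forall>q'\<in>V. \<forall>y. Q y \<longrightarrow> P q' y)" if q: "q \<in> U" for q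
  proof -
    obtain R Q where "eventually R (nhds q)" "eventually Q F" "\<And>x y. R x \<Longrightarrow> Q y \<Longrightarrow> P x y"
      using P[OF q] unfolding eventually_prod_filter by auto
    then show ?thesis unfolding eventually_nhds by blast
  qed
  then obtain V Q where VQ: "\<And>q. q \<in> U \<Longrightarrow> open (V q) \<and> q \<in> V q \<and> eventually (Q q) F \<and>
      (\<forall>q'\<in>V q. \<forall>y. Q q y \<longrightarrow> P q' y)" by metis
  then have "U \<subseteq> (\<Union>q\<in>U. V q)" "\<And>q. q \<in> U \<Longrightarrow> open (V q)" by auto
  from compactE_image[OF \<open>compact U\<close> this(2,1)]
  obtain D where D: "D \<subseteq> U" "finite D" "U \<subseteq> (\<Union>q\<in>D. V q)" by auto
  have "\<forall>\<^sub>F y in F. \<forall>q\<in>D. Q q y" using D VQ by (intro eventually_ball_finite) auto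
  then show ?thesis
    by eventually_elim (use D VQ in blast)
qed

text \<open>Images of closed coordinate balls of radius \<open>r / (n + 1)\<close>. They serve as
  the compact sets of Whitney neighbourhoods, and as a countable family shrinking to
  \<open>p\<close> for a dominated convergence argument.\<close>

lemma compact_neighbourhood_basis:
  fixes A :: "('a::{t2_space, second_countable_topology}, 'e::finite_dim_inner) chart set"
  assumes A: "smooth_atlas A"
  obtains U :: "nat \<Rightarrow> 'a set" where "\<And>n. compact (U n)" "\<And>n. \<forall>\<^sub>F q in nhds p. q \<in> U n"
    "\<And>V. open V \<Longrightarrow> p \<in> V \<Longrightarrow> \<forall>\<^sub>F n in sequentially. U n \<subseteq> V"
proof -
  let ?c = "chart_at A p"
  note c = chart_at[OF A, of p]
  note props = chart_props[OF A c(1)]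
  obtain r where r: "0 < r" "cball (snd ?c p) r \<subseteq> snd ?c ` fst ?c"
    using props(2) c(2) by (meson imageI open_contains_cball)
  define R where "R n = r / real (Suc n)" for n
  have R: "0 < R n" "R n \<le> r" for n
    using r(1) by (auto simp: R_def divide_le_eq mult_le_cancel_left)
  have R0: "R \<longlonglongrightarrow> 0" unfolding R_def by real_asymp
  define U where "U n = chart_inv ?c ` cball (snd ?c p) (R n)" for n
  have sub: "cball (snd ?c p) (R n) \<subseteq> snd ?c ` fst ?c" for n
    using r(2) R(2)[of n] by (meson order_trans subset_cball)
  show thesis
  proof (rule that[of U])
    show "compact (U n)" for n
      unfolding U_def
      by (intro compact_continuous_image continuous_on_subset[OF props(4) sub] compact_finite_dim) auto
    show "\<forall>\<^sub>F q in nhds p. q \<in> U n" for n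
    proof -
      have "((\<lambda>q. snd ?c q) \<longlongrightarrow> snd ?c p) (nhds p)"
        using tendsto_chart[OF A c(1) props(1) order_refl c(2), of "\<lambda>x. x"] by simp
      then have "\<forall>\<^sub>F q in nhds p. snd ?c q \<in> ball (snd ?c p) (R n)"
        by (rule topological_tendstoD) (use R in auto)
      moreover have "\<forall>\<^sub>F q in nhds p. q \<in> fst ?c" by (rule eventually_nhds_in_open[OF props(1) c(2)])
      ultimately show ?thesis
      proof eventually_elim
        case (elim q)
        then show ?case unfolding U_def
          by (intro image_eqI[of _ _ "snd ?c q"]) (auto simp: props(5))
      qed
    qed
    fix V assume V: "open V" "p \<in> V"
    have "isCont (chart_inv ?c) (snd ?c p)"
      using props(4) c(2) unfolding continuous_on_eq_continuous_at[OF props(2)] by blast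
    then have "(chart_inv ?c \<longlongrightarrow> p) (nhds (snd ?c p))"
      using props(5)[OF c(2)] tendsto_at_iff_tendsto_nhds[of "chart_inv ?c" "snd ?c p"]
      by (simp add: isCont_def)
    from topological_tendstoD[OF this V] obtain \<delta> where \<delta>: "0 < \<delta>"
      "\<And>x. dist x (snd ?c p) < \<delta> \<Longrightarrow> chart_inv ?c x \<in> V"
      unfolding eventually_nhds_metric by blast
    have "\<forall>\<^sub>F n in sequentially. R n < \<delta>" using order_tendstoD(2)[OF R0 \<delta>(1)] .
    then show "\<forall>\<^sub>F n in sequentially. U n \<subseteq> V"
      by eventually_elim (auto simp: U_def dist_commute intro!: \<delta>(2))
  qed
qed

lemma topspace_weak_whitney:
  assumes A: "smooth_atlas A"
  shows "topspace (weak_whitney A :: ('a::{t2_space, second_countable_topology} \<Rightarrow> 'v::real_normed_vector) topology)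
    = C1_maps (A :: ('a, 'e::finite_dim_inner) chart set)"
proof -
  obtain c where c: "c \<in> A" using chart_at(1)[OF A] by blast
  \<comment> \<open>Over the empty compact set the closeness conditions are vacuous, so every
    \<open>C1\<close> map lies in some subbasic set.\<close>
  have "f \<in> whitney_nbhd A f c {} 1" if "f \<in> C1_maps A" for f :: "'a \<Rightarrow> 'v"
    using that by (simp add: whitney_nbhd_def)
  then have "C1_maps A \<subseteq> topspace (weak_whitney A :: ('a \<Rightarrow> 'v) topology)"
    unfolding weak_whitney_def topology_generated_by_topspace
    using c compact_empty zero_less_one by blast
  moreover have "topspace (weak_whitney A :: ('a \<Rightarrow> 'v) topology) \<subseteq> C1_maps A"
    unfolding weak_whitney_def topology_generated_by_topspace by (auto simp: whitney_nbhd_def)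
  ultimately show ?thesis by blast
qed

lemma eventually_nhdsin_topspace: "\<forall>\<^sub>F x in nhdsin T a. x \<in> topspace T"
  unfolding eventually_nhdsin using openin_topspace[of T] by blast

text \<open>Continuity for an abstract topology is turned into limits along \<open>nhdsin\<close>,
  which can be combined with \<open>nhds\<close> in product filters and treated by the limit
  calculus.\<close>

lemma continuous_map_real_iff_nhdsin:
  "continuous_map T euclideanreal h \<longleftrightarrow> (\<forall>f\<in>topspace T. (h \<longlongrightarrow> h f) (nhdsin T f))"
proof
  assume h: "continuous_map T euclideanreal h"
  show "\<forall>f\<in>topspace T. (h \<longlongrightarrow> h f) (nhdsin T f)"
  proof (intro ballI topological_tendstoI)
    fix f S assume f: "f \<in> topspace T" and S: "open S" "h f \<in> S"
    have "openin T {x \<in> topspace T. h x \<in> S}"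
      using h S(1) by (intro openin_continuous_map_preimage) auto
    then show "\<forall>\<^sub>F x in nhdsin T f. h x \<in> S"
      unfolding eventually_nhdsin using f S(2) by (intro disjI2 exI[of _ "{x \<in> topspace T. h x \<in> S}"]) auto
  qed
next
  assume h: "\<forall>f\<in>topspace T. (h \<longlongrightarrow> h f) (nhdsin T f)"
  show "continuous_map T euclideanreal h"
    unfolding continuous_map_def
  proof (intro conjI allI impI)
    fix S :: "real set" assume "openin euclideanreal S"
    then have S: "open S" by simp
    show "openin T {x \<in> topspace T. h x \<in> S}"
    proof (subst openin_subopen, intro ballI)
      fix f assume f: "f \<in> {x \<in> topspace T. h x \<in> S}"
      then have "\<forall>\<^sub>F x in nhdsin T f. h x \<in> S" using h S by (auto intro: topological_tendstoD)
      then obtain W where "openin T W" "f \<in> W" "\<forall>x\<in>W. h x \<in> S"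
        unfolding eventually_nhdsin using f by blast
      then show "\<exists>W. openin T W \<and> f \<in> W \<and> W \<subseteq> {x \<in> topspace T. h x \<in> S}"
        using openin_subset by blast
    qed
  qed auto
qed

context
  fixes A :: "('a::{t2_space, second_countable_topology}, 'e::finite_dim_inner) chart set"
    and f0 :: "'a \<Rightarrow> 'v::real_normed_vector"
  assumes A: "smooth_atlas A" and f0: "f0 \<in> C1_maps A"
begin

lemma eventually_nhdsin_C1: "\<forall>\<^sub>F f in nhdsin (weak_whitney A) f0. f \<in> C1_maps A"
  using eventually_nhdsin_topspace[of "weak_whitney A"] unfolding topspace_weak_whitney[OF A] .

text \<open>Uniform closeness on a compact neighbourhood of \<open>p\<close> gives closeness at a
  moving point. This is the source of all joint continuity in the point and the map.\<close>

lemma eventually_whitney_close: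
  assumes c: "c \<in> A" and p: "p \<in> fst c" and \<epsilon>: "0 < \<epsilon>"
  shows "\<forall>\<^sub>F z in nhds p \<times>\<^sub>F nhdsin (weak_whitney A) f0. norm (snd z (fst z) - f0 (fst z)) < \<epsilon> \<and>
    onorm (\<lambda>v. coord_deriv c (snd z) (fst z) v - coord_deriv c f0 (fst z) v) < \<epsilon>"
proof -
  obtain U :: "nat \<Rightarrow> 'a set" where U: "\<And>n. compact (U n)" "\<And>n. \<forall>\<^sub>F q in nhds p. q \<in> U n"
    "\<And>V. open V \<Longrightarrow> p \<in> V \<Longrightarrow> \<forall>\<^sub>F n in sequentially. U n \<subseteq> V"
    using compact_neighbourhood_basis[OF A] by metis
  obtain n where n: "U n \<subseteq> fst c"
    using eventually_happens'[OF sequentially_bot U(3)[OF chart_props(1)[OF A c] p]] by blast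
  let ?W = "whitney_nbhd A f0 c (U n) \<epsilon>"
  have "openin (weak_whitney A) ?W"
    unfolding weak_whitney_def using f0 c U(1)[of n] n \<epsilon> by (intro topology_generated_by_Basis) blast
  moreover have "f0 \<in> ?W"
    using f0 \<epsilon> by (simp add: whitney_nbhd_def onorm_zero)
  ultimately have "\<forall>\<^sub>F f in nhdsin (weak_whitney A) f0. f \<in> ?W"
    unfolding eventually_nhdsin by blast
  from eventually_prodI[OF U(2)[of n] this] show ?thesis
    by eventually_elim (simp add: whitney_nbhd_def)
qed

lemma tendsto_eval:
  "((\<lambda>z. snd z (fst z)) \<longlongrightarrow> f0 p) (nhds p \<times>\<^sub>F nhdsin (weak_whitney A) f0)"
proof -
  note c = chart_at[OF A, of p]
  have "((\<lambda>z. snd z (fst z) - f0 (fst z)) \<longlongrightarrow> 0) (nhds p \<times>\<^sub>F nhdsin (weak_whitney A) f0)"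
  proof (rule tendstoI)
    fix \<epsilon> :: real assume "0 < \<epsilon>"
    from eventually_whitney_close[OF c this]
    show "\<forall>\<^sub>F z in nhds p \<times>\<^sub>F nhdsin (weak_whitney A) f0. dist (snd z (fst z) - f0 (fst z)) 0 < \<epsilon>"
      by eventually_elim simp
  qed
  from tendsto_add[OF this filterlim_compose[OF C1_deriv(3)[OF A c(1) f0 c(2)] filterlim_fst_prod]]
  show ?thesis by simp
qed

lemma tendsto_coord_deriv:
  assumes c: "c \<in> A" and p: "p \<in> fst c"
  shows "((\<lambda>z. coord_deriv c (snd z) (fst z) v) \<longlongrightarrow> coord_deriv c f0 p v)
    (nhds p \<times>\<^sub>F nhdsin (weak_whitney A) f0)"
proof -
  let ?G = "nhds p \<times>\<^sub>F nhdsin (weak_whitney A) f0"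
  have "((\<lambda>z. coord_deriv c (snd z) (fst z) v - coord_deriv c f0 (fst z) v) \<longlongrightarrow> 0) ?G"
  proof (rule tendstoI)
    fix \<epsilon> :: real assume \<epsilon>: "0 < \<epsilon>"
    \<comment> \<open>The added 1 covers \<open>v = 0\<close> and makes the final inequality
      strict.\<close>
    then have "0 < \<epsilon> / (norm v + 1)" by (simp add: add_nonneg_pos)
    from eventually_whitney_close[OF c p this]
      eventually_prodI[OF eventually_nhds_in_open[OF chart_props(1)[OF A c] p] eventually_nhdsin_C1]
    show "\<forall>\<^sub>F z in ?G. dist (coord_deriv c (snd z) (fst z) v - coord_deriv c f0 (fst z) v) 0 < \<epsilon>"
    proof eventually_elim
      case (elim z)
      let ?D = "\<lambda>v. coord_deriv c (snd z) (fst z) v - coord_deriv c f0 (fst z) v"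
      have "bounded_linear ?D"
        using elim(2) by (intro bounded_linear_finite_dim linear_compose_sub linear_coord_deriv[OF A c] f0) auto
      then have "norm (?D v) \<le> onorm ?D * norm v" by (rule onorm)
      also have "\<dots> \<le> \<epsilon> / (norm v + 1) * norm v" using elim(1) by (intro mult_right_mono) auto
      also have "\<dots> < \<epsilon>" using \<epsilon> by (simp add: divide_less_eq add_nonneg_pos mult_less_cancel_left_pos)
      finally show ?case by simp
    qed
  qed
  from tendsto_add[OF this filterlim_compose[OF C1_deriv(2)[OF A c f0 p, of v] filterlim_fst_prod]]
  show ?thesis by simp
qed

end

text \<open>\<open>g p\<close> refers to the chart chosen at \<open>p\<close>, which may jump with
  \<open>p\<close>, so its values at fixed vectors need not be continuous. These are the
  coefficients in one fixed chart, the ones that \<open>riemannian_metric\<close> makes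
  smooth.\<close>

definition metric_coord ::
  "('a, 'e::real_normed_vector) chart set \<Rightarrow> ('a \<Rightarrow> 'e \<Rightarrow> 'e \<Rightarrow> real) \<Rightarrow> ('a, 'e) chart \<Rightarrow> 'a \<Rightarrow> 'e \<Rightarrow> 'e \<Rightarrow> real" where
  "metric_coord A g c p v w = g p (from_chart A c p v) (from_chart A c p w)"

lemma inner_form_metric: "riemannian_metric A g \<Longrightarrow> inner_form (g p)"
  unfolding riemannian_metric_def inner_form_def by blast

lemma inner_form_metric_coord:
  assumes "smooth_atlas A" "riemannian_metric A g" "c \<in> A" "p \<in> fst c"
  shows "inner_form (metric_coord A g c p)"
proof -
  have "inner_form (\<lambda>v w. g p (from_chart A c p v) (from_chart A c p w))"
    by (rule inner_form_compose[OF inner_form_metric[OF assms(2)] from_chart_linear_bij(1)[OF assms(1,3,4)]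
          bij_is_inj[OF from_chart_linear_bij(2)[OF assms(1,3,4)]]])
  then show ?thesis by (simp add: metric_coord_def[abs_def])
qed

lemma tendsto_metric_coord:
  assumes A: "smooth_atlas A" and g: "riemannian_metric A g" and c: "c \<in> A" and p: "p \<in> fst c"
  shows "((\<lambda>p. metric_coord A g c p v w) \<longlongrightarrow> metric_coord A g c p v w) (nhds p)"
proof -
  let ?h = "\<lambda>x. g (chart_inv c x) (from_chart A c (chart_inv c x) v) (from_chart A c (chart_inv c x) w)"
  have "smooth_on ?h (snd c ` fst c)" using g c unfolding riemannian_metric_def by blast
  then have "Ck_on 0 ?h (snd c ` fst c)" unfolding smooth_on_def by blast
  then have "continuous_on (snd c ` fst c) ?h" by simp
  from tendsto_chart[OF A c chart_props(1)[OF A c] order_refl p this]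
  have "((\<lambda>p. ?h (snd c p)) \<longlongrightarrow> ?h (snd c p)) (nhds p)" .
  moreover have "\<forall>\<^sub>F p in nhds p. ?h (snd c p) = metric_coord A g c p v w"
    using eventually_nhds_in_open[OF chart_props(1)[OF A c] p]
    by eventually_elim (simp add: chart_props(5)[OF A c] metric_coord_def)
  moreover have "?h (snd c p) = metric_coord A g c p v w"
    using p by (simp add: chart_props(5)[OF A c] metric_coord_def)
  ultimately show ?thesis by (simp add: filterlim_cong)
qed

text \<open>\<open>from_chart\<close> is an isometry from \<open>metric_coord\<close> to
  \<open>g p\<close> and matches the two coordinate expressions of the differential, so
  \<open>wedge_norm_bij\<close> applies.\<close>

lemma jac_coord:
  assumes A: "smooth_atlas A" and g: "riemannian_metric A g" and c: "c \<in> A" and p: "p \<in> fst c"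
    and f: "f \<in> C1_maps A"
  shows "jac A g p f = wedge_norm (metric_coord A g c p) (\<lambda>i v. coord_deriv c f p v $ i)"
  unfolding jac_def metric_coord_def[abs_def] coord_deriv_from_chart[OF A c p f]
  using wedge_norm_bij[OF inner_form_metric[OF g, of p] from_chart_linear_bij[OF A c p],
      of "dcomp A f p"] linear_dcomp[OF A f]
  by (simp add: dcomp_def)

lemma jac_nonneg:
  assumes A: "smooth_atlas A" and g: "riemannian_metric A g" and f: "f \<in> C1_maps A"
  shows "0 \<le> jac A g p f"
  unfolding jac_def by (intro wedge_norm_nonneg inner_form_metric[OF g] linear_dcomp[OF A f])

lemma tendsto_jac:
  fixes A :: "('a::{t2_space, second_countable_topology}, 'e::finite_dim_inner) chart set"
    and f0 :: "'a \<Rightarrow> real ^ 'k::finite"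
  assumes A: "smooth_atlas A" and g: "riemannian_metric A g" and f0: "f0 \<in> C1_maps A"
  shows "((\<lambda>z. jac A g (fst z) (snd z)) \<longlongrightarrow> jac A g p f0) (nhds p \<times>\<^sub>F nhdsin (weak_whitney A) f0)"
    (is "(_ \<longlongrightarrow> _) ?G")
proof -
  let ?c = "chart_at A p"
  note c = chart_at[OF A, of p]
  \<comment> \<open>\<open>tendsto_wedge_norm\<close> wants inner forms and linear maps at every
    \<open>z\<close>. Where the chart or the differentiability fails, the data are replaced by those
    at \<open>p\<close> and \<open>f0\<close>; eventually no replacement occurs.\<close>
  define ok where "ok z \<longleftrightarrow> fst z \<in> fst ?c \<and> snd z \<in> C1_maps A" for z :: "'a \<times> ('a \<Rightarrow> real ^ 'k)"
  define b where "b z = (if ok z then metric_coord A g ?c (fst z) else metric_coord A g ?c p)" for z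
  define \<alpha> where "\<alpha> z i v = (if ok z then coord_deriv ?c (snd z) (fst z) v $ i else coord_deriv ?c f0 p v $ i)" for z i v
  have ok: "\<forall>\<^sub>F z in ?G. ok z"
    using eventually_prodI[OF eventually_nhds_in_open[OF chart_props(1)[OF A c(1)] c(2)] eventually_nhdsin_C1[OF A f0]]
    by (simp add: ok_def)
  have lin: "linear (\<lambda>v. coord_deriv ?c f0 p v $ i)" for i
    by (intro linear_vec_nth_compose linear_coord_deriv[OF A c(1) f0 c(2)])
  have "((\<lambda>z. wedge_norm (b z) (\<alpha> z)) \<longlongrightarrow>
    wedge_norm (metric_coord A g ?c p) (\<lambda>i v. coord_deriv ?c f0 p v $ i)) ?G"
  proof (rule tendsto_wedge_norm)
    show "inner_form (b z)" for z
      using inner_form_metric_coord[OF A g c(1)] c(2) by (simp add: b_def ok_def)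
    show "inner_form (metric_coord A g ?c p)" by (rule inner_form_metric_coord[OF A g c])
    show "linear (\<alpha> z i)" for z i
    proof (cases "ok z")
      case True
      then have "linear (\<lambda>v. coord_deriv ?c (snd z) (fst z) v $ i)"
        by (intro linear_vec_nth_compose linear_coord_deriv[OF A c(1)]) (auto simp: ok_def)
      then show ?thesis using True by (simp add: \<alpha>_def[abs_def])
    qed (use lin in \<open>simp add: \<alpha>_def[abs_def]\<close>)
    show "((\<lambda>z. b z v w) \<longlongrightarrow> metric_coord A g ?c p v w) ?G" for v w
    proof (rule Lim_transform_eventually)
      show "((\<lambda>z. metric_coord A g ?c (fst z) v w) \<longlongrightarrow> metric_coord A g ?c p v w) ?G"
        by (rule filterlim_compose[OF tendsto_metric_coord[OF A g c] filterlim_fst_prod])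
      show "\<forall>\<^sub>F z in ?G. metric_coord A g ?c (fst z) v w = b z v w"
        using ok by eventually_elim (simp add: b_def)
    qed
    show "((\<lambda>z. \<alpha> z i v) \<longlongrightarrow> coord_deriv ?c f0 p v $ i) ?G" for i v
    proof (rule Lim_transform_eventually)
      show "((\<lambda>z. coord_deriv ?c (snd z) (fst z) v $ i) \<longlongrightarrow> coord_deriv ?c f0 p v $ i) ?G"
        by (intro tendsto_vec_nth tendsto_coord_deriv[OF A f0 c])
      show "\<forall>\<^sub>F z in ?G. coord_deriv ?c (snd z) (fst z) v $ i = \<alpha> z i v"
        using ok by eventually_elim (simp add: \<alpha>_def)
    qed
  qed (rule lin)
  moreover have "\<forall>\<^sub>F z in ?G. wedge_norm (b z) (\<alpha> z) = jac A g (fst z) (snd z)"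
    using ok
  proof eventually_elim
    case (elim z)
    then show ?case
      using jac_coord[OF A g c(1), of "fst z" "snd z"] by (simp add: ok_def b_def \<alpha>_def[abs_def])
  qed
  ultimately have "((\<lambda>z. jac A g (fst z) (snd z)) \<longlongrightarrow>
    wedge_norm (metric_coord A g ?c p) (\<lambda>i v. coord_deriv ?c f0 p v $ i)) ?G"
    by (rule Lim_transform_eventually)
  then show ?thesis using jac_coord[OF A g c f0] by simp
qed

text \<open>Freezes the point at \<open>p\<close> in a joint limit, by composing with
  \<open>f \<mapsto> (p, f)\<close>.\<close>

lemma tendsto_apply_at:
  assumes "((\<lambda>z. h (fst z) (snd z)) \<longlongrightarrow> l) (nhds p \<times>\<^sub>F F)"
  shows "(h p \<longlongrightarrow> l) F"
proof -
  have "filterlim (\<lambda>f. (p, f)) (nhds p \<times>\<^sub>F F) F"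
    by (intro filterlim_Pair tendsto_const filterlim_ident)
  from filterlim_compose[OF assms this] show ?thesis by simp
qed

lemma continuous_map_jac:
  fixes A :: "('a::{t2_space, second_countable_topology}, 'e::finite_dim_inner) chart set"
  assumes A: "smooth_atlas A" and g: "riemannian_metric A g"
  shows "continuous_map (weak_whitney A) euclideanreal (jac A g p :: ('a \<Rightarrow> real ^ 'k::finite) \<Rightarrow> real)"
  unfolding continuous_map_real_iff_nhdsin topspace_weak_whitney[OF A]
  using tendsto_apply_at[OF tendsto_jac[OF A g]] by blast

lemma continuous_map_wedge_det:
  fixes A :: "('a::{t2_space, second_countable_topology}, 'e::finite_dim_inner) chart set"
  assumes A: "smooth_atlas A"
  shows "continuous_map (weak_whitney A) euclideanreal
    (\<lambda>f :: 'a \<Rightarrow> real ^ 'k::finite. altform_apply (wedge (dcomp A f p)) v)"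
  unfolding continuous_map_real_iff_nhdsin topspace_weak_whitney[OF A]
proof
  fix f0 :: "'a \<Rightarrow> real ^ 'k" assume f0: "f0 \<in> C1_maps A"
  let ?c = "chart_at A p"
  note c = chart_at[OF A, of p]
  have "((\<lambda>f. coord_deriv ?c f p v) \<longlongrightarrow> coord_deriv ?c f0 p v) (nhdsin (weak_whitney A) f0)" for v
    using tendsto_apply_at[of "\<lambda>p f. coord_deriv ?c f p v", OF tendsto_coord_deriv[OF A f0 c]] .
  then have "((\<lambda>f. dcomp A f p i v) \<longlongrightarrow> dcomp A f0 p i v) (nhdsin (weak_whitney A) f0)" for i v
    unfolding dcomp_def dfun_def by (intro tendsto_vec_nth)
  then have "((\<lambda>f. wedge_det (dcomp A f p) v) \<longlongrightarrow> wedge_det (dcomp A f0 p) v) (nhdsin (weak_whitney A) f0)"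
    by (intro tendsto_det)
  moreover have "\<forall>\<^sub>F f in nhdsin (weak_whitney A) f0. wedge_det (dcomp A f p) v = altform_apply (wedge (dcomp A f p)) v"
    using eventually_nhdsin_C1[OF A f0] by eventually_elim (simp add: wedge_apply linear_dcomp[OF A])
  ultimately have "((\<lambda>f. altform_apply (wedge (dcomp A f p)) v) \<longlongrightarrow> wedge_det (dcomp A f0 p) v) (nhdsin (weak_whitney A) f0)"
    by (rule Lim_transform_eventually)
  then show "((\<lambda>f. altform_apply (wedge (dcomp A f p)) v) \<longlongrightarrow> altform_apply (wedge (dcomp A f0 p)) v) (nhdsin (weak_whitney A) f0)"
    by (simp add: wedge_apply linear_dcomp[OF A f0])
qed

section \<open>Composition with a smooth map\<close>

context
  fixes A :: "('a::{t2_space, second_countable_topology}, 'e::finite_dim_inner) chart set"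
    and A' :: "('s::{t2_space, second_countable_topology}, 'f::finite_dim_inner) chart set"
    and \<phi> :: "'s \<Rightarrow> 'a"
  assumes A: "smooth_atlas A" and A': "smooth_atlas A'" and \<phi>: "smooth_map A' A \<phi>"
begin

lemma tendsto_smooth_map: "(\<phi> \<longlongrightarrow> \<phi> q) (nhds q)"
  using \<phi> by (simp add: smooth_map_def continuous_on_eq_continuous_at isCont_def tendsto_at_iff_tendsto_nhds)

lemma filterlim_smooth_map_prod:
  "filterlim (\<lambda>z. (\<phi> (fst z), snd z)) (nhds (\<phi> q) \<times>\<^sub>F F) (nhds q \<times>\<^sub>F F)"
  by (intro filterlim_Pair filterlim_compose[OF tendsto_smooth_map filterlim_fst_prod] filterlim_snd_prod)

lemma eventually_chart_domains:
  assumes "c \<in> A'" "d \<in> A" "q \<in> fst c" "\<phi> q \<in> fst d"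
  shows "\<forall>\<^sub>F q in nhds q. q \<in> fst c \<and> \<phi> q \<in> fst d"
  using eventually_nhds_in_open[OF chart_props(1)[OF A' assms(1)] assms(3)]
    topological_tendstoD[OF tendsto_smooth_map chart_props(1)[OF A assms(2)] assms(4)]
  by eventually_elim simp

lemma tendsto_coord_deriv_compose:
  fixes f0 :: "'a \<Rightarrow> 'v::real_normed_vector"
  assumes f0: "f0 \<in> C1_maps A" and c: "c \<in> A'" and q: "q \<in> fst c"
  shows "((\<lambda>z. coord_deriv c (snd z \<circ> \<phi>) (fst z) v) \<longlongrightarrow> coord_deriv c (f0 \<circ> \<phi>) q v)
    (nhds q \<times>\<^sub>F nhdsin (weak_whitney A) f0)" (is "(_ \<longlongrightarrow> _) ?G")
proof -
  let ?d = "chart_at A (\<phi> q)"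
  note d = chart_at[OF A, of "\<phi> q"]
  have near: "\<forall>\<^sub>F z in ?G. fst z \<in> fst c \<and> \<phi> (fst z) \<in> fst ?d \<and> snd z \<in> C1_maps A"
    using eventually_prodI[OF eventually_chart_domains[OF c d(1) q d(2)] eventually_nhdsin_C1[OF A f0]]
    by eventually_elim simp
  have "((\<lambda>z. coord_deriv ?d (snd z) (\<phi> (fst z)) (map_deriv c ?d \<phi> (fst z) v)) \<longlongrightarrow>
      coord_deriv ?d f0 (\<phi> q) (map_deriv c ?d \<phi> q v)) ?G"
  proof (rule tendsto_linear_apply)
    show "\<forall>\<^sub>F z in ?G. linear (coord_deriv ?d (snd z) (\<phi> (fst z)))"
      using near by eventually_elim (rule linear_coord_deriv[OF A d(1)], auto)
    show "linear (coord_deriv ?d f0 (\<phi> q))" by (rule linear_coord_deriv[OF A d(1) f0 d(2)])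
    show "((\<lambda>z. coord_deriv ?d (snd z) (\<phi> (fst z)) v) \<longlongrightarrow> coord_deriv ?d f0 (\<phi> q) v) ?G" for v
      using filterlim_compose[OF tendsto_coord_deriv[OF A f0 d, of v] filterlim_smooth_map_prod] by simp
    show "((\<lambda>z. map_deriv c ?d \<phi> (fst z) v) \<longlongrightarrow> map_deriv c ?d \<phi> q v) ?G"
      by (rule filterlim_compose[OF smooth_map_deriv(2)[OF A' c A d(1) \<phi> q d(2)] filterlim_fst_prod])
  qed
  moreover have "\<forall>\<^sub>F z in ?G. coord_deriv ?d (snd z) (\<phi> (fst z)) (map_deriv c ?d \<phi> (fst z) v)
      = coord_deriv c (snd z \<circ> \<phi>) (fst z) v"
    using near
  proof eventually_elim
    case (elim z)
    then show ?case using coord_deriv_compose(2)[OF A' c A d(1) \<phi>, of "fst z" "snd z"] by simp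
  qed
  ultimately have "((\<lambda>z. coord_deriv c (snd z \<circ> \<phi>) (fst z) v) \<longlongrightarrow>
      coord_deriv ?d f0 (\<phi> q) (map_deriv c ?d \<phi> q v)) ?G"
    by (rule Lim_transform_eventually)
  then show ?thesis using coord_deriv_compose(2)[OF A' c A d(1) \<phi> q d(2) f0] by simp
qed

text \<open>The strict inequalities defining a subbasic set persist near each \<open>q\<close> in
  \<open>K\<close>, jointly in the point and the map, and compactness of \<open>K\<close> yields a
  single neighbourhood of \<open>f0\<close>. The argument is local because the image of
  \<open>K\<close> need not fit into one chart of \<open>A\<close>.\<close>

lemma continuous_map_weak_whitney_compose:
  "continuous_map (weak_whitney A) (weak_whitney A')
    (\<lambda>f :: 'a \<Rightarrow> 'v::real_normed_vector. f \<circ> \<phi>)"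
  unfolding weak_whitney_def[of A']
proof (rule continuous_on_generated_topo)
  fix W :: "('s \<Rightarrow> 'v) set"
  assume "W \<in> {whitney_nbhd A' f c K \<epsilon> | f c K \<epsilon>. f \<in> C1_maps A' \<and> c \<in> A' \<and> compact K \<and> K \<subseteq> fst c \<and> 0 < \<epsilon>}"
  then obtain f' c K \<epsilon> where W: "W = whitney_nbhd A' f' c K \<epsilon>" and f': "f' \<in> C1_maps A'" and c: "c \<in> A'"
    and K: "compact K" "K \<subseteq> fst c" and \<epsilon>: "0 < \<epsilon>" by blast
  show "openin (weak_whitney A) ((\<lambda>f. f \<circ> \<phi>) -` W \<inter> topspace (weak_whitney A))"
  proof (subst openin_subopen, intro ballI)
    fix f0 assume "f0 \<in> (\<lambda>f. f \<circ> \<phi>) -` W \<inter> topspace (weak_whitney A)"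
    then have f0W: "f0 \<circ> \<phi> \<in> W" and f0: "f0 \<in> C1_maps A"
      using topspace_weak_whitney[OF A] by auto
    let ?N = "nhdsin (weak_whitney A) f0"
    let ?D = "\<lambda>q f v. coord_deriv c (f \<circ> \<phi>) q v - coord_deriv c f' q v"
    have "\<forall>\<^sub>F f in ?N. \<forall>q\<in>K. norm (f (\<phi> q) - f' q) < \<epsilon> \<and> onorm (?D q f) < \<epsilon>"
    proof (rule eventually_Ball_compact[OF K(1)])
      fix q assume "q \<in> K"
      then have q: "q \<in> fst c" and near: "norm (f0 (\<phi> q) - f' q) < \<epsilon>" "onorm (?D q f0) < \<epsilon>"
        using K(2) f0W by (auto simp: W whitney_nbhd_def)
      let ?G = "nhds q \<times>\<^sub>F ?N"
      have "((\<lambda>z. snd z (\<phi> (fst z))) \<longlongrightarrow> f0 (\<phi> q)) ?G"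
        using filterlim_compose[OF tendsto_eval[OF A f0] filterlim_smooth_map_prod] by simp
      then have "((\<lambda>z. norm (snd z (\<phi> (fst z)) - f' (fst z))) \<longlongrightarrow> norm (f0 (\<phi> q) - f' q)) ?G"
        by (intro tendsto_intros filterlim_compose[OF C1_deriv(3)[OF A' c f' q] filterlim_fst_prod])
      then have ev1: "\<forall>\<^sub>F z in ?G. norm (snd z (\<phi> (fst z)) - f' (fst z)) < \<epsilon>"
        by (rule order_tendstoD) (rule near(1))
      have lin': "linear (coord_deriv c f' q')" if "q' \<in> fst c" for q'
        using linear_coord_deriv[OF A' c f' that] .
      have lin: "linear (coord_deriv c (f \<circ> \<phi>) q')" if "q' \<in> fst c" "f \<in> C1_maps A" for q' f
        using linear_coord_deriv[OF A' c compose_in_C1_maps[OF A' A \<phi> that(2)] that(1)] .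
      have ev2: "\<forall>\<^sub>F z in ?G. onorm (?D (fst z) (snd z)) < \<epsilon>"
      proof (rule eventually_onorm_less[OF _ _ _ near(2)])
        show "\<forall>\<^sub>F z in ?G. linear (?D (fst z) (snd z))"
          using eventually_prodI[OF eventually_nhds_in_open[OF chart_props(1)[OF A' c] q] eventually_nhdsin_C1[OF A f0]]
          by eventually_elim (intro linear_compose_sub lin lin', auto)
        show "linear (?D q f0)" by (intro linear_compose_sub lin lin' q f0)
        show "((\<lambda>z. ?D (fst z) (snd z) v) \<longlongrightarrow> ?D q f0 v) ?G" for v
          by (intro tendsto_diff tendsto_coord_deriv_compose[OF f0 c q]
              filterlim_compose[OF C1_deriv(2)[OF A' c f' q] filterlim_fst_prod])
      qed
      show "\<forall>\<^sub>F z in ?G. norm (snd z (\<phi> (fst z)) - f' (fst z)) < \<epsilon> \<and> onorm (?D (fst z) (snd z)) < \<epsilon>"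
        using ev1 ev2 by eventually_elim simp
    qed
    with eventually_nhdsin_C1[OF A f0] have "\<forall>\<^sub>F f in ?N. f \<circ> \<phi> \<in> W"
      by eventually_elim (simp add: W whitney_nbhd_def compose_in_C1_maps[OF A' A \<phi>])
    moreover have "f0 \<in> topspace (weak_whitney A)" using f0 topspace_weak_whitney[OF A] by auto
    ultimately obtain V where "openin (weak_whitney A) V" "f0 \<in> V" "\<forall>f\<in>V. f \<circ> \<phi> \<in> W"
      unfolding eventually_nhdsin by auto
    then show "\<exists>V. openin (weak_whitney A) V \<and> f0 \<in> V \<and>
        V \<subseteq> (\<lambda>f. f \<circ> \<phi>) -` W \<inter> topspace (weak_whitney A)"
      using openin_subset by blast
  qed
next
  have "(\<lambda>f :: 'a \<Rightarrow> 'v. f \<circ> \<phi>) ` topspace (weak_whitney A) \<subseteq> topspace (weak_whitney A' :: ('s \<Rightarrow> 'v) topology)"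
    unfolding topspace_weak_whitney[OF A] topspace_weak_whitney[OF A']
    using compose_in_C1_maps[OF A' A \<phi>] by blast
  then show "(\<lambda>f :: 'a \<Rightarrow> 'v. f \<circ> \<phi>) ` topspace (weak_whitney A) \<subseteq> \<Union> {whitney_nbhd A' f c K \<epsilon> | f c K \<epsilon>.
        f \<in> C1_maps A' \<and> c \<in> A' \<and> compact K \<and> K \<subseteq> fst c \<and> 0 < \<epsilon>}"
    unfolding weak_whitney_def[of A'] topology_generated_by_topspace .
qed

lemma filterlim_compose_nhdsin:
  fixes f0 :: "'a \<Rightarrow> 'v::real_normed_vector"
  assumes f0: "f0 \<in> C1_maps A"
  shows "filterlim (\<lambda>f. f \<circ> \<phi>) (nhdsin (weak_whitney A') (f0 \<circ> \<phi>)) (nhdsin (weak_whitney A) f0)"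
  unfolding filterlim_iff
proof (intro allI impI)
  fix P assume "eventually P (nhdsin (weak_whitney A') (f0 \<circ> \<phi>))"
  moreover have "f0 \<circ> \<phi> \<in> topspace (weak_whitney A')"
    unfolding topspace_weak_whitney[OF A'] by (rule compose_in_C1_maps[OF A' A \<phi> f0])
  ultimately obtain S where S: "openin (weak_whitney A') S" "f0 \<circ> \<phi> \<in> S" "\<forall>x\<in>S. P x"
    unfolding eventually_nhdsin by blast
  have "openin (weak_whitney A) {f \<in> topspace (weak_whitney A). f \<circ> \<phi> \<in> S}"
    using continuous_map_weak_whitney_compose S(1) by (rule openin_continuous_map_preimage)
  then show "\<forall>\<^sub>F f in nhdsin (weak_whitney A) f0. P (f \<circ> \<phi>)"
    unfolding eventually_nhdsin topspace_weak_whitney[OF A] using S f0 by blast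
qed

lemma tendsto_jac_compose:
  fixes f0 :: "'a \<Rightarrow> real ^ 'k::finite"
  assumes g': "riemannian_metric A' g'" and f0: "f0 \<in> C1_maps A"
  shows "((\<lambda>z. jac A' g' (fst z) (snd z \<circ> \<phi>)) \<longlongrightarrow> jac A' g' q (f0 \<circ> \<phi>)) (nhds q \<times>\<^sub>F nhdsin (weak_whitney A) f0)"
proof -
  have "filterlim (\<lambda>z. (fst z, snd z \<circ> \<phi>)) (nhds q \<times>\<^sub>F nhdsin (weak_whitney A') (f0 \<circ> \<phi>))
      (nhds q \<times>\<^sub>F nhdsin (weak_whitney A) f0)"
    by (intro filterlim_Pair filterlim_fst_prod filterlim_compose[OF filterlim_compose_nhdsin[OF f0] filterlim_snd_prod])
  from filterlim_compose[OF tendsto_jac[OF A' g' compose_in_C1_maps[OF A' A \<phi> f0]] this]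
  show ?thesis by simp
qed

text \<open>Near \<open>q0\<close>, in fixed charts, both metrics are comparable to those at
  \<open>q0\<close> and the Hilbert-Schmidt norm of the differential of \<open>\<phi>\<close> stays
  bounded, so one \<open>\<kappa>\<close> works in \<open>wedge_norm_compose_le\<close>. The same
  \<open>C\<close> serves all \<open>f\<close>, as domination under the conditional laws
  demands.\<close>

lemma eventually_jac_compose_le:
  assumes g: "riemannian_metric A g" and g': "riemannian_metric A' g'"
  obtains C where "0 \<le> C"
    "\<forall>\<^sub>F q in nhds q0. \<forall>f :: 'a \<Rightarrow> real ^ 'k::finite. f \<in> C1_maps A \<longrightarrow> jac A' g' q (f \<circ> \<phi>) \<le> C * jac A g (\<phi> q) f"
proof -
  let ?c = "chart_at A' q0" and ?d = "chart_at A (\<phi> q0)"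
  note c = chart_at[OF A', of q0] and d = chart_at[OF A, of "\<phi> q0"]
  let ?b = "\<lambda>q. metric_coord A g ?d (\<phi> q)" and ?b' = "metric_coord A' g' ?c"
  let ?L = "map_deriv ?c ?d \<phi>"
  have dom: "\<forall>\<^sub>F q in nhds q0. q \<in> fst ?c \<and> \<phi> q \<in> fst ?d"
    by (rule eventually_chart_domains[OF c(1) d(1) c(2) d(2)])
  have b0: "inner_form (?b q0)" and b0': "inner_form (?b' q0)"
    using inner_form_metric_coord[OF A g d] inner_form_metric_coord[OF A' g' c] .
  obtain E where E: "orthonormal_basis (?b' q0) E" using orthonormal_basis_exists[OF b0'] .
  obtain D where D: "orthonormal_basis (?b q0) D" using orthonormal_basis_exists[OF b0] .
  have bound: "\<forall>\<^sub>F q in nhds q0. \<forall>v. ?b q v v \<le> 2 * ?b q0 v v"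
  proof -
    \<comment> \<open>The comparison lemma asks for an inner form at every point, so the value at
      \<open>q0\<close> is used outside the chart domain.\<close>
    let ?B = "\<lambda>q. if \<phi> q \<in> fst ?d then ?b q else ?b q0"
    have "((\<lambda>q. ?B q v w) \<longlongrightarrow> ?b q0 v w) (nhds q0)" for v w
    proof (rule Lim_transform_eventually)
      show "((\<lambda>q. ?b q v w) \<longlongrightarrow> ?b q0 v w) (nhds q0)"
        by (rule filterlim_compose[OF tendsto_metric_coord[OF A g d] tendsto_smooth_map])
      show "\<forall>\<^sub>F q in nhds q0. ?b q v w = ?B q v w" using dom by eventually_elim simp
    qed
    then have "\<forall>\<^sub>F q in nhds q0. \<forall>v. ?b q0 v v \<le> 2 * ?B q v v \<and> ?B q v v \<le> 2 * ?b q0 v v"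
      by (intro eventually_inner_form_bounds b0) (use inner_form_metric_coord[OF A g d(1)] d(2) in auto)
    with dom show ?thesis by eventually_elim simp
  qed
  have bound': "\<forall>\<^sub>F q in nhds q0. \<forall>v. ?b' q0 v v \<le> 2 * ?b' q v v"
  proof -
    let ?B = "\<lambda>q. if q \<in> fst ?c then ?b' q else ?b' q0"
    have "((\<lambda>q. ?B q v w) \<longlongrightarrow> ?b' q0 v w) (nhds q0)" for v w
    proof (rule Lim_transform_eventually)
      show "((\<lambda>q. ?b' q v w) \<longlongrightarrow> ?b' q0 v w) (nhds q0)" by (rule tendsto_metric_coord[OF A' g' c])
      show "\<forall>\<^sub>F q in nhds q0. ?b' q v w = ?B q v w" using dom by eventually_elim simp
    qed
    then have "\<forall>\<^sub>F q in nhds q0. \<forall>v. ?b' q0 v v \<le> 2 * ?B q v v \<and> ?B q v v \<le> 2 * ?b' q0 v v"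
      by (intro eventually_inner_form_bounds b0') (use inner_form_metric_coord[OF A' g' c(1)] c(2) in auto)
    with dom show ?thesis by eventually_elim simp
  qed
  define S where "S q = (\<Sum>e\<in>E. ?b q0 (?L q e) (?L q e))" for q
  have pars: "?b q0 v v = (\<Sum>d\<in>D. ?b q0 v d * ?b q0 v d)" for v
    using b0 by (intro orthonormal_basis_parseval[OF _ D]) (simp add: inner_form_def)
  have lin0: "bounded_linear (\<lambda>v. ?b q0 v d)" for d
    using b0 by (intro bounded_linear_finite_dim) (simp add: inner_form_def bilinear_def)
  have S_eq: "S = (\<lambda>q. \<Sum>e\<in>E. \<Sum>d\<in>D. ?b q0 (?L q e) d * ?b q0 (?L q e) d)"
    by (simp only: S_def[abs_def] pars)
  have "(S \<longlongrightarrow> S q0) (nhds q0)"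
    unfolding S_eq
    by (intro tendsto_intros bounded_linear.tendsto[OF lin0] smooth_map_deriv(2)[OF A' c(1) A d(1) \<phi> c(2) d(2)])
  then have S: "\<forall>\<^sub>F q in nhds q0. S q < S q0 + 1" by (rule order_tendstoD) simp
  have S0: "0 \<le> S q" for q unfolding S_eq by (intro sum_nonneg) auto
  \<comment> \<open>\<open>\<kappa>\<^sup>2\<close> collects a factor 2 from each of the two metrics
    and the bound \<open>S q \<le> S q0 + 1\<close>.\<close>
  define \<kappa> where "\<kappa> = 2 * sqrt (S q0 + 1)"
  have \<kappa>: "0 \<le> \<kappa>" "\<kappa>\<^sup>2 = 4 * (S q0 + 1)" using S0[of q0] by (auto simp: \<kappa>_def power_mult_distrib)
  define C where "C = sqrt (real (dim (UNIV :: 'f set) ^ CARD('k))) * \<kappa> ^ CARD('k)"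
  show thesis
  proof (rule that[of C])
    show "0 \<le> C" using \<kappa> by (simp add: C_def)
    show "\<forall>\<^sub>F q in nhds q0. \<forall>f :: 'a \<Rightarrow> real ^ 'k. f \<in> C1_maps A \<longrightarrow> jac A' g' q (f \<circ> \<phi>) \<le> C * jac A g (\<phi> q) f"
      using dom bound bound' S
    proof eventually_elim
      case (elim q)
      then have qc: "q \<in> fst ?c" and qd: "\<phi> q \<in> fst ?d" by auto
      show ?case
      proof (intro allI impI)
        fix f :: "'a \<Rightarrow> real ^ 'k" assume f: "f \<in> C1_maps A"
        have L: "linear (?L q)" by (rule has_derivative_linear[OF smooth_map_deriv(1)[OF A' c(1) A d(1) \<phi> qc qd]])
        have le: "?b q (?L q v) (?L q v) \<le> \<kappa>\<^sup>2 * ?b' q v v" for v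
        proof -
          have nn: "0 \<le> ?b' q v v"
            using inner_form_metric_coord[OF A' g' c(1) qc]
            by (cases "v = 0") (auto simp: inner_form_def bilinear_def linear_0 less_imp_le)
          have nn0: "0 \<le> ?b' q0 v v"
            using b0' by (cases "v = 0") (auto simp: inner_form_def bilinear_def linear_0 less_imp_le)
          have "?b q (?L q v) (?L q v) \<le> 2 * ?b q0 (?L q v) (?L q v)" using elim by blast
          also have "\<dots> \<le> 2 * (S q * ?b' q0 v v)"
            using inner_form_linear_image_le[OF b0 b0' E L, of v] by (simp add: S_def)
          also have "\<dots> \<le> 2 * ((S q0 + 1) * (2 * ?b' q v v))"
            using elim S0[of q0] nn0 by (intro mult_left_mono mult_mono) auto
          finally show ?thesis unfolding \<kappa>(2) by (simp add: algebra_simps)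
        qed
        have lin: "linear (\<lambda>v. coord_deriv ?d f (\<phi> q) v $ i)" for i
          by (intro linear_vec_nth_compose linear_coord_deriv[OF A d(1) f qd])
        have "jac A' g' q (f \<circ> \<phi>) = wedge_norm (?b' q) (\<lambda>i v. coord_deriv ?d f (\<phi> q) (?L q v) $ i)"
          using jac_coord[OF A' g' c(1) qc compose_in_C1_maps[OF A' A \<phi> f]]
            coord_deriv_compose(2)[OF A' c(1) A d(1) \<phi> qc qd f] by simp
        also have "\<dots> \<le> C * wedge_norm (?b q) (\<lambda>i v. coord_deriv ?d f (\<phi> q) v $ i)"
          unfolding C_def
          by (rule wedge_norm_compose_le[OF inner_form_metric_coord[OF A g d(1) qd]
                inner_form_metric_coord[OF A' g' c(1) qc] lin L le \<kappa>(1)])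
        also have "wedge_norm (?b q) (\<lambda>i v. coord_deriv ?d f (\<phi> q) v $ i) = jac A g (\<phi> q) f"
          by (rule jac_coord[OF A g d(1) qd f, symmetric])
        finally show "jac A' g' q (f \<circ> \<phi>) \<le> C * jac A g (\<phi> q) f" .
      qed
    qed
  qed
qed

text \<open>\<open>f\<close> vanishes along curves in its zero set, so their velocities lie in the
  kernel of the differential of \<open>f\<close>. By transversality the image of the differential of
  \<open>\<phi>\<close> together with this kernel is everything; hence the differential of
  \<open>f \<circ> \<phi>\<close> has the same image as that of \<open>f\<close>.\<close>

lemma regular_value_compose:
  fixes f :: "'a \<Rightarrow> real ^ 'k::finite"
  assumes f: "f \<in> C1_maps A" and reg: "regular_value A f 0" and trans: "transverse A' A \<phi> (f -` {0})"
  shows "regular_value A' (f \<circ> \<phi>) 0"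
  unfolding regular_value_def
proof (intro allI impI)
  fix q assume q: "(f \<circ> \<phi>) q = 0"
  let ?d = "chart_at A (\<phi> q)"
  note d = chart_at[OF A, of "\<phi> q"]
  have zero: "dfun A f (\<phi> q) v = 0" if "v \<in> tangent_space_of A (f -` {0}) (\<phi> q)" for v
  proof -
    from that obtain \<gamma> \<epsilon> where \<gamma>: "0 < \<epsilon>" "\<gamma> 0 = \<phi> q" "\<gamma> ` {-\<epsilon><..<\<epsilon>} \<subseteq> f -` {0} \<inter> fst ?d"
      "(snd ?d \<circ> \<gamma> has_vector_derivative v) (at (0::real))"
      unfolding tangent_space_of_def by blast
    have "((f \<circ> chart_inv ?d) has_derivative dfun A f (\<phi> q)) (at ((snd ?d \<circ> \<gamma>) 0))"
      using C1_deriv(1)[OF A d(1) f d(2)] by (simp add: \<gamma>(2) dfun_def)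
    moreover have "((snd ?d \<circ> \<gamma>) has_derivative (\<lambda>t. t *\<^sub>R v)) (at 0)"
      using \<gamma>(4) by (simp add: has_vector_derivative_def)
    ultimately have "((f \<circ> chart_inv ?d) \<circ> (snd ?d \<circ> \<gamma>) has_derivative dfun A f (\<phi> q) \<circ> (\<lambda>t. t *\<^sub>R v)) (at 0)"
      by (intro diff_chain_at)
    then have "((\<lambda>_. 0) has_derivative dfun A f (\<phi> q) \<circ> (\<lambda>t. t *\<^sub>R v)) (at (0::real))"
    proof (rule has_derivative_transform_within_open)
      show "open {-\<epsilon><..<\<epsilon>}" "0 \<in> {-\<epsilon><..<\<epsilon>}" using \<gamma>(1) by auto
      fix t assume "t \<in> {-\<epsilon><..<\<epsilon>}"
      then have "\<gamma> t \<in> f -` {0} \<inter> fst ?d" using \<gamma>(3) by blast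
      then show "((f \<circ> chart_inv ?d) \<circ> (snd ?d \<circ> \<gamma>)) t = 0" by (simp add: chart_props(5)[OF A d(1)])
    qed
    then have "dfun A f (\<phi> q) \<circ> (\<lambda>t. t *\<^sub>R v) = (\<lambda>_. 0)"
      by (rule has_derivative_unique) (rule has_derivative_const)
    from fun_cong[OF this, of 1] show ?thesis by simp
  qed
  have surj: "surj (dfun A f (\<phi> q))" using reg q by (simp add: regular_value_def)
  have decomp: "{u + v | u v. u \<in> range (dmap A' A \<phi> q) \<and> v \<in> tangent_space_of A (f -` {0}) (\<phi> q)} = UNIV"
    using trans q by (simp add: transverse_def)
  have "\<exists>w. dfun A' (f \<circ> \<phi>) q w = y" for y
  proof -
    obtain x where x: "y = dfun A f (\<phi> q) x" using surj by (rule surjE)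
    obtain w v where "x = dmap A' A \<phi> q w + v" "v \<in> tangent_space_of A (f -` {0}) (\<phi> q)"
      using decomp by blast
    then have "y = dfun A f (\<phi> q) (dmap A' A \<phi> q w)"
      using zero linear_add[OF linear_dfun[OF A f]] by (simp add: x)
    then show ?thesis by (intro exI[of _ w]) (simp add: dfun_compose[OF A' A \<phi> f])
  qed
  then show "surj (dfun A' (f \<circ> \<phi>) q)" by (metis surj_def)
qed

end

section \<open>Weak convergence and conditional probabilities\<close>

abbreviation top_borel :: "'b topology \<Rightarrow> 'b measure" where
  "top_borel T \<equiv> sigma (topspace T) {U. openin T U}"

lemma sets_top_borel: "sets (top_borel T) = sigma_sets (topspace T) {U. openin T U}"
  by (rule sets_measure_of) (auto dest: openin_subset)

lemma space_top_borel: "space (top_borel T) = topspace T"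
  by (rule space_measure_of) (auto dest: openin_subset)

lemma openin_sets_top_borel: "openin T U \<Longrightarrow> U \<in> sets (top_borel T)"
  unfolding sets_top_borel by (rule sigma_sets.Basic) simp

lemma C1_borel_eq:
  fixes A :: "('a::{t2_space, second_countable_topology}, 'e::finite_dim_inner) chart set"
  assumes "smooth_atlas A"
  shows "(C1_borel A :: ('a \<Rightarrow> 'v::real_normed_vector) measure) = top_borel (weak_whitney A)"
  unfolding C1_borel_def topspace_weak_whitney[OF assms] ..

lemma borel_measurable_continuous_map:
  fixes h :: "'b \<Rightarrow> real"
  assumes h: "continuous_map T euclideanreal h" and M: "sets M = sets (top_borel T)"
  shows "h \<in> borel_measurable M"
proof (rule borel_measurableI)
  fix S :: "real set" assume "open S"
  then have "openin T {x \<in> topspace T. h x \<in> S}"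
    by (intro openin_continuous_map_preimage[OF h]) auto
  moreover have "h -` S \<inter> space M = {x \<in> topspace T. h x \<in> S}"
    using sets_eq_imp_space_eq[OF M] by (auto simp: space_top_borel)
  ultimately show "h -` S \<inter> space M \<in> sets M"
    unfolding M using openin_sets_top_borel by simp
qed

lemma measurable_continuous_map:
  assumes F: "continuous_map T T' F"
  shows "F \<in> top_borel T \<rightarrow>\<^sub>M top_borel T'"
proof (rule measurable_measure_of)
  show "{U. openin T' U} \<subseteq> Pow (topspace T')" by (auto dest: openin_subset)
  show "F \<in> space (top_borel T) \<rightarrow> topspace T'"
    using F by (auto simp: continuous_map_def space_top_borel)
  fix U assume "U \<in> {U. openin T' U}"
  then have "openin T {x \<in> topspace T. F x \<in> U}" by (intro openin_continuous_map_preimage[OF F]) auto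
  moreover have "F -` U \<inter> space (top_borel T) = {x \<in> topspace T. F x \<in> U}" by (auto simp: space_top_borel)
  ultimately show "F -` U \<inter> space (top_borel T) \<in> sets (top_borel T)"
    using openin_sets_top_borel by simp
qed

lemma integrable_bounded_continuous_map:
  fixes h :: "'b \<Rightarrow> real"
  assumes "finite_measure M" "sets M = sets (top_borel T)" "continuous_map T euclideanreal h"
    and "\<And>f. f \<in> topspace T \<Longrightarrow> \<bar>h f\<bar> \<le> C"
  shows "integrable M h"
proof (rule finite_measure.integrable_const_bound[OF assms(1), of h C])
  show "AE f in M. norm (h f) \<le> C"
    using assms(4) sets_eq_imp_space_eq[OF assms(2)] by (intro AE_I2) (simp add: space_top_borel)
qed (rule borel_measurable_continuous_map[OF assms(3,2)])

text \<open>
  The error of replacing \<open>R (\<pi> z)\<close> by \<open>R q0\<close> is dominated by its oscillation over a compact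
  neighbourhood of \<open>q0\<close>, which is again a bounded continuous test function; no tightness is needed.
\<close>

lemma tendsto_integral_varying_integrand:
  fixes \<nu> :: "'z \<Rightarrow> 'b measure" and R :: "'s::topological_space \<Rightarrow> 'b \<Rightarrow> real"
  assumes sets: "\<And>z. sets (\<nu> z) = sets (top_borel T)" "sets \<nu>0 = sets (top_borel T)"
    and fin: "\<And>z. finite_measure (\<nu> z)" "finite_measure \<nu>0"
    and weak: "\<And>h. continuous_map T euclideanreal h \<Longrightarrow> bounded (h ` topspace T) \<Longrightarrow>
      ((\<lambda>z. \<integral>f. h f \<partial>\<nu> z) \<longlongrightarrow> (\<integral>f. h f \<partial>\<nu>0)) G"
    and \<pi>: "(\<pi> \<longlongrightarrow> q0) G"
    and R: "\<And>q f. f \<in> topspace T \<Longrightarrow> ((\<lambda>z. R (fst z) (snd z)) \<longlongrightarrow> R q f) (nhds q \<times>\<^sub>F nhdsin T f)"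
    and bound: "\<forall>\<^sub>F q in nhds q0. \<forall>f\<in>topspace T. \<bar>R q f\<bar> \<le> C"
    and U: "\<And>n. compact (U n)" "\<And>n. \<forall>\<^sub>F q in nhds q0. q \<in> U n"
      "\<And>V. open V \<Longrightarrow> q0 \<in> V \<Longrightarrow> \<forall>\<^sub>F n in sequentially. U n \<subseteq> V"
  shows "((\<lambda>z. \<integral>f. R (\<pi> z) f \<partial>\<nu> z) \<longlongrightarrow> (\<integral>f. R q0 f \<partial>\<nu>0)) G"
proof -
  have space: "space (\<nu> z) = topspace T" "space \<nu>0 = topspace T" for z
    using sets_eq_imp_space_eq[OF sets(1)] sets_eq_imp_space_eq[OF sets(2)]
    unfolding space_top_borel by auto
  obtain V where V: "open V" "q0 \<in> V" "\<And>q f. q \<in> V \<Longrightarrow> f \<in> topspace T \<Longrightarrow> \<bar>R q f\<bar> \<le> C"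
    using bound unfolding eventually_nhds by blast
  \<comment> \<open>From \<open>N\<close> on the compact sets lie in the region where
    \<open>C\<close> bounds \<open>R\<close>; the suprema in \<open>osc\<close> are suprema of
    bounded sets only from there.\<close>
  obtain N where N: "\<And>n. N \<le> n \<Longrightarrow> U n \<subseteq> V"
    using U(3)[OF V(1,2)] unfolding eventually_sequentially by blast
  have q0: "q0 \<in> U n" for n using eventually_nhds_x_imp_x[OF U(2)] .
  have contR: "continuous_map T euclideanreal (R q)" for q
    unfolding continuous_map_real_iff_nhdsin using tendsto_apply_at[OF R] by blast
  define d where "d q f = \<bar>R q f - R q0 f\<bar>" for q f
  define osc where "osc n f = (SUP q\<in>U n. d q f)" for n f
  have d_le: "d q f \<le> 2 * C" if "q \<in> U n" "N \<le> n" "f \<in> topspace T" for q f n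
    using V(3)[of q f] V(3)[of q0 f] that N[of n] V(2) by (auto simp: d_def)
  have bdd: "bdd_above ((\<lambda>q. d q f) ` U n)" if "N \<le> n" "f \<in> topspace T" for f n
    using d_le that by (intro bdd_aboveI[of _ "2 * C"]) auto
  have d_osc: "d q f \<le> osc n f" if "q \<in> U n" "N \<le> n" "f \<in> topspace T" for q f n
    unfolding osc_def by (rule cSUP_upper[OF that(1) bdd[OF that(2,3)]])
  have osc_least: "osc n f \<le> x" if "\<And>q. q \<in> U n \<Longrightarrow> d q f \<le> x" for n f x
    unfolding osc_def using q0 that by (intro cSUP_least) auto
  have osc_nonneg: "0 \<le> osc n f" if "N \<le> n" "f \<in> topspace T" for f n
    using d_osc[OF q0 that] by (simp add: d_def)
  have osc_abs: "\<bar>osc n f\<bar> \<le> 2 * C" if "N \<le> n" "f \<in> topspace T" for f n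
    using osc_nonneg[OF that] osc_least[OF d_le[OF _ that]] by simp
  \<comment> \<open>By the tube lemma \<open>d q f\<close> is close to \<open>d q f0\<close>
    simultaneously for all \<open>q\<close> in the compact set, and suprema of uniformly close
    functions are close.\<close>
  have osc_cont: "continuous_map T euclideanreal (osc n)" if n: "N \<le> n" for n
    unfolding continuous_map_real_iff_nhdsin
  proof (intro ballI tendstoI)
    fix f0 and \<epsilon> :: real assume f0: "f0 \<in> topspace T" and \<epsilon>: "0 < \<epsilon>"
    have "\<forall>\<^sub>F f in nhdsin T f0. \<forall>q\<in>U n. \<bar>d q f - d q f0\<bar> < \<epsilon> / 2"
    proof (rule eventually_Ball_compact[OF U(1)])
      fix q :: 's
      let ?G = "nhds q \<times>\<^sub>F nhdsin T f0"
      have "filterlim (\<lambda>z. (fst z, f0)) ?G ?G"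
      proof (intro filterlim_Pair filterlim_fst_prod)
        show "filterlim (\<lambda>z. f0) (nhdsin T f0) ?G"
          unfolding filterlim_iff eventually_nhdsin using f0 by auto
      qed
      from filterlim_compose[OF R[OF f0] this]
      have "((\<lambda>z. R (fst z) f0) \<longlongrightarrow> R q f0) ?G" by simp
      moreover have "((\<lambda>z. R q0 (snd z)) \<longlongrightarrow> R q0 f0) ?G"
        by (rule filterlim_compose[OF tendsto_apply_at[OF R[OF f0]] filterlim_snd_prod])
      ultimately have "((\<lambda>z. d (fst z) (snd z) - d (fst z) f0) \<longlongrightarrow> d q f0 - d q f0) ?G"
        unfolding d_def by (intro tendsto_intros R[OF f0])
      then have "\<forall>\<^sub>F z in ?G. dist (d (fst z) (snd z) - d (fst z) f0) 0 < \<epsilon> / 2"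
        using \<epsilon> by (intro tendstoD) auto
      then show "\<forall>\<^sub>F z in ?G. \<bar>d (fst z) (snd z) - d (fst z) f0\<bar> < \<epsilon> / 2" by simp
    qed
    with eventually_nhdsin_topspace[of T f0] show "\<forall>\<^sub>F f in nhdsin T f0. dist (osc n f) (osc n f0) < \<epsilon>"
    proof eventually_elim
      case (elim f)
      have "d q f \<le> osc n f0 + \<epsilon> / 2" if "q \<in> U n" for q
        using bspec[OF elim(2) that] d_osc[OF that n f0] by linarith
      then have 1: "osc n f \<le> osc n f0 + \<epsilon> / 2" by (rule osc_least)
      have "d q f0 \<le> osc n f + \<epsilon> / 2" if "q \<in> U n" for q
        using bspec[OF elim(2) that] d_osc[OF that n elim(1)] by linarith
      then have "osc n f0 \<le> osc n f + \<epsilon> / 2" by (rule osc_least)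
      with 1 \<epsilon> show ?case by (simp add: dist_real_def abs_le_iff)
    qed
  qed
  \<comment> \<open>Only pointwise in \<open>f\<close>: the joint limit of \<open>R\<close> contains
    continuity of \<open>q \<mapsto> R q f\<close> at \<open>q0\<close>. The bound
    \<open>2 * C\<close> then allows dominated convergence under \<open>\<nu>0\<close>.\<close>
  have osc_lim: "(\<lambda>n. osc (n + N) f) \<longlonglongrightarrow> 0" if f: "f \<in> topspace T" for f
  proof (rule tendstoI)
    fix \<epsilon> :: real assume \<epsilon>: "0 < \<epsilon>"
    have "filterlim (\<lambda>q. (q, f)) (nhds q0 \<times>\<^sub>F nhdsin T f) (nhds q0)"
    proof (intro filterlim_Pair filterlim_ident)
      show "filterlim (\<lambda>z. f) (nhdsin T f) (nhds q0)"
        unfolding filterlim_iff eventually_nhdsin using f by auto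
    qed
    from filterlim_compose[OF R[OF f] this]
    have "((\<lambda>q. R q f) \<longlongrightarrow> R q0 f) (nhds q0)" by simp
    then have "\<forall>\<^sub>F q in nhds q0. dist (R q f) (R q0 f) < \<epsilon> / 2" using \<epsilon> by (intro tendstoD) auto
    then obtain W where W: "open W" "q0 \<in> W" "\<And>q. q \<in> W \<Longrightarrow> d q f < \<epsilon> / 2"
      unfolding eventually_nhds by (auto simp: d_def dist_real_def)
    have "\<forall>\<^sub>F n in sequentially. U (n + N) \<subseteq> W"
      using U(3)[OF W(1,2)] by (rule eventually_all_ge_at_top[THEN eventually_mono]) auto
    then show "\<forall>\<^sub>F n in sequentially. dist (osc (n + N) f) 0 < \<epsilon>"
    proof eventually_elim
      case (elim n)
      have "osc (n + N) f \<le> \<epsilon> / 2" using elim W(3) by (intro osc_least) (auto intro: less_imp_le)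
      then show ?case using osc_nonneg[of "n + N" f] f \<epsilon> by simp
    qed
  qed
  have "(\<lambda>n. \<integral>f. osc (n + N) f \<partial>\<nu>0) \<longlonglongrightarrow> (\<integral>f. 0 \<partial>\<nu>0)"
  proof (rule integral_dominated_convergence[where w = "\<lambda>_. 2 * C"])
    show "osc (n + N) \<in> borel_measurable \<nu>0" for n
      by (rule borel_measurable_continuous_map[OF osc_cont sets(2)]) simp
    show "integrable \<nu>0 (\<lambda>_. 2 * C)" using fin(2) by (simp add: finite_measure.integrable_const)
    show "AE f in \<nu>0. (\<lambda>n. osc (n + N) f) \<longlonglongrightarrow> 0" using osc_lim by (intro AE_I2) (simp add: space)
    show "AE f in \<nu>0. norm (osc (n + N) f) \<le> 2 * C" for n
      using osc_abs[of "n + N"] by (intro AE_I2) (simp add: space)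
  qed simp
  then have osc_int: "(\<lambda>n. \<integral>f. osc (n + N) f \<partial>\<nu>0) \<longlonglongrightarrow> 0" by simp
  have bounded: "bounded (h ` topspace T)" if "\<And>f. f \<in> topspace T \<Longrightarrow> \<bar>h f\<bar> \<le> B" for h :: "'b \<Rightarrow> real" and B
    using that by (auto simp: bounded_iff intro!: exI[of _ B])
  show ?thesis
  proof (rule tendstoI)
    fix \<epsilon> :: real assume \<epsilon>: "0 < \<epsilon>"
    have "\<forall>\<^sub>F n in sequentially. (\<integral>f. osc (n + N) f \<partial>\<nu>0) < \<epsilon> / 2"
      by (rule order_tendstoD(2)[OF osc_int]) (use \<epsilon> in simp)
    from eventually_happens'[OF sequentially_bot this]
    obtain m where m: "(\<integral>f. osc (m + N) f \<partial>\<nu>0) < \<epsilon> / 2" by blast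
    \<comment> \<open>The order of choices matters: \<open>n\<close> is fixed with the limit measure
      alone, and weak convergence then transfers the smallness of the integral of
      \<open>osc n\<close> to \<open>\<nu> z\<close>.\<close>
    define n where "n = m + N"
    have n: "N \<le> n" by (simp add: n_def)
    have "((\<lambda>z. \<integral>f. osc n f \<partial>\<nu> z) \<longlongrightarrow> (\<integral>f. osc n f \<partial>\<nu>0)) G"
      by (rule weak[OF osc_cont[OF n] bounded[OF osc_abs[OF n]]])
    then have ev1: "\<forall>\<^sub>F z in G. (\<integral>f. osc n f \<partial>\<nu> z) < \<epsilon> / 2"
      by (rule order_tendstoD(2)) (use m in \<open>simp add: n_def\<close>)
    have "((\<lambda>z. \<integral>f. R q0 f \<partial>\<nu> z) \<longlongrightarrow> (\<integral>f. R q0 f \<partial>\<nu>0)) G"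
      by (rule weak[OF contR bounded[OF V(3)[OF V(2)]]])
    then have ev2: "\<forall>\<^sub>F z in G. dist (\<integral>f. R q0 f \<partial>\<nu> z) (\<integral>f. R q0 f \<partial>\<nu>0) < \<epsilon> / 2"
      using \<epsilon> by (intro tendstoD) auto
    have ev3: "\<forall>\<^sub>F z in G. \<pi> z \<in> U n"
      using \<pi> U(2)[of n] by (auto simp: filterlim_iff)
    show "\<forall>\<^sub>F z in G. dist (\<integral>f. R (\<pi> z) f \<partial>\<nu> z) (\<integral>f. R q0 f \<partial>\<nu>0) < \<epsilon>"
      using ev1 ev2 ev3
    proof eventually_elim
      case (elim z)
      have \<pi>V: "\<pi> z \<in> V" using elim(3) N[OF n] by blast
      have int: "integrable (\<nu> z) (R q)" if "q \<in> V" for q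
        by (rule integrable_bounded_continuous_map[OF fin(1) sets(1) contR V(3)[OF that]])
      have "\<bar>(\<integral>f. R (\<pi> z) f \<partial>\<nu> z) - (\<integral>f. R q0 f \<partial>\<nu> z)\<bar> = \<bar>\<integral>f. R (\<pi> z) f - R q0 f \<partial>\<nu> z\<bar>"
        using int[OF \<pi>V] int[OF V(2)] by simp
      also have "\<dots> \<le> (\<integral>f. \<bar>R (\<pi> z) f - R q0 f\<bar> \<partial>\<nu> z)" by (rule integral_abs_bound)
      also have "\<dots> \<le> (\<integral>f. osc n f \<partial>\<nu> z)"
      proof (rule integral_mono)
        show "integrable (\<nu> z) (\<lambda>f. \<bar>R (\<pi> z) f - R q0 f\<bar>)" using int[OF \<pi>V] int[OF V(2)] by auto
        show "integrable (\<nu> z) (osc n)"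
          by (rule integrable_bounded_continuous_map[OF fin(1) sets(1) osc_cont[OF n] osc_abs[OF n]])
        show "\<bar>R (\<pi> z) f - R q0 f\<bar> \<le> osc n f" if "f \<in> space (\<nu> z)" for f
          using d_osc[OF elim(3) n] that by (simp add: d_def space)
      qed
      finally show ?case using elim(1,2) unfolding dist_real_def by linarith
    qed
  qed
qed

section \<open>Regular conditional probabilities: disintegration and almost sure uniqueness\<close>

lemma regular_cond_prob_kernel:
  assumes "regular_cond_prob P N X Y \<kappa>"
  shows "\<kappa> \<in> borel \<rightarrow>\<^sub>M subprob_algebra N"
  using assms unfolding regular_cond_prob_def
  by (intro measurable_subprob_algebra) (auto intro: prob_space_imp_subprob_space)

text \<open>The defining identity says that mixing the \<open>\<kappa> y\<close> over the law of
  \<open>Y\<close> restricted to \<open>V\<close> gives the distribution of \<open>X\<close> under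
  \<open>P\<close> restricted to \<open>Y \<in> V\<close>. Equal measures have equal integrals of
  \<open>F\<close>.\<close>

lemma regular_cond_prob_disintegration:
  fixes Y :: "'w \<Rightarrow> 'y::topological_space"
  assumes \<kappa>: "regular_cond_prob P N X Y \<kappa>" and X: "X \<in> P \<rightarrow>\<^sub>M N" and Y: "Y \<in> borel_measurable P"
    and F: "F \<in> borel_measurable N" and V: "V \<in> sets borel"
  shows "(\<integral>\<^sup>+ y\<in>V. (\<integral>\<^sup>+ f. F f \<partial>\<kappa> y) \<partial>distr P borel Y) = (\<integral>\<^sup>+ \<omega>. F (X \<omega>) * indicator V (Y \<omega>) \<partial>P)"
proof -
  let ?law = "distr P borel Y"
  let ?L = "density ?law (indicator V)"
  let ?Q = "density P (\<lambda>\<omega>. indicator V (Y \<omega>))"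
  have K: "\<kappa> \<in> ?L \<rightarrow>\<^sub>M subprob_algebra N"
    using regular_cond_prob_kernel[OF \<kappa>] by (simp cong: measurable_cong_sets)
  have ne: "space ?L \<noteq> {}" by simp
  have XQ: "X \<in> ?Q \<rightarrow>\<^sub>M N" using X by (simp cong: measurable_cong_sets)
  have "?L \<bind> \<kappa> = distr ?Q N X"
  proof (rule measure_eqI)
    show sets_eq: "sets (?L \<bind> \<kappa>) = sets (distr ?Q N X)"
      using sets_bind[of ?L \<kappa> N] \<kappa> ne by (simp add: regular_cond_prob_def)
    fix B assume "B \<in> sets (?L \<bind> \<kappa>)"
    then have B: "B \<in> sets N" using sets_eq by simp
    have mB: "(\<lambda>y. emeasure (\<kappa> y) B) \<in> borel_measurable borel"
      using \<kappa> B unfolding regular_cond_prob_def by blast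
    have "emeasure (?L \<bind> \<kappa>) B = (\<integral>\<^sup>+ y. emeasure (\<kappa> y) B \<partial>?L)" by (rule emeasure_bind[OF ne K B])
    also have "\<dots> = (\<integral>\<^sup>+ y\<in>V. emeasure (\<kappa> y) B \<partial>?law)"
      using V mB by (subst nn_integral_density) (auto simp: mult.commute)
    also have "\<dots> = emeasure P {\<omega> \<in> space P. X \<omega> \<in> B \<and> Y \<omega> \<in> V}"
      using \<kappa> B V unfolding regular_cond_prob_def by simp
    also have "\<dots> = (\<integral>\<^sup>+ \<omega>. indicator V (Y \<omega>) * indicator (X -` B \<inter> space P) \<omega> \<partial>P)"
    proof -
      have "{\<omega> \<in> space P. X \<omega> \<in> B \<and> Y \<omega> \<in> V} = (X -` B \<inter> space P) \<inter> (Y -` V \<inter> space P)" by auto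
      then have "{\<omega> \<in> space P. X \<omega> \<in> B \<and> Y \<omega> \<in> V} \<in> sets P"
        using measurable_sets[OF X B] measurable_sets[OF Y V] by simp
      then have "emeasure P {\<omega> \<in> space P. X \<omega> \<in> B \<and> Y \<omega> \<in> V}
          = (\<integral>\<^sup>+ \<omega>. indicator {\<omega> \<in> space P. X \<omega> \<in> B \<and> Y \<omega> \<in> V} \<omega> \<partial>P)" by simp
      also have "\<dots> = (\<integral>\<^sup>+ \<omega>. indicator V (Y \<omega>) * indicator (X -` B \<inter> space P) \<omega> \<partial>P)"
        by (intro nn_integral_cong) (auto simp: indicator_def)
      finally show ?thesis .
    qed
    also have "\<dots> = emeasure ?Q (X -` B \<inter> space P)"
      using measurable_sets[OF X B] V Y by (subst emeasure_density) auto
    also have "\<dots> = emeasure (distr ?Q N X) B" using XQ B by (simp add: emeasure_distr)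
    finally show "emeasure (?L \<bind> \<kappa>) B = emeasure (distr ?Q N X) B" .
  qed
  then have "(\<integral>\<^sup>+ f. F f \<partial>(?L \<bind> \<kappa>)) = (\<integral>\<^sup>+ f. F f \<partial>distr ?Q N X)" by simp
  moreover have "(\<integral>\<^sup>+ f. F f \<partial>(?L \<bind> \<kappa>)) = (\<integral>\<^sup>+ y. (\<integral>\<^sup>+ f. F f \<partial>\<kappa> y) \<partial>?L)"
    by (rule nn_integral_bind[OF F K])
  moreover have "\<dots> = (\<integral>\<^sup>+ y\<in>V. (\<integral>\<^sup>+ f. F f \<partial>\<kappa> y) \<partial>?law)"
  proof -
    have "(\<lambda>y. \<integral>\<^sup>+ f. F f \<partial>\<kappa> y) \<in> borel_measurable borel"
      using measurable_compose[OF regular_cond_prob_kernel[OF \<kappa>] nn_integral_measurable_subprob_algebra[OF F]] .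
    then show ?thesis using V by (subst nn_integral_density) (auto simp: mult.commute)
  qed
  moreover have "(\<integral>\<^sup>+ f. F f \<partial>distr ?Q N X) = (\<integral>\<^sup>+ \<omega>. F (X \<omega>) * indicator V (Y \<omega>) \<partial>P)"
  proof -
    have "(\<lambda>\<omega>. F (X \<omega>)) \<in> borel_measurable P" by (rule measurable_compose[OF X F])
    then show ?thesis
      using V Y by (subst nn_integral_distr[OF XQ]) (use F in \<open>auto simp: nn_integral_density mult.commute\<close>)
  qed
  ultimately show ?thesis by simp
qed

text \<open>By disintegration the two functions of \<open>y\<close> are densities of one and the
  same measure. The exceptional null set depends on \<open>F\<close>.\<close>

lemma regular_cond_prob_unique:
  fixes Y :: "'w \<Rightarrow> 'y::topological_space"
  assumes P: "prob_space P" and \<kappa>: "regular_cond_prob P N X Y \<kappa>" and \<kappa>': "regular_cond_prob P N X Y \<kappa>'"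
    and X: "X \<in> P \<rightarrow>\<^sub>M N" and Y: "Y \<in> borel_measurable P" and F: "F \<in> borel_measurable N"
  shows "AE y in distr P borel Y. (\<integral>\<^sup>+ f. F f \<partial>\<kappa> y) = (\<integral>\<^sup>+ f. F f \<partial>\<kappa>' y)"
proof (rule sigma_finite_measure.density_unique2)
  have "prob_space (distr P borel Y)" by (rule prob_space.prob_space_distr[OF P Y])
  then show "sigma_finite_measure (distr P borel Y)"
    by (simp add: prob_space_imp_sigma_finite)
  show "(\<lambda>y. \<integral>\<^sup>+ f. F f \<partial>\<kappa> y) \<in> borel_measurable (distr P borel Y)"
    "(\<lambda>y. \<integral>\<^sup>+ f. F f \<partial>\<kappa>' y) \<in> borel_measurable (distr P borel Y)"
    using measurable_compose[OF regular_cond_prob_kernel[OF \<kappa>] nn_integral_measurable_subprob_algebra[OF F]]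
      measurable_compose[OF regular_cond_prob_kernel[OF \<kappa>'] nn_integral_measurable_subprob_algebra[OF F]]
    by simp_all
  fix V assume "V \<in> sets (distr P borel Y)"
  then have "V \<in> sets borel" by simp
  from regular_cond_prob_disintegration[OF \<kappa> X Y F this] regular_cond_prob_disintegration[OF \<kappa>' X Y F this]
  show "(\<integral>\<^sup>+ y\<in>V. (\<integral>\<^sup>+ f. F f \<partial>\<kappa> y) \<partial>distr P borel Y) = (\<integral>\<^sup>+ y\<in>V. (\<integral>\<^sup>+ f. F f \<partial>\<kappa>' y) \<partial>distr P borel Y)"
    by simp
qed

text \<open>If the values at \<open>x\<close> differed, the functions would differ on a whole ball
  around \<open>x\<close>, which has positive volume. The predicate \<open>P\<close> allows for
  equality known only where a density is positive.\<close>

lemma isCont_eq_if_AE_eq: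
  fixes F F' :: "'v::euclidean_space \<Rightarrow> real"
  assumes F: "isCont F x" "isCont F' x" and near: "\<forall>\<^sub>F y in nhds x. P y"
    and AE: "AE y in lborel. P y \<longrightarrow> F y = F' y"
  shows "F x = F' x"
proof (rule ccontr)
  assume "F x \<noteq> F' x"
  moreover have "isCont (\<lambda>y. F y - F' y) x" using F by (intro continuous_intros)
  then have "((\<lambda>y. F y - F' y) \<longlongrightarrow> F x - F' x) (nhds x)"
    unfolding isCont_def by (rule tendsto_at_iff_tendsto_nhds[THEN iffD1])
  ultimately have "\<forall>\<^sub>F y in nhds x. F y - F' y \<noteq> 0"
    by (intro tendsto_imp_eventually_ne) auto
  with near have "\<forall>\<^sub>F y in nhds x. P y \<and> F y \<noteq> F' y" by eventually_elim simp
  then obtain e where e: "0 < e" "\<And>y. dist y x < e \<Longrightarrow> P y \<and> F y \<noteq> F' y"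
    unfolding eventually_nhds_metric by blast
  have "AE y in lborel. y \<notin> ball x e"
    using AE by eventually_elim (use e(2) in \<open>auto simp: dist_commute\<close>)
  then have "emeasure lborel (ball x e) = 0"
    by (subst (asm) AE_iff_measurable[of "ball x e"]) auto
  then have "measure lebesgue (ball x e) = 0" by (simp add: measure_def)
  with content_ball_pos[OF e(1), of x] show False by simp
qed

section \<open>Zonoids\<close>

lemma zonotope_compact_convex:
  fixes Z :: "'v::real_normed_vector set"
  assumes "zonotope Z"
  shows "compact Z" "convex Z" "Z \<noteq> {}"
proof -
  have *: "compact {\<Sum>i<n. x i | x. \<forall>i<n. x i \<in> closed_segment (a i) (b i)} \<and>
      convex {\<Sum>i<n. x i | x. \<forall>i<n. x i \<in> closed_segment (a i) (b i)} \<and>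
      {\<Sum>i<n. x i | x. \<forall>i<n. x i \<in> closed_segment (a i) (b i)} \<noteq> {}"
    for n :: nat and a b :: "nat \<Rightarrow> 'v"
  proof (induction n)
    case 0
    have "{\<Sum>i<0. x i | x :: nat \<Rightarrow> 'v. \<forall>i<0. x i \<in> closed_segment (a i) (b i)} = {0}" by auto
    then show ?case by simp
  next
    case (Suc n)
    let ?Z = "\<lambda>n. {\<Sum>i<n. x i | x. \<forall>i<n. x i \<in> closed_segment (a i) (b i)}"
    have eq: "?Z (Suc n) = {x + y | x y. x \<in> ?Z n \<and> y \<in> closed_segment (a n) (b n)}"
    proof
      show "?Z (Suc n) \<subseteq> {x + y | x y. x \<in> ?Z n \<and> y \<in> closed_segment (a n) (b n)}"
        by fastforce
      show "{x + y | x y. x \<in> ?Z n \<and> y \<in> closed_segment (a n) (b n)} \<subseteq> ?Z (Suc n)"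
      proof
        fix z assume "z \<in> {x + y | x y. x \<in> ?Z n \<and> y \<in> closed_segment (a n) (b n)}"
        then obtain x y where z: "z = (\<Sum>i<n. x i) + y" "\<forall>i<n. x i \<in> closed_segment (a i) (b i)"
          "y \<in> closed_segment (a n) (b n)" by blast
        then have "z = (\<Sum>i<Suc n. (x(n := y)) i)" "\<forall>i<Suc n. (x(n := y)) i \<in> closed_segment (a i) (b i)"
          by (auto simp: less_Suc_eq)
        then show "z \<in> ?Z (Suc n)" by blast
      qed
    qed
    show ?case unfolding eq
    proof (intro conjI)
      show "compact {x + y | x y. x \<in> ?Z n \<and> y \<in> closed_segment (a n) (b n)}"
        using Suc by (intro compact_sums) auto
      have "{x + y | x y. x \<in> ?Z n \<and> y \<in> closed_segment (a n) (b n)} = (\<Union>x\<in>?Z n. \<Union>y\<in>closed_segment (a n) (b n). {x + y})"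
        by blast
      then show "convex {x + y | x y. x \<in> ?Z n \<and> y \<in> closed_segment (a n) (b n)}"
        using Suc convex_sums[of "?Z n" "closed_segment (a n) (b n)"] by simp
      obtain x where "x \<in> ?Z n" using Suc by blast
      then show "{x + y | x y. x \<in> ?Z n \<and> y \<in> closed_segment (a n) (b n)} \<noteq> {}"
        using ends_in_segment(1)[of "a n" "b n"] by blast
    qed
  qed
  obtain n :: nat and a b :: "nat \<Rightarrow> 'v" where "Z = {\<Sum>i<n. x i | x. \<forall>i<n. x i \<in> closed_segment (a i) (b i)}"
    using assms unfolding zonotope_def by blast
  with *[of n a b] show "compact Z" "convex Z" "Z \<noteq> {}" by auto
qed

text \<open>A sum of the segments from 0 to \<open>b \<tau>\<close>, renumbered because
  \<open>zonotope\<close> indexes its segments by natural numbers.\<close>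

lemma zonotopeI_finite:
  fixes b :: "'i \<Rightarrow> 'v::real_normed_vector"
  assumes "finite T"
  shows "zonotope {\<Sum>\<tau>\<in>T. t \<tau> *\<^sub>R b \<tau> | t. \<forall>\<tau>\<in>T. 0 \<le> t \<tau> \<and> t \<tau> \<le> 1}"
proof -
  obtain h where h: "bij_betw h {..<card T} T"
    using ex_bij_betw_nat_finite[OF assms] by (auto simp: atLeast0LessThan)
  let ?n = "card T"
  let ?g = "inv_into {..<?n} h"
  have hT: "h i \<in> T" if "i < ?n" for i using h that by (auto simp: bij_betw_def)
  have gh: "?g (h i) = i" if "i < ?n" for i
    using h that by (intro inv_into_f_f) (auto simp: bij_betw_def)
  have seg: "x \<in> closed_segment 0 y \<longleftrightarrow> (\<exists>t. 0 \<le> t \<and> t \<le> 1 \<and> x = t *\<^sub>R y)" for x y :: 'v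
    by (auto simp: closed_segment_def)
  have "{\<Sum>\<tau>\<in>T. t \<tau> *\<^sub>R b \<tau> | t. \<forall>\<tau>\<in>T. 0 \<le> t \<tau> \<and> t \<tau> \<le> 1}
      = {\<Sum>i<?n. x i | x. \<forall>i<?n. x i \<in> closed_segment 0 (b (h i))}" (is "?L = ?R")
  proof
    show "?L \<subseteq> ?R"
    proof
      fix z assume "z \<in> ?L"
      then obtain t where t: "z = (\<Sum>\<tau>\<in>T. t \<tau> *\<^sub>R b \<tau>)" "\<forall>\<tau>\<in>T. 0 \<le> t \<tau> \<and> t \<tau> \<le> 1" by blast
      have "z = (\<Sum>i<?n. t (h i) *\<^sub>R b (h i))" unfolding t(1) by (rule sum.reindex_bij_betw[OF h, symmetric])
      moreover have "\<forall>i<?n. t (h i) *\<^sub>R b (h i) \<in> closed_segment 0 (b (h i))"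
        using t(2) hT unfolding seg by blast
      ultimately show "z \<in> ?R" by blast
    qed
    show "?R \<subseteq> ?L"
    proof
      fix z assume "z \<in> ?R"
      then obtain x where x: "z = (\<Sum>i<?n. x i)" "\<forall>i<?n. x i \<in> closed_segment 0 (b (h i))" by blast
      then obtain t where t: "\<And>i. i < ?n \<Longrightarrow> 0 \<le> t i \<and> t i \<le> 1 \<and> x i = t i *\<^sub>R b (h i)"
        unfolding seg by metis
      have "z = (\<Sum>i<?n. t (?g (h i)) *\<^sub>R b (h i))" unfolding x(1) using t gh by (intro sum.cong) auto
      also have "\<dots> = (\<Sum>\<tau>\<in>T. t (?g \<tau>) *\<^sub>R b \<tau>)" by (rule sum.reindex_bij_betw[OF h])
      finally have "z = (\<Sum>\<tau>\<in>T. t (?g \<tau>) *\<^sub>R b \<tau>)" .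
      moreover have "0 \<le> t (?g \<tau>) \<and> t (?g \<tau>) \<le> 1" if "\<tau> \<in> T" for \<tau>
      proof -
        have "\<tau> \<in> h ` {..<?n}" using that bij_betw_imp_surj_on[OF h] by simp
        then obtain i where "i < ?n" "\<tau> = h i" by blast
        then show ?thesis using t gh by simp
      qed
      ultimately show "z \<in> ?L" by (intro CollectI exI[of _ "\<lambda>\<tau>. t (?g \<tau>)"]) blast
    qed
  qed
  then show ?thesis unfolding zonotope_def
    by (intro exI[of _ ?n] exI[of _ "\<lambda>_. 0"] exI[of _ "\<lambda>i. b (h i)"])
qed

text \<open>Boundedness and nonemptiness make the suprema in \<open>hausdorff_dist\<close> suprema
  of bounded sets of reals, so that they dominate each member.\<close>

lemma infdist_le_hausdorff_dist:
  assumes "bounded K" "bounded L" "K \<noteq> {}" "L \<noteq> {}"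
  shows "x \<in> K \<Longrightarrow> infdist x L \<le> hausdorff_dist K L" "y \<in> L \<Longrightarrow> infdist y K \<le> hausdorff_dist K L"
proof -
  have bdd: "bdd_above ((\<lambda>x. infdist x L) ` K)" if KL: "bounded K" "L \<noteq> {}" for K L :: "'a set"
  proof -
    obtain l where l: "l \<in> L" using KL(2) by blast
    obtain B where "\<And>x. x \<in> K \<Longrightarrow> dist l x \<le> B" using KL(1) by (auto simp: bounded_any_center[where a = l])
    then show ?thesis
      by (intro bdd_aboveI[of _ B]) (auto intro: order_trans[OF infdist_le[OF l]] simp: dist_commute)
  qed
  show "infdist x L \<le> hausdorff_dist K L" if "x \<in> K"
    unfolding hausdorff_dist_def using cSUP_upper[OF that bdd[OF assms(1,4)]] by simp
  show "infdist y K \<le> hausdorff_dist K L" if "y \<in> L"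
    unfolding hausdorff_dist_def using cSUP_upper[OF that bdd[OF assms(2,3)]] by simp
qed

lemma hausdorff_dist_nonneg:
  assumes "bounded K" "bounded L" "K \<noteq> {}" "L \<noteq> {}"
  shows "0 \<le> hausdorff_dist K L"
proof -
  obtain x where "x \<in> K" using assms by blast
  from infdist_le_hausdorff_dist(1)[OF assms this] show ?thesis using infdist_nonneg[of x L] by linarith
qed

lemma hausdorff_dist_le:
  assumes "K \<noteq> {}" "L \<noteq> {}" "\<And>x. x \<in> K \<Longrightarrow> infdist x L \<le> r" "\<And>y. y \<in> L \<Longrightarrow> infdist y K \<le> r"
  shows "hausdorff_dist K L \<le> r"
  unfolding hausdorff_dist_def using assms by (intro max.boundedI cSUP_least) auto

lemma infdist_less_imp_ex:
  assumes "infdist x K < r" "K \<noteq> {}"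
  obtains y where "y \<in> K" "dist x y < r"
proof -
  have "\<exists>y\<in>K. dist x y < r"
  proof (rule ccontr)
    assume "\<not> ?thesis"
    then have "r \<le> (INF y\<in>K. dist x y)" using assms(2) by (intro cINF_greatest) (auto simp: not_less)
    then show False using assms by (simp add: infdist_notempty)
  qed
  then show thesis using that by blast
qed

text \<open>Convexity is not part of the definition of \<open>zonoid\<close>; it is inherited from
  zonotopes: approximate two points of \<open>K\<close>, combine the approximations, and use that
  \<open>K\<close> is closed.\<close>

lemma zonoid_convex:
  fixes K :: "'v::real_normed_vector set"
  assumes "zonoid K"
  shows "convex K"
proof (rule convexI)
  fix x y :: 'v and u v :: real
  assume x: "x \<in> K" and y: "y \<in> K" and uv: "0 \<le> u" "0 \<le> v" "u + v = 1"
  obtain Z where K: "K \<noteq> {}" "compact K" and Z: "\<And>n. zonotope (Z n)" "(\<lambda>n. hausdorff_dist (Z n) K) \<longlonglongrightarrow> 0"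
    using assms unfolding zonoid_def by blast
  let ?w = "u *\<^sub>R x + v *\<^sub>R y"
  have "infdist ?w K \<le> 0 + \<epsilon>" if \<epsilon>: "0 < \<epsilon>" for \<epsilon>
  proof -
    have "\<forall>\<^sub>F n in sequentially. hausdorff_dist (Z n) K < \<epsilon> / 2"
      by (rule order_tendstoD(2)[OF Z(2)]) (use \<epsilon> in simp)
    from eventually_happens'[OF sequentially_bot this]
    obtain n where n: "hausdorff_dist (Z n) K < \<epsilon> / 2" by blast
    note zn = zonotope_compact_convex[OF Z(1)[of n]]
    note hd = infdist_le_hausdorff_dist[OF compact_imp_bounded[OF zn(1)] compact_imp_bounded[OF K(2)] zn(3) K(1)]
    obtain x' where x': "x' \<in> Z n" "dist x x' < \<epsilon> / 2"
      using infdist_less_imp_ex[OF order.strict_trans1[OF hd(2)[OF x] n] zn(3)] by blast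
    obtain y' where y': "y' \<in> Z n" "dist y y' < \<epsilon> / 2"
      using infdist_less_imp_ex[OF order.strict_trans1[OF hd(2)[OF y] n] zn(3)] by blast
    let ?w' = "u *\<^sub>R x' + v *\<^sub>R y'"
    have "?w' \<in> Z n" using zn(2) x' y' uv by (intro convexD)
    from hd(1)[OF this] have "infdist ?w' K \<le> \<epsilon> / 2" using n by simp
    moreover have "dist ?w ?w' \<le> \<epsilon> / 2"
    proof -
      have "?w - ?w' = u *\<^sub>R (x - x') + v *\<^sub>R (y - y')" by (simp add: algebra_simps)
      then have "dist ?w ?w' \<le> u * dist x x' + v * dist y y'"
        using uv norm_triangle_ineq[of "u *\<^sub>R (x - x')" "v *\<^sub>R (y - y')"] by (simp add: dist_norm)
      also have "\<dots> \<le> u * (\<epsilon> / 2) + v * (\<epsilon> / 2)" using x' y' uv by (intro add_mono mult_left_mono) auto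
      also have "\<dots> = \<epsilon> / 2" using uv by (simp flip: distrib_right)
      finally show ?thesis .
    qed
    ultimately show ?thesis using infdist_triangle[of ?w K ?w'] by simp
  qed
  then have "infdist ?w K \<le> 0" by (rule field_le_epsilon)
  then have "infdist ?w K = 0" using infdist_nonneg[of ?w K] by simp
  then show "?w \<in> K"
    using in_closed_iff_infdist_zero[OF compact_imp_closed[OF K(2)] K(1)] by blast
qed

text \<open>Linear maps send segments to segments and therefore zonotopes to zonotopes, and a bound
  \<open>B\<close> for \<open>T\<close> controls how much Hausdorff distances grow. On support
  functions the image acts through the adjoint.\<close>

lemma zonoid_linear_image:
  assumes T: "bounded_linear T" and K: "zonoid K"
  shows "zonoid (T ` K)"
    and "support_function (T ` K) u = support_function K (u o\<^sub>L Blinfun T)"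
proof -
  interpret T: bounded_linear T by (rule T)
  obtain Z where K: "K \<noteq> {}" "compact K" and Z: "\<And>n. zonotope (Z n)" "(\<lambda>n. hausdorff_dist (Z n) K) \<longlonglongrightarrow> 0"
    using K unfolding zonoid_def by blast
  have image: "zonotope (T ` Y)" if Y: "zonotope Y" for Y
  proof -
    obtain n :: nat and a b where Y: "Y = {\<Sum>i<n. x i | x. \<forall>i<n. x i \<in> closed_segment (a i) (b i)}"
      using Y unfolding zonotope_def by blast
    have "T ` Y = {\<Sum>i<n. x i | x. \<forall>i<n. x i \<in> closed_segment (T (a i)) (T (b i))}" (is "_ = ?R")
    proof
      show "T ` Y \<subseteq> ?R"
      proof
        fix z assume "z \<in> T ` Y"
        then obtain x where x: "z = T (\<Sum>i<n. x i)" "\<forall>i<n. x i \<in> closed_segment (a i) (b i)"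
          unfolding Y by blast
        then show "z \<in> ?R"
          by (intro CollectI exI[of _ "\<lambda>i. T (x i)"])
            (auto simp: T.sum closed_segment_linear_image[OF T.linear])
      qed
      show "?R \<subseteq> T ` Y"
      proof
        fix z assume "z \<in> ?R"
        then obtain x where x: "z = (\<Sum>i<n. x i)" "\<forall>i<n. x i \<in> T ` closed_segment (a i) (b i)"
          unfolding closed_segment_linear_image[OF T.linear] by blast
        then obtain y where y: "\<And>i. i < n \<Longrightarrow> y i \<in> closed_segment (a i) (b i) \<and> x i = T (y i)"
          unfolding image_iff by metis
        then have "z = T (\<Sum>i<n. y i)" by (simp add: x T.sum)
        moreover have "(\<Sum>i<n. y i) \<in> Y" unfolding Y using y by blast
        ultimately show "z \<in> T ` Y" by blast
      qed
    qed
    then show ?thesis unfolding zonotope_def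
      by (intro exI[of _ n] exI[of _ "\<lambda>i. T (a i)"] exI[of _ "\<lambda>i. T (b i)"])
  qed
  obtain B where B: "0 < B" "\<And>x. norm (T x) \<le> norm x * B" using T.pos_bounded by blast
  have dist_T: "dist (T x) (T y) \<le> B * dist x y" for x y
    using B(2)[of "x - y"] by (simp add: dist_norm T.diff mult.commute)
  have inf_T: "infdist (T x) (T ` L) \<le> B * infdist x L" if L: "L \<noteq> {}" for x L
  proof -
    have "infdist (T x) (T ` L) / B \<le> (INF y\<in>L. dist x y)"
    proof (rule cINF_greatest[OF L])
      fix y assume y: "y \<in> L"
      have "infdist (T x) (T ` L) \<le> dist (T x) (T y)" using y by (intro infdist_le) blast
      then show "infdist (T x) (T ` L) / B \<le> dist x y"
        using B(1) dist_T[of x y] by (simp add: divide_le_eq mult.commute)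
    qed
    then show ?thesis using B(1) L by (simp add: infdist_notempty divide_le_eq mult.commute)
  qed
  have "(\<lambda>n. hausdorff_dist (T ` Z n) (T ` K)) \<longlonglongrightarrow> 0"
  proof (rule tendsto_sandwich[where f = "\<lambda>_. 0" and h = "\<lambda>n. B * hausdorff_dist (Z n) K"])
    show "(\<lambda>n. B * hausdorff_dist (Z n) K) \<longlonglongrightarrow> 0" using tendsto_mult_right_zero[OF Z(2)] by simp
    show "(\<lambda>n. 0) \<longlonglongrightarrow> (0::real)" by simp
    show "\<forall>\<^sub>F n in sequentially. 0 \<le> hausdorff_dist (T ` Z n) (T ` K)"
      using zonotope_compact_convex[OF Z(1)] K
      by (intro always_eventually allI hausdorff_dist_nonneg bounded_linear_image[OF compact_imp_bounded T]) auto
    show "\<forall>\<^sub>F n in sequentially. hausdorff_dist (T ` Z n) (T ` K) \<le> B * hausdorff_dist (Z n) K"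
    proof (intro always_eventually allI hausdorff_dist_le)
      fix n
      note zn = zonotope_compact_convex[OF Z(1)[of n]]
      note hd = infdist_le_hausdorff_dist[OF compact_imp_bounded[OF zn(1)] compact_imp_bounded[OF K(2)] zn(3) K(1)]
      show "T ` Z n \<noteq> {}" "T ` K \<noteq> {}" using zn(3) K(1) by auto
      show "infdist x (T ` K) \<le> B * hausdorff_dist (Z n) K" if "x \<in> T ` Z n" for x
      proof -
        from that obtain z where z: "x = T z" "z \<in> Z n" by blast
        show ?thesis unfolding z(1)
          by (rule order_trans[OF inf_T[OF K(1)]]) (use hd(1)[OF z(2)] B(1) in \<open>simp add: mult_left_mono\<close>)
      qed
      show "infdist x (T ` Z n) \<le> B * hausdorff_dist (Z n) K" if "x \<in> T ` K" for x
      proof -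
        from that obtain z where z: "x = T z" "z \<in> K" by blast
        show ?thesis unfolding z(1)
          by (rule order_trans[OF inf_T[OF zn(3)]]) (use hd(2)[OF z(2)] B(1) in \<open>simp add: mult_left_mono\<close>)
      qed
    qed
  qed
  moreover have "compact (T ` K)"
    by (intro compact_continuous_image K T.continuous_on continuous_on_id)
  ultimately show "zonoid (T ` K)"
    unfolding zonoid_def using K(1) image[OF Z(1)]
    by (intro conjI exI[of _ "\<lambda>n. T ` Z n"]) auto
  show "support_function (T ` K) u = support_function K (u o\<^sub>L Blinfun T)"
    unfolding support_function_def image_image
    by (simp add: bounded_linear_Blinfun_apply[OF T])
qed

section \<open>Separation by functionals and support functions in coordinates\<close>

context finite_coordinates
begin

text \<open>Nearest point projection for the scalar product \<open>ip\<close> built from the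
  coordinates, as the given norm need not be Euclidean. The functional is \<open>ip\<close> with the
  vector from the nearest point \<open>y\<close> to \<open>x\<close>.\<close>

lemma separating_functional:
  fixes K :: "'v set"
  assumes K: "compact K" "convex K" "K \<noteq> {}" and x: "x \<notin> K"
  obtains u where "support_function K u < blinfun_apply u x"
proof -
  define ip where "ip a b = (\<Sum>i\<in>F. l i a * l i b)" for a b
  have lin: "linear (l i)" if "i \<in> F" for i using bounded_linear_coord[OF that] by (rule bounded_linear.linear)
  have bl: "bounded_linear (ip a)" for a
    unfolding ip_def by (intro bounded_linear_sum bounded_linear_const_mult bounded_linear_coord)
  have add: "ip a (b + c) = ip a b + ip a c" and scale: "ip a (r *\<^sub>R b) = r * ip a b"
    and diff: "ip a (b - c) = ip a b - ip a c" for a b c r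
    using bl[of a] by (simp_all add: linear_add linear_scale linear_diff bounded_linear.linear)
  have sym: "ip a b = ip b a" for a b by (simp add: ip_def mult.commute)
  have pos: "0 < ip a a" if "a \<noteq> 0" for a
  proof -
    have nn: "0 \<le> ip a a" by (simp add: ip_def sum_nonneg)
    moreover have "ip a a \<noteq> 0"
    proof
      assume "ip a a = 0"
      then have "\<forall>i\<in>F. l i a = 0" using finite_F by (simp add: ip_def sum_nonneg_eq_0_iff)
      then have "(\<Sum>i\<in>F. l i a *\<^sub>R d i) = 0" by simp
      then show False using expand[of a] that by simp
    qed
    ultimately show ?thesis by simp
  qed
  have "continuous_on K (\<lambda>y. ip (x - y) (x - y))"
    unfolding ip_def
    by (intro continuous_intros bounded_linear.continuous_on[OF bounded_linear_coord])
  then obtain y where y: "y \<in> K" "\<And>z. z \<in> K \<Longrightarrow> ip (x - y) (x - y) \<le> ip (x - z) (x - z)"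
    using continuous_attains_inf[OF K(1,3)] by blast
  let ?a = "x - y"
  have a: "0 < ip ?a ?a" using y(1) x by (intro pos) auto
  have le: "ip ?a (z - y) \<le> 0" if z: "z \<in> K" for z
  proof (rule ccontr)
    assume "\<not> ?thesis"
    then have c: "0 < ip ?a (z - y)" by simp
    define N where "N = ip (z - y) (z - y)"
    have N: "0 < N" unfolding N_def using c by (intro pos) (auto simp: diff)
    \<comment> \<open>Moving from \<open>y\<close> by the fraction \<open>t\<close> towards
      \<open>z\<close> changes the squared distance by \<open>t * (t * N - 2 * c)\<close> with
      \<open>c = ip ?a (z - y)\<close>. This \<open>t\<close> makes \<open>t * N \<le> c\<close>, so
      the change is at most \<open>- t * c\<close>, against minimality.\<close>
    define t where "t = min 1 (ip ?a (z - y) / N)"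
    have t: "0 < t" "t \<le> 1" "t * N \<le> ip ?a (z - y)"
      using c N by (auto simp: t_def min_def divide_simps)
    have "(1 - t) *\<^sub>R y + t *\<^sub>R z \<in> K" using K(2) y(1) z t by (intro convexD) auto
    from y(2)[OF this] have "ip ?a ?a \<le> ip (?a - t *\<^sub>R (z - y)) (?a - t *\<^sub>R (z - y))"
      by (simp add: algebra_simps)
    also have "\<dots> = ip ?a ?a - 2 * t * ip ?a (z - y) + t * (t * N)"
    proof -
      have left: "ip (?a - t *\<^sub>R (z - y)) b = ip ?a b - t * ip (z - y) b" for b
        using sym[of "?a - t *\<^sub>R (z - y)" b] sym[of b ?a] sym[of b "z - y"]
          diff[of b ?a "t *\<^sub>R (z - y)"] scale[of b t "z - y"] by simp
      have "ip (?a - t *\<^sub>R (z - y)) (?a - t *\<^sub>R (z - y))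
          = ip ?a (?a - t *\<^sub>R (z - y)) - t * ip (z - y) (?a - t *\<^sub>R (z - y))"
        by (rule left)
      also have "\<dots> = (ip ?a ?a - t * ip ?a (z - y)) - t * (ip (z - y) ?a - t * N)"
        unfolding N_def using diff[of _ ?a "t *\<^sub>R (z - y)"] scale[of _ t "z - y"] by simp
      also have "ip (z - y) ?a = ip ?a (z - y)" by (rule sym)
      finally show ?thesis by (simp add: algebra_simps)
    qed
    finally have "2 * t * ip ?a (z - y) \<le> t * (t * N)" by simp
    also have "\<dots> \<le> t * ip ?a (z - y)" using t by (intro mult_left_mono) auto
    finally have "t * ip ?a (z - y) \<le> 0" by simp
    then show False using mult_pos_pos[OF t(1) c] by linarith
  qed
  let ?u = "Blinfun (ip ?a)"
  have u: "blinfun_apply ?u z = ip ?a z" for z using bounded_linear_Blinfun_apply[OF bl] by simp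
  have "support_function K ?u \<le> ip ?a y"
    unfolding support_function_def u using K(3) le by (intro cSUP_least) (auto simp: diff)
  also have "\<dots> < blinfun_apply ?u x" using a by (simp add: u diff)
  finally show thesis by (rule that)
qed

text \<open>A point of \<open>K\<close> outside \<open>L\<close> would be separated from the convex
  set \<open>L\<close> by a functional whose supremum over \<open>K\<close> then exceeds the one
  over \<open>L\<close>.\<close>

lemma support_function_inject:
  fixes K L :: "'v set"
  assumes K: "zonoid K" and L: "zonoid L" and eq: "\<And>u. support_function K u = support_function L u"
  shows "K = L"
proof -
  have sub: "K \<subseteq> L" if K: "zonoid K" and L: "zonoid L" and eq: "\<And>u. support_function K u = support_function L u" for K L :: "'v set"
  proof
    fix x assume x: "x \<in> K"
    show "x \<in> L"
    proof (rule ccontr)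
      assume "x \<notin> L"
      then obtain u where u: "support_function L u < blinfun_apply u x"
        using separating_functional[of L x] L zonoid_convex[OF L] unfolding zonoid_def by blast
      have "compact (blinfun_apply u ` K)"
        using K unfolding zonoid_def by (intro compact_continuous_image continuous_intros) auto
      then have "bdd_above (blinfun_apply u ` K)" by (intro bounded_imp_bdd_above compact_imp_bounded)
      from cSUP_upper[OF x this] have "blinfun_apply u x \<le> support_function K u" by (simp add: support_function_def)
      with u eq show False by simp
    qed
  qed
  show ?thesis using sub[OF K L eq] sub[OF L K eq[symmetric]] by blast
qed

end

text \<open>The pointwise approximations are bounded by \<open>2 * \<bar>f x\<bar>\<close>, hence
  the error by \<open>3 * \<bar>f x\<bar>\<close>, and dominated convergence applies.\<close>

lemma integrable_simple_approximation:
  fixes f :: "'w \<Rightarrow> real"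
  assumes f: "integrable M f" and \<epsilon>: "0 < \<epsilon>"
  obtains s where "simple_function M s" "integrable M s" "(\<integral>x. \<bar>f x - s x\<bar> \<partial>M) < \<epsilon>"
proof -
  obtain S where "(\<forall>i. simple_function M (S i)) \<and> (\<forall>x\<in>space M. (\<lambda>i. S i x) \<longlonglongrightarrow> f x) \<and>
      (\<forall>i. \<forall>x\<in>space M. dist (S i x) 0 \<le> 2 * dist (f x) 0)"
    using borel_measurable_implies_sequence_metric[OF borel_measurable_integrable[OF f], of 0] by blast
  then have S: "\<And>i. simple_function M (S i)" "\<And>x. x \<in> space M \<Longrightarrow> (\<lambda>i. S i x) \<longlonglongrightarrow> f x"
    "\<And>i x. x \<in> space M \<Longrightarrow> dist (S i x) 0 \<le> 2 * dist (f x) 0"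
    by blast+
  have meas: "S i \<in> borel_measurable M" for i using S(1) by (rule borel_measurable_simple_function)
  have int: "integrable M (S i)" for i
    by (rule Bochner_Integration.integrable_bound[of M "\<lambda>x. 2 * \<bar>f x\<bar>"])
      (use f meas S(3) in \<open>auto intro!: AE_I2\<close>)
  have "(\<lambda>i. \<integral>x. \<bar>f x - S i x\<bar> \<partial>M) \<longlonglongrightarrow> (\<integral>x. 0 \<partial>M)"
  proof (rule integral_dominated_convergence[where w = "\<lambda>x. 3 * \<bar>f x\<bar>"])
    show "AE x in M. (\<lambda>i. \<bar>f x - S i x\<bar>) \<longlonglongrightarrow> 0"
    proof (rule AE_I2)
      fix x assume "x \<in> space M"
      from tendsto_rabs[OF tendsto_diff[OF tendsto_const[of "f x"] S(2)[OF this]]]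
      show "(\<lambda>i. \<bar>f x - S i x\<bar>) \<longlonglongrightarrow> 0" by simp
    qed
    show "AE x in M. norm \<bar>f x - S i x\<bar> \<le> 3 * \<bar>f x\<bar>" for i
    proof (rule AE_I2)
      fix x assume "x \<in> space M"
      from S(3)[OF this, of i] show "norm \<bar>f x - S i x\<bar> \<le> 3 * \<bar>f x\<bar>" by simp
    qed
  qed (use f meas in auto)
  then have "\<forall>\<^sub>F i in sequentially. (\<integral>x. \<bar>f x - S i x\<bar> \<partial>M) < \<epsilon>"
    using \<epsilon> by (intro order_tendstoD(2)[of _ 0]) auto
  from eventually_happens'[OF sequentially_bot this]
  obtain i where "(\<integral>x. \<bar>f x - S i x\<bar> \<partial>M) < \<epsilon>" by blast
  with S(1)[of i] int[of i] show thesis by (rule that)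
qed

text \<open>
  The zonoid with support function \<open>u \<mapsto> E max 0 (u w)\<close> is the closure of the set of all
  \<open>E (\<theta> w)\<close> with \<open>0 \<le> \<theta> \<le> 1\<close>: the supremum over \<open>\<theta>\<close> is attained at the indicator of \<open>u w > 0\<close>,
  and replacing \<open>w\<close> by a simple function turns this set into a zonotope.
\<close>

lemma (in finite_coordinates) zonoid_exists:
  fixes w :: "'w \<Rightarrow> 'v"
  assumes M: "finite_measure M" and int: "\<And>i. i \<in> F \<Longrightarrow> integrable M (\<lambda>f. l i (w f))"
  shows "\<exists>K. zonoid K \<and> (\<forall>u. support_function K u = (\<integral>f. max 0 (blinfun_apply u (w f)) \<partial>M))"
proof -
  interpret M: finite_measure M by (rule M)
  define \<Theta> where "\<Theta> = {\<theta> \<in> borel_measurable M. \<forall>f. 0 \<le> \<theta> f \<and> \<theta> f \<le> (1::real)}"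
  \<comment> \<open>The vector-valued expectation of \<open>\<theta> w\<close>, assembled from its
    coordinates.\<close>
  define pt where "pt \<theta> = (\<Sum>i\<in>F. (\<integral>f. \<theta> f * l i (w f) \<partial>M) *\<^sub>R d i)" for \<theta>
  define S where "S = pt ` \<Theta>"
  define K where "K = closure S"
  have \<Theta>_int: "integrable M (\<lambda>f. \<theta> f * y f)" and \<Theta>_bound: "\<bar>\<integral>f. \<theta> f * y f \<partial>M\<bar> \<le> (\<integral>f. \<bar>y f\<bar> \<partial>M)"
    if \<theta>: "\<theta> \<in> \<Theta>" and y: "integrable M y" for \<theta> and y :: "'w \<Rightarrow> real"
  proof -
    have le: "\<bar>\<theta> f * y f\<bar> \<le> \<bar>y f\<bar>" for f
      using \<theta> mult_right_mono[of "\<bar>\<theta> f\<bar>" 1 "\<bar>y f\<bar>"] by (simp add: \<Theta>_def abs_mult)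
    show *: "integrable M (\<lambda>f. \<theta> f * y f)"
      by (rule Bochner_Integration.integrable_bound[OF y]) (use \<theta> y le in \<open>auto simp: \<Theta>_def\<close>)
    have "\<bar>\<integral>f. \<theta> f * y f \<partial>M\<bar> \<le> (\<integral>f. \<bar>\<theta> f * y f\<bar> \<partial>M)" by (rule integral_abs_bound)
    also have "\<dots> \<le> (\<integral>f. \<bar>y f\<bar> \<partial>M)" using * y le by (intro integral_mono) auto
    finally show "\<bar>\<integral>f. \<theta> f * y f \<partial>M\<bar> \<le> (\<integral>f. \<bar>y f\<bar> \<partial>M)" .
  qed
  have u_expand: "blinfun_apply u (w f) = (\<Sum>i\<in>F. l i (w f) * blinfun_apply u (d i))" for u :: "'v \<Rightarrow>\<^sub>L real" and f
    using linear_expand[of "blinfun_apply u" "w f"] bounded_linear.linear[OF blinfun.bounded_linear_right] by auto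
  have u_int: "integrable M (\<lambda>f. blinfun_apply u (w f))" for u :: "'v \<Rightarrow>\<^sub>L real"
    unfolding u_expand using int by (intro Bochner_Integration.integrable_sum) auto
  have u_pt: "blinfun_apply u (pt \<theta>) = (\<integral>f. \<theta> f * blinfun_apply u (w f) \<partial>M)" if \<theta>: "\<theta> \<in> \<Theta>" for u :: "'v \<Rightarrow>\<^sub>L real" and \<theta>
  proof -
    have "(\<integral>f. \<theta> f * blinfun_apply u (w f) \<partial>M) = (\<integral>f. (\<Sum>i\<in>F. (\<theta> f * l i (w f)) * blinfun_apply u (d i)) \<partial>M)"
      unfolding u_expand by (simp add: sum_distrib_left mult.assoc)
    also have "\<dots> = (\<Sum>i\<in>F. (\<integral>f. \<theta> f * l i (w f) \<partial>M) * blinfun_apply u (d i))"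
      using \<Theta>_int[OF \<theta> int] by (subst Bochner_Integration.integral_sum) auto
    finally show ?thesis by (simp add: pt_def blinfun.sum_right blinfun.scaleR_right)
  qed
  have ne: "S \<noteq> {}" unfolding S_def \<Theta>_def by (auto intro!: exI[of _ "\<lambda>_. 0"])
  have "norm (pt \<theta>) \<le> (\<Sum>i\<in>F. (\<integral>f. \<bar>l i (w f)\<bar> \<partial>M) * norm (d i))" if "\<theta> \<in> \<Theta>" for \<theta>
    unfolding pt_def using \<Theta>_bound[OF that int] by (intro sum_norm_le) (simp add: mult_right_mono)
  then have "bounded S" unfolding S_def bounded_iff by blast
  then have K: "compact K" "K \<noteq> {}" and clK: "closed K" and SK: "S \<subseteq> K"
    unfolding K_def using compact_if_closed_bounded[of "closure S"] ne closure_subset[of S] by auto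
  have support: "support_function K u = (\<integral>f. max 0 (blinfun_apply u (w f)) \<partial>M)" (is "_ = ?h") for u
    unfolding support_function_def
  proof (rule cSup_eq_maximum)
    let ?\<theta> = "\<lambda>f. if 0 < blinfun_apply u (w f) \<and> f \<in> space M then 1 else 0 :: real"
    have "?\<theta> \<in> \<Theta>"
    proof -
      have "(\<lambda>f. blinfun_apply u (w f)) \<in> borel_measurable M" using u_int by simp
      then have "(\<lambda>f. if 0 < blinfun_apply u (w f) then 1 else 0 :: real) \<in> borel_measurable M" by measurable
      moreover have "?\<theta> \<in> borel_measurable M \<longleftrightarrow> (\<lambda>f. if 0 < blinfun_apply u (w f) then 1 else 0 :: real) \<in> borel_measurable M"
        by (intro measurable_cong) auto
      ultimately show ?thesis by (simp add: \<Theta>_def)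
    qed
    then have "pt ?\<theta> \<in> K" "blinfun_apply u (pt ?\<theta>) = (\<integral>f. ?\<theta> f * blinfun_apply u (w f) \<partial>M)"
      using SK u_pt by (auto simp: S_def)
    moreover have "(\<integral>f. ?\<theta> f * blinfun_apply u (w f) \<partial>M) = ?h"
      by (intro Bochner_Integration.integral_cong) auto
    ultimately show "?h \<in> blinfun_apply u ` K" by (intro image_eqI[of _ _ "pt ?\<theta>"]) simp_all
    fix x assume "x \<in> blinfun_apply u ` K"
    then obtain y where y: "y \<in> K" "x = blinfun_apply u y" by blast
    have "blinfun_apply u z \<le> ?h" if "z \<in> S" for z
    proof -
      obtain \<theta> where \<theta>: "\<theta> \<in> \<Theta>" "z = pt \<theta>" using \<open>z \<in> S\<close> by (auto simp: S_def)
      have "(\<integral>f. \<theta> f * blinfun_apply u (w f) \<partial>M) \<le> ?h"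
      proof (rule integral_mono)
        show "integrable M (\<lambda>f. \<theta> f * blinfun_apply u (w f))" by (rule \<Theta>_int[OF \<theta>(1) u_int])
        show "integrable M (\<lambda>f. max 0 (blinfun_apply u (w f)))" using u_int by auto
        fix f
        have *: "0 \<le> \<theta> f" "\<theta> f \<le> 1" using \<theta>(1) by (auto simp: \<Theta>_def)
        show "\<theta> f * blinfun_apply u (w f) \<le> max 0 (blinfun_apply u (w f))"
          using * mult_right_mono[OF *(2), of "blinfun_apply u (w f)"]
            mult_nonneg_nonpos[OF *(1), of "blinfun_apply u (w f)"]
          by (cases "0 \<le> blinfun_apply u (w f)") auto
      qed
      then show ?thesis using u_pt[OF \<theta>(1)] \<theta>(2) by simp
    qed
    then have "S \<subseteq> {z. blinfun_apply u z \<le> ?h}" by blast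
    moreover have "closed {z. blinfun_apply u z \<le> ?h}" by (intro closed_Collect_le continuous_intros)
    ultimately have "K \<subseteq> {z. blinfun_apply u z \<le> ?h}" unfolding K_def by (rule closure_minimal)
    then show "x \<le> ?h" using y by blast
  qed
  have approx: "\<exists>Z. zonotope Z \<and> hausdorff_dist Z K \<le> \<epsilon>" if \<epsilon>: "0 < \<epsilon>" for \<epsilon>
  proof -
    \<comment> \<open>Errors of at most \<open>\<delta>\<close> in every coordinate add up to at
      most \<open>\<delta>\<close> times the sum of the norms of the \<open>d i\<close>; the added 1
      avoids a division by zero.\<close>
    define \<delta> where "\<delta> = \<epsilon> / ((\<Sum>i\<in>F. norm (d i)) + 1)"
    have D: "0 < (\<Sum>i\<in>F. norm (d i)) + 1" by (simp add: add_nonneg_pos sum_nonneg)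
    have \<delta>: "0 < \<delta>" "\<delta> * (\<Sum>i\<in>F. norm (d i)) \<le> \<epsilon>"
      using \<epsilon> D by (auto simp: \<delta>_def divide_simps)
    have "\<exists>s. simple_function M s \<and> integrable M s \<and> (\<integral>f. \<bar>l i (w f) - s f\<bar> \<partial>M) < \<delta>" if "i \<in> F" for i
      using integrable_simple_approximation[OF int[OF that] \<delta>(1)] by metis
    then obtain s where s: "\<And>i. i \<in> F \<Longrightarrow> simple_function M (s i)" "\<And>i. i \<in> F \<Longrightarrow> integrable M (s i)"
      "\<And>i. i \<in> F \<Longrightarrow> (\<integral>f. \<bar>l i (w f) - s i f\<bar> \<partial>M) < \<delta>" by metis
    \<comment> \<open>All simple coordinate values at once. With \<open>restrict\<close> the value
      outside \<open>F\<close> is canonical, so the range \<open>T\<close> is finite and its fibres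
      \<open>A \<tau>\<close> partition the space into atoms on which the approximation is
      constant.\<close>
    define \<sigma> where "\<sigma> f = restrict (\<lambda>i. s i f) F" for f
    define T where "T = \<sigma> ` space M"
    define A where "A \<tau> = {f \<in> space M. \<sigma> f = \<tau>}" for \<tau>
    define v where "v \<tau> = (\<Sum>i\<in>F. \<tau> i *\<^sub>R d i)" for \<tau>
    have "T \<subseteq> PiE F (\<lambda>i. s i ` space M)" by (auto simp: T_def \<sigma>_def)
    moreover have "finite (PiE F (\<lambda>i. s i ` space M))"
      using s(1) finite_F by (intro finite_PiE) (auto simp: simple_function_def)
    ultimately have finT: "finite T" by (rule finite_subset)
    have A: "A \<tau> \<in> sets M" if \<tau>: "\<tau> \<in> T" for \<tau>
    proof -
      have "A \<tau> = {f \<in> space M. \<forall>i\<in>F. s i f = \<tau> i}"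
        using \<tau> by (auto simp: A_def \<sigma>_def T_def restrict_def fun_eq_iff)
      moreover have "{f \<in> space M. s i f = \<tau> i} \<in> sets M" if "i \<in> F" for i
        using simple_functionD(2)[OF s(1)[OF that], of "{\<tau> i}"] by (simp add: vimage_def Int_def conj_commute)
      ultimately show ?thesis using finite_F by (simp add: sets.sets_Collect_finite_All)
    qed
    have iA: "integrable M (indicator (A \<tau>) :: 'w \<Rightarrow> real)" if "\<tau> \<in> T" for \<tau>
      using A[OF that] by (simp add: M.emeasure_eq_measure)
    define z where "z \<theta> = (\<Sum>i\<in>F. (\<integral>f. \<theta> f * s i f \<partial>M) *\<^sub>R d i)" for \<theta>
    \<comment> \<open>On the atom \<open>A \<tau>\<close> the approximating vector is
      \<open>v \<tau>\<close>, so \<open>\<theta>\<close> matters only through its integrals over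
      the atoms.\<close>
    have z_eq: "z \<theta> = (\<Sum>\<tau>\<in>T. (\<integral>f. \<theta> f * indicator (A \<tau>) f \<partial>M) *\<^sub>R v \<tau>)" if \<theta>: "\<theta> \<in> \<Theta>" for \<theta>
    proof -
      have "(\<integral>f. \<theta> f * s i f \<partial>M) = (\<Sum>\<tau>\<in>T. (\<integral>f. \<theta> f * indicator (A \<tau>) f \<partial>M) * \<tau> i)" if i: "i \<in> F" for i
      proof -
        have "(\<integral>f. \<theta> f * s i f \<partial>M) = (\<integral>f. (\<Sum>\<tau>\<in>T. (\<theta> f * indicator (A \<tau>) f) * \<tau> i) \<partial>M)"
        proof (intro Bochner_Integration.integral_cong refl)
          fix f assume f: "f \<in> space M"
          have "(\<Sum>\<tau>\<in>T. (\<theta> f * indicator (A \<tau>) f) * \<tau> i) = (\<Sum>\<tau>\<in>T. if \<tau> = \<sigma> f then \<theta> f * s i f else 0)"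
            using f i by (intro sum.cong) (auto simp: A_def \<sigma>_def)
          then show "\<theta> f * s i f = (\<Sum>\<tau>\<in>T. (\<theta> f * indicator (A \<tau>) f) * \<tau> i)"
            using finT f by (simp add: T_def)
        qed
        also have "\<dots> = (\<Sum>\<tau>\<in>T. (\<integral>f. \<theta> f * indicator (A \<tau>) f \<partial>M) * \<tau> i)"
          using \<Theta>_int[OF \<theta> iA] by (subst Bochner_Integration.integral_sum) auto
        finally show ?thesis .
      qed
      then have "z \<theta> = (\<Sum>i\<in>F. \<Sum>\<tau>\<in>T. ((\<integral>f. \<theta> f * indicator (A \<tau>) f \<partial>M) * \<tau> i) *\<^sub>R d i)"
        unfolding z_def by (intro sum.cong) (auto simp: scaleR_sum_left)
      also have "\<dots> = (\<Sum>\<tau>\<in>T. \<Sum>i\<in>F. ((\<integral>f. \<theta> f * indicator (A \<tau>) f \<partial>M) * \<tau> i) *\<^sub>R d i)" by (rule sum.swap)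
      finally show ?thesis by (simp add: v_def scaleR_sum_right)
    qed
    have close: "dist (pt \<theta>) (z \<theta>) \<le> \<epsilon>" if \<theta>: "\<theta> \<in> \<Theta>" for \<theta>
    proof -
      have "pt \<theta> - z \<theta> = (\<Sum>i\<in>F. (\<integral>f. \<theta> f * (l i (w f) - s i f) \<partial>M) *\<^sub>R d i)"
        unfolding pt_def z_def sum_subtractf[symmetric]
      proof (intro sum.cong refl)
        fix i assume i: "i \<in> F"
        have "(\<integral>f. \<theta> f * (l i (w f) - s i f) \<partial>M) = (\<integral>f. \<theta> f * l i (w f) \<partial>M) - (\<integral>f. \<theta> f * s i f \<partial>M)"
          using \<Theta>_int[OF \<theta> int[OF i]] \<Theta>_int[OF \<theta> s(2)[OF i]] by (simp add: right_diff_distrib)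
        then show "(\<integral>f. \<theta> f * l i (w f) \<partial>M) *\<^sub>R d i - (\<integral>f. \<theta> f * s i f \<partial>M) *\<^sub>R d i
            = (\<integral>f. \<theta> f * (l i (w f) - s i f) \<partial>M) *\<^sub>R d i" by (simp add: scaleR_diff_left)
      qed
      also have "norm \<dots> \<le> (\<Sum>i\<in>F. \<delta> * norm (d i))"
      proof (rule sum_norm_le)
        fix i assume i: "i \<in> F"
        have "\<bar>\<integral>f. \<theta> f * (l i (w f) - s i f) \<partial>M\<bar> \<le> \<delta>"
          using \<Theta>_bound[OF \<theta>, of "\<lambda>f. l i (w f) - s i f"] int[OF i] s(2,3)[OF i] by simp
        then show "norm ((\<integral>f. \<theta> f * (l i (w f) - s i f) \<partial>M) *\<^sub>R d i) \<le> \<delta> * norm (d i)"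
          by (simp add: mult_right_mono)
      qed
      finally show ?thesis using \<delta>(2) by (simp add: dist_norm sum_distrib_left)
    qed
    define Z where "Z = {\<Sum>\<tau>\<in>T. t \<tau> *\<^sub>R (measure M (A \<tau>) *\<^sub>R v \<tau>) | t. \<forall>\<tau>\<in>T. 0 \<le> t \<tau> \<and> t \<tau> \<le> 1}"
    have Z: "zonotope Z" unfolding Z_def by (rule zonotopeI_finite[OF finT])
    have zZ: "z \<theta> \<in> Z" if \<theta>: "\<theta> \<in> \<Theta>" for \<theta>
    proof -
      let ?I = "\<lambda>\<tau>. \<integral>f. \<theta> f * indicator (A \<tau>) f \<partial>M"
      \<comment> \<open>The mean of \<open>\<theta>\<close> over the atom. On a null atom the
        numerator vanishes too and the quotient is 0 by convention.\<close>
      let ?t = "\<lambda>\<tau>. ?I \<tau> / measure M (A \<tau>)"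
      have I: "0 \<le> ?I \<tau>" "?I \<tau> \<le> measure M (A \<tau>)" if \<tau>: "\<tau> \<in> T" for \<tau>
      proof -
        show "0 \<le> ?I \<tau>" using \<theta> by (intro Bochner_Integration.integral_nonneg) (auto simp: \<Theta>_def)
        have "(\<integral>f. \<bar>indicator (A \<tau>) f :: real\<bar> \<partial>M) = measure M (A \<tau>)"
          using A[OF \<tau>] sets.sets_into_space[OF A[OF \<tau>]] by (simp add: Int_absorb2)
        then show "?I \<tau> \<le> measure M (A \<tau>)" using \<Theta>_bound[OF \<theta> iA[OF \<tau>]] by linarith
      qed
      have t: "0 \<le> ?t \<tau> \<and> ?t \<tau> \<le> 1" if "\<tau> \<in> T" for \<tau>
        using I[OF that] by (auto simp: divide_le_eq_1 intro: divide_nonneg_nonneg)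
      have "z \<theta> = (\<Sum>\<tau>\<in>T. ?t \<tau> *\<^sub>R (measure M (A \<tau>) *\<^sub>R v \<tau>))"
        unfolding z_eq[OF \<theta>]
      proof (intro sum.cong refl)
        fix \<tau> assume "\<tau> \<in> T"
        then have "?t \<tau> * measure M (A \<tau>) = ?I \<tau>" using I[of \<tau>] by (cases "measure M (A \<tau>) = 0") auto
        then show "?I \<tau> *\<^sub>R v \<tau> = ?t \<tau> *\<^sub>R (measure M (A \<tau>) *\<^sub>R v \<tau>)" by (metis scaleR_scaleR)
      qed
      with t show ?thesis unfolding Z_def by (intro CollectI exI[of _ ?t]) blast
    qed
    have Zz: "\<exists>\<theta>\<in>\<Theta>. y = z \<theta>" if "y \<in> Z" for y
    proof -
      from that obtain t where t: "y = (\<Sum>\<tau>\<in>T. t \<tau> *\<^sub>R (measure M (A \<tau>) *\<^sub>R v \<tau>))" "\<And>\<tau>. \<tau> \<in> T \<Longrightarrow> 0 \<le> t \<tau> \<and> t \<tau> \<le> 1"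
        unfolding Z_def by blast
      \<comment> \<open>Conversely, the step function with value \<open>t \<tau>\<close> on each
        atom is an admissible weight that realizes the given point of \<open>Z\<close>.\<close>
      define \<theta> where "\<theta> f = (\<Sum>\<tau>\<in>T. t \<tau> * indicator (A \<tau>) f)" for f
      have \<theta>_eq: "\<theta> f = (if f \<in> space M then t (\<sigma> f) else 0)" for f
      proof -
        have "\<theta> f = (\<Sum>\<tau>\<in>T. if \<tau> = \<sigma> f then (if f \<in> space M then t (\<sigma> f) else 0) else 0)"
          unfolding \<theta>_def by (intro sum.cong) (auto simp: A_def)
        then show ?thesis using finT by (auto simp: T_def)
      qed
      have "\<theta> \<in> borel_measurable M"
        unfolding \<theta>_def using A by (intro borel_measurable_sum borel_measurable_times) auto
      moreover have "0 \<le> \<theta> f \<and> \<theta> f \<le> 1" for f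
        unfolding \<theta>_eq using t(2)[of "\<sigma> f"] by (auto simp: T_def)
      ultimately have \<theta>: "\<theta> \<in> \<Theta>" by (simp add: \<Theta>_def)
      have "(\<integral>f. \<theta> f * indicator (A \<tau>) f \<partial>M) = t \<tau> * measure M (A \<tau>)" if \<tau>: "\<tau> \<in> T" for \<tau>
      proof -
        have "(\<integral>f. \<theta> f * indicator (A \<tau>) f \<partial>M) = (\<integral>f. t \<tau> * indicator (A \<tau>) f \<partial>M)"
          by (intro Bochner_Integration.integral_cong) (auto simp: \<theta>_eq A_def indicator_def)
        then show ?thesis using A[OF \<tau>] sets.sets_into_space[OF A[OF \<tau>]] by (simp add: Int_absorb2)
      qed
      then have "z \<theta> = y" unfolding z_eq[OF \<theta>] t(1) by (intro sum.cong) auto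
      with \<theta> show ?thesis by blast
    qed
    have "hausdorff_dist Z K \<le> \<epsilon>"
    proof (rule hausdorff_dist_le)
      show "Z \<noteq> {}" by (rule zonotope_compact_convex(3)[OF Z])
      show "infdist y K \<le> \<epsilon>" if y: "y \<in> Z" for y
      proof -
        obtain \<theta> where \<theta>: "\<theta> \<in> \<Theta>" "y = z \<theta>" using Zz[OF y] by blast
        have "infdist y K \<le> dist y (pt \<theta>)" using SK \<theta>(1) by (intro infdist_le) (auto simp: S_def)
        then show ?thesis using close[OF \<theta>(1)] by (simp add: \<theta>(2) dist_commute)
      qed
      \<comment> \<open>Distances to \<open>Z\<close> are estimated on \<open>S\<close> and pass to
        the closure \<open>K\<close> by continuity of \<open>infdist\<close>.\<close>
      have "S \<subseteq> {x. infdist x Z \<le> \<epsilon>}"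
      proof
        fix x assume "x \<in> S"
        then obtain \<theta> where \<theta>: "\<theta> \<in> \<Theta>" "x = pt \<theta>" by (auto simp: S_def)
        have "infdist x Z \<le> dist x (z \<theta>)" by (rule infdist_le[OF zZ[OF \<theta>(1)]])
        then show "x \<in> {x. infdist x Z \<le> \<epsilon>}" using close[OF \<theta>(1)] by (simp add: \<theta>(2))
      qed
      moreover have "closed {x. infdist x Z \<le> \<epsilon>}" by (intro closed_Collect_le continuous_intros)
      ultimately have "K \<subseteq> {x. infdist x Z \<le> \<epsilon>}" unfolding K_def by (rule closure_minimal)
      then show "infdist x Z \<le> \<epsilon>" if "x \<in> K" for x using that by blast
    qed (rule K(2))
    with Z show ?thesis by blast
  qed
  have "\<exists>Z. zonotope Z \<and> hausdorff_dist Z K \<le> inverse (real (Suc n))" for n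
    by (rule approx) simp
  then obtain Z where Z: "\<And>n. zonotope (Z n)" "\<And>n. hausdorff_dist (Z n) K \<le> inverse (real (Suc n))"
    by metis
  have "(\<lambda>n. hausdorff_dist (Z n) K) \<longlonglongrightarrow> 0"
  proof (rule tendsto_sandwich[OF _ _ tendsto_const LIMSEQ_inverse_real_of_nat])
    show "\<forall>\<^sub>F n in sequentially. 0 \<le> hausdorff_dist (Z n) K"
      using zonotope_compact_convex[OF Z(1)] K
      by (intro always_eventually allI hausdorff_dist_nonneg compact_imp_bounded) auto
    show "\<forall>\<^sub>F n in sequentially. hausdorff_dist (Z n) K \<le> inverse (real (Suc n))"
      using Z(2) by (intro always_eventually) auto
  qed
  then have "zonoid K" unfolding zonoid_def using K Z(1) by blast
  with support show ?thesis by blast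
qed

section \<open>z-KROK fields\<close>

context
  fixes A :: "('a::{t2_space, second_countable_topology}, 'e::finite_dim_inner) chart set"
    and g :: "'a \<Rightarrow> 'e \<Rightarrow> 'e \<Rightarrow> real"
  assumes A: "smooth_atlas A" and g: "riemannian_metric A g"
begin

lemma continuous_map_wedge_functional:
  fixes u :: "('e, 'k::finite) altform \<Rightarrow>\<^sub>L real"
  shows "continuous_map (weak_whitney A) euclideanreal (\<lambda>f. blinfun_apply u (wedge (dcomp A f p)))"
proof -
  obtain E where E: "orthonormal_basis (g p) E" using orthonormal_basis_exists[OF inner_form_metric[OF g]] .
  obtain d :: "('k \<Rightarrow> 'e) \<Rightarrow> ('e, 'k) altform" where d: "finite_coordinates (tuples E) (\<lambda>I \<omega>. altform_apply \<omega> I) d"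
    using altform_coordinates[OF E] .
  have u: "blinfun_apply u \<omega> = (\<Sum>I\<in>tuples E. altform_apply \<omega> I * blinfun_apply u (d I))" for \<omega>
    using finite_coordinates.linear_expand[OF d, of "blinfun_apply u" \<omega>]
      bounded_linear.linear[OF blinfun.bounded_linear_right[of u]] by simp
  have "continuous_map (weak_whitney A) euclideanreal
      (\<lambda>f :: 'a \<Rightarrow> real ^ 'k. \<Sum>I\<in>tuples E. altform_apply (wedge (dcomp A f p)) I * blinfun_apply u (d I))"
    using continuous_map_wedge_det[OF A] unfolding continuous_map_real_iff_nhdsin
    by (intro ballI tendsto_intros) blast
  then show ?thesis by (simp flip: u)
qed

lemma wedge_dcomp_le_jac:
  fixes f :: "'a \<Rightarrow> real ^ 'k::finite"
  assumes E: "orthonormal_basis (g p) E" and I: "I \<in> tuples E" and f: "f \<in> C1_maps A"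
  shows "\<bar>altform_apply (wedge (dcomp A f p)) I\<bar> \<le> sqrt (fact CARD('k)) * jac A g p f"
proof -
  have "(\<Prod>i\<in>UNIV. sqrt (g p (I i) (I i))) = 1"
    using I E by (intro prod.neutral) (auto simp: orthonormal_basis_def)
  then show ?thesis
    using hadamard_bound[OF inner_form_metric[OF g, of p], of "dcomp A f p" I] linear_dcomp[OF A f]
    by (simp add: wedge_apply jac_def)
qed

text \<open>Expand \<open>u\<close> in the components on a basis orthonormal for \<open>g p\<close>,
  each of which Hadamard bounds by the Jacobian. Integrability of the Jacobian thus controls every
  linear functional of the wedge.\<close>

lemma wedge_functional_le_jac:
  fixes u :: "('e, 'k::finite) altform \<Rightarrow>\<^sub>L real"
  obtains C where "0 \<le> C"
    "\<And>f. f \<in> C1_maps A \<Longrightarrow> \<bar>blinfun_apply u (wedge (dcomp A f p))\<bar> \<le> C * jac A g p f"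
proof -
  obtain E where E: "orthonormal_basis (g p) E" using orthonormal_basis_exists[OF inner_form_metric[OF g]] .
  obtain d :: "('k \<Rightarrow> 'e) \<Rightarrow> ('e, 'k) altform" where d: "finite_coordinates (tuples E) (\<lambda>I \<omega>. altform_apply \<omega> I) d"
    using altform_coordinates[OF E] .
  have u: "blinfun_apply u \<omega> = (\<Sum>I\<in>tuples E. altform_apply \<omega> I * blinfun_apply u (d I))" for \<omega>
    using finite_coordinates.linear_expand[OF d, of "blinfun_apply u" \<omega>]
      bounded_linear.linear[OF blinfun.bounded_linear_right[of u]] by simp
  let ?C = "\<Sum>I\<in>tuples E. sqrt (fact CARD('k)) * \<bar>blinfun_apply u (d I)\<bar>"
  show thesis
  proof (rule that[of ?C])
    show "0 \<le> ?C" by (intro sum_nonneg) auto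
    fix f :: "'a \<Rightarrow> real ^ 'k" assume f: "f \<in> C1_maps A"
    have "\<bar>altform_apply (wedge (dcomp A f p)) I * blinfun_apply u (d I)\<bar>
        \<le> sqrt (fact CARD('k)) * \<bar>blinfun_apply u (d I)\<bar> * jac A g p f" if "I \<in> tuples E" for I
      using mult_right_mono[OF wedge_dcomp_le_jac[OF E that f], of "\<bar>blinfun_apply u (d I)\<bar>"] by (simp add: abs_mult mult_ac)
    then have "\<bar>blinfun_apply u (wedge (dcomp A f p))\<bar>
        \<le> (\<Sum>I\<in>tuples E. sqrt (fact CARD('k)) * \<bar>blinfun_apply u (d I)\<bar> * jac A g p f)"
      unfolding u[of "wedge (dcomp A f p)"] by (intro order_trans[OF sum_abs] sum_mono)
    then show "\<bar>blinfun_apply u (wedge (dcomp A f p))\<bar> \<le> ?C * jac A g p f" by (simp add: sum_distrib_right)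
  qed
qed

context
  fixes \<nu> :: "('a \<Rightarrow> real ^ 'k::finite) measure"
  assumes \<nu>: "sets \<nu> = sets (C1_borel A)"
begin

lemma sets_C1: "sets \<nu> = sets (top_borel (weak_whitney A))"
  using \<nu> by (simp add: C1_borel_eq[OF A])

lemma space_C1: "space \<nu> = C1_maps A"
  using sets_eq_imp_space_eq[OF sets_C1] unfolding space_top_borel unfolding topspace_weak_whitney[OF A] .

lemma borel_measurable_jac: "jac A g p \<in> borel_measurable \<nu>"
  by (rule borel_measurable_continuous_map[OF continuous_map_jac[OF A g] sets_C1])

lemma AE_jac_nonneg: "AE f in \<nu>. 0 \<le> jac A g p f"
  by (intro AE_I2) (simp add: space_C1 jac_nonneg[OF A g])

lemma integral_jac_measure:
  fixes h :: "('a \<Rightarrow> real ^ 'k) \<Rightarrow> real"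
  assumes "h \<in> borel_measurable \<nu>"
  shows "(\<integral>f. h f \<partial>jac_measure A g p \<nu>) = (\<integral>f. jac A g p f * h f \<partial>\<nu>)"
  unfolding jac_measure_def
  using integral_density[OF assms borel_measurable_jac AE_jac_nonneg] by simp

lemma finite_jac_measure_iff: "finite_measure (jac_measure A g p \<nu>) \<longleftrightarrow> integrable \<nu> (jac A g p)"
proof -
  have nn: "(\<integral>\<^sup>+ f. ennreal (norm (jac A g p f)) \<partial>\<nu>) = (\<integral>\<^sup>+ f. ennreal (jac A g p f) \<partial>\<nu>)"
    by (intro nn_integral_cong) (simp add: space_C1 jac_nonneg[OF A g])
  have m: "(\<lambda>f. ennreal (jac A g p f)) \<in> borel_measurable \<nu>" using borel_measurable_jac by simp
  have "emeasure (jac_measure A g p \<nu>) (space (jac_measure A g p \<nu>)) = (\<integral>\<^sup>+ f. ennreal (jac A g p f) \<partial>\<nu>)"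
    unfolding jac_measure_def using m
    by (simp add: emeasure_density)
  then have "finite_measure (jac_measure A g p \<nu>) \<longleftrightarrow> (\<integral>\<^sup>+ f. ennreal (jac A g p f) \<partial>\<nu>) \<noteq> \<infinity>"
    using finite_measureI[of "jac_measure A g p \<nu>"]
      finite_measure.emeasure_finite[of "jac_measure A g p \<nu>" "space (jac_measure A g p \<nu>)"] by auto
  then show ?thesis
    unfolding integrable_iff_bounded nn using borel_measurable_jac by (simp add: less_top)
qed

end

text \<open>
  The functions \<open>max 0 (u w) / (J + 1 / n)\<close> are bounded and continuous, unlike their limit
  \<open>max 0 (u w) / J\<close>, which is what the weak topology would have to test in order to recover
  \<open>E max 0 (u w)\<close> from the measure with density \<open>J\<close>.
\<close>

lemma zKROK_support_unique:
  fixes X :: "'w \<Rightarrow> 'a \<Rightarrow> real ^ 'k::finite" and u :: "('e, 'k) altform \<Rightarrow>\<^sub>L real"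
  assumes P: "prob_space P" and z: "zKROK_with A g P X \<rho> \<mu>" and z': "zKROK_with A g P X \<rho>' \<mu>'"
  shows "\<rho> p 0 * (\<integral>f. max 0 (blinfun_apply u (wedge (dcomp A f p))) \<partial>\<mu> p 0)
    = \<rho>' p 0 * (\<integral>f. max 0 (blinfun_apply u (wedge (dcomp A f p))) \<partial>\<mu>' p 0)"
proof -
  let ?T = "weak_whitney A :: ('a \<Rightarrow> real ^ 'k) topology"
  let ?J = "jac A g p :: ('a \<Rightarrow> real ^ 'k) \<Rightarrow> real"
  have X: "X \<in> P \<rightarrow>\<^sub>M C1_borel A" using z by (simp add: zKROK_with_def)
  \<comment> \<open>What z-KROK says at the single point \<open>p\<close>, with the joint continuity
    restricted to the slice over \<open>p\<close>; both witnesses can then be treated alike.\<close>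
  define good where "good \<rho> \<mu> \<longleftrightarrow> (\<forall>x. 0 \<le> \<rho> x) \<and> distributed P lborel (\<lambda>\<omega>. X \<omega> p) (\<lambda>x. ennreal (\<rho> x)) \<and>
    isCont \<rho> 0 \<and> regular_cond_prob P (C1_borel A) X (\<lambda>\<omega>. X \<omega> p) \<mu> \<and>
    (\<forall>x. finite_measure (jac_measure A g p (\<mu> x))) \<and>
    (\<forall>h. continuous_map ?T euclideanreal h \<longrightarrow> bounded (h ` topspace ?T) \<longrightarrow>
      isCont (\<lambda>x. \<integral>f. h f \<partial>jac_measure A g p (\<mu> x)) 0)" for \<rho> and \<mu> :: "real ^ 'k \<Rightarrow> _"
  have good: "good (\<rho> p) (\<mu> p)" if z: "zKROK_with A g P X \<rho> \<mu>" for \<rho> \<mu>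
  proof -
    have pair: "isCont (\<lambda>x. H p x) 0" if "isCont (\<lambda>(p, x). H p x) (p, 0)" for H :: "'a \<Rightarrow> real ^ 'k \<Rightarrow> real"
      using isCont_o2[where f = "\<lambda>x. (p, x)" and a = "0 :: real ^ 'k" and g = "\<lambda>(p, x). H p x"] that
      by (simp add: isCont_Pair)
    have "isCont (\<rho> p) 0" using z pair[of \<rho>] by (simp add: zKROK_with_def)
    moreover have "isCont (\<lambda>x. \<integral>f. h f \<partial>jac_measure A g p (\<mu> p x)) 0"
      if "continuous_map ?T euclideanreal h" "bounded (h ` topspace ?T)" for h
    proof (rule pair)
      show "isCont (\<lambda>(p, x). \<integral>f. h f \<partial>jac_measure A g p (\<mu> p x)) (p, 0)"
        using z that unfolding zKROK_with_def weakly_isCont_def by (simp add: case_prod_unfold)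
    qed
    ultimately show ?thesis using z unfolding good_def zKROK_with_def by blast
  qed
  have G: "good (\<rho> p) (\<mu> p)" "good (\<rho>' p) (\<mu>' p)" using good z z' by blast+
  have Y: "(\<lambda>\<omega>. X \<omega> p) \<in> borel_measurable P"
    using G(1) unfolding good_def distributed_def by auto
  have sets: "sets (\<mu> x) = sets (C1_borel A)" if "good \<rho> \<mu>" for \<rho> \<mu> x
    using that unfolding good_def regular_cond_prob_def by blast
  have prob: "prob_space (\<mu> x)" if "good \<rho> \<mu>" for \<rho> \<mu> x
    using that unfolding good_def regular_cond_prob_def by blast
  have "AE x in lborel. ennreal (\<rho> p x) = ennreal (\<rho>' p x)"
  proof (rule sigma_finite_measure.density_unique[OF lborel.sigma_finite_measure_axioms])
    show "density lborel (\<lambda>x. ennreal (\<rho> p x)) = density lborel (\<lambda>x. ennreal (\<rho>' p x))"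
      using G unfolding good_def distributed_def by metis
  qed (use G in \<open>auto simp: good_def distributed_def\<close>)
  then have AE: "AE x in lborel. True \<longrightarrow> \<rho> p x = \<rho>' p x"
    by eventually_elim (use G in \<open>simp add: good_def\<close>)
  have \<rho>_eq: "\<rho> p 0 = \<rho>' p 0"
    by (rule isCont_eq_if_AE_eq[OF _ _ _ AE]) (use G in \<open>simp_all add: good_def\<close>)
  \<comment> \<open>If the density vanishes at 0, both sides are 0. Otherwise it is positive near 0,
    where null sets of the law of \<open>X(p)\<close> are Lebesgue null, and continuity at 0 can be
    exploited.\<close>
  show ?thesis
  proof (cases "\<rho> p 0 = 0")
    case True
    then show ?thesis using \<rho>_eq by simp
  next
    case False
    then have pos: "0 < \<rho> p 0" using G(1) unfolding good_def by (simp add: less_le)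
    obtain C where C: "0 \<le> C"
      "\<And>f. f \<in> C1_maps A \<Longrightarrow> \<bar>blinfun_apply u (wedge (dcomp A f p))\<bar> \<le> C * ?J f"
      by (rule wedge_functional_le_jac[of u p]) blast
    define m where "m f = max 0 (blinfun_apply u (wedge (dcomp A f p)))" for f
    define h where "h n f = m f / (?J f + 1 / real (Suc n))" for n f
    have J: "0 \<le> ?J f" if "f \<in> C1_maps A" for f by (rule jac_nonneg[OF A g that])
    have m: "0 \<le> m f" "m f \<le> C * ?J f" if "f \<in> C1_maps A" for f
      using C(2)[OF that] mult_nonneg_nonneg[OF C(1) J[OF that]] by (auto simp: m_def)
    have m_cont: "continuous_map ?T euclideanreal m"
      using continuous_map_wedge_functional[of u p]
      unfolding continuous_map_real_iff_nhdsin m_def by (intro ballI tendsto_max tendsto_const) blast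
    have h_cont: "continuous_map ?T euclideanreal (h n)" for n
      unfolding continuous_map_real_iff_nhdsin
    proof
      fix f assume f: "f \<in> topspace ?T"
      then have "0 < ?J f + 1 / real (Suc n)"
        using J[of f] topspace_weak_whitney[OF A] by (intro add_nonneg_pos) auto
      then show "(h n \<longlongrightarrow> h n f) (nhdsin ?T f)"
        using m_cont continuous_map_jac[OF A g, of p] f
        unfolding h_def continuous_map_real_iff_nhdsin by (intro tendsto_divide tendsto_add tendsto_const) auto
    qed
    have h_bound: "0 \<le> h n f \<and> h n f \<le> C" if f: "f \<in> C1_maps A" for n f
    proof -
      have d: "0 < ?J f + 1 / real (Suc n)" using J[OF f] by (simp add: add_nonneg_pos)
      have "m f \<le> C * (?J f + 1 / real (Suc n))"
        using m(2)[OF f] C(1) by (intro order_trans[OF m(2)[OF f]] mult_left_mono) auto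
      then show ?thesis using d m(1)[OF f] by (simp add: h_def pos_divide_le_eq)
    qed
    have h_bounded: "bounded (h n ` topspace ?T)" for n
      unfolding topspace_weak_whitney[OF A] bounded_iff using h_bound[of _ n]
      by (intro exI[of _ C]) auto
    have int_h: "(\<integral>f. h n f \<partial>jac_measure A g p (\<mu> x)) = (\<integral>f. ?J f * h n f \<partial>\<mu> x)"
      and ennreal_h: "ennreal (\<integral>f. ?J f * h n f \<partial>\<mu> x) = (\<integral>\<^sup>+ f. ennreal (?J f * h n f) \<partial>\<mu> x)"
      and lim_h: "(\<lambda>n. \<integral>f. ?J f * h n f \<partial>\<mu> x) \<longlonglongrightarrow> (\<integral>f. m f \<partial>\<mu> x)"
      if G: "good \<rho> \<mu>" for \<rho> \<mu> n x
    proof -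
      note s = sets[OF G, of x]
      have hm: "h n \<in> borel_measurable (\<mu> x)" for n by (rule borel_measurable_continuous_map[OF h_cont sets_C1[OF s]])
      have mm: "m \<in> borel_measurable (\<mu> x)" by (rule borel_measurable_continuous_map[OF m_cont sets_C1[OF s]])
      note Jm = borel_measurable_jac[OF s, of p]
      have Ji: "integrable (\<mu> x) ?J"
        using G finite_jac_measure_iff[OF s] unfolding good_def by blast
      show "(\<integral>f. h n f \<partial>jac_measure A g p (\<mu> x)) = (\<integral>f. ?J f * h n f \<partial>\<mu> x)"
        by (rule integral_jac_measure[OF s hm])
      have le: "\<bar>?J f * h n f\<bar> \<le> C * ?J f" if "f \<in> C1_maps A" for f n
        using h_bound[OF that, of n] J[OF that] by (simp add: abs_mult mult.commute mult_right_mono)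
      have i: "integrable (\<mu> x) (\<lambda>f. ?J f * h n f)"
        by (rule Bochner_Integration.integrable_bound[of _ "\<lambda>f. C * ?J f"])
          (use Ji Jm hm le C(1) J in \<open>auto intro!: AE_I2 simp: space_C1[OF s]\<close>)
      show "ennreal (\<integral>f. ?J f * h n f \<partial>\<mu> x) = (\<integral>\<^sup>+ f. ennreal (?J f * h n f) \<partial>\<mu> x)"
        using h_bound J by (intro nn_integral_eq_integral[symmetric] i AE_I2) (auto simp: space_C1[OF s])
      show "(\<lambda>n. \<integral>f. ?J f * h n f \<partial>\<mu> x) \<longlonglongrightarrow> (\<integral>f. m f \<partial>\<mu> x)"
      proof (rule integral_dominated_convergence[where w = "\<lambda>f. C * ?J f"])
        show "AE f in \<mu> x. (\<lambda>n. ?J f * h n f) \<longlonglongrightarrow> m f"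
        proof (rule AE_I2)
          fix f assume "f \<in> space (\<mu> x)"
          then have f: "f \<in> C1_maps A" by (simp add: space_C1[OF s])
          \<comment> \<open>Where the Jacobian is 0, the bound \<open>m f \<le> C * ?J f\<close>
            forces \<open>m f = 0\<close>, so the limit is correct there too.\<close>
          show "(\<lambda>n. ?J f * h n f) \<longlonglongrightarrow> m f"
          proof (cases "?J f = 0")
            case True
            then show ?thesis using m[OF f] by simp
          next
            case False
            have "(\<lambda>n. 1 / real (Suc n)) \<longlonglongrightarrow> 0" by real_asymp
            then have "(\<lambda>n. ?J f * (m f / (?J f + 1 / real (Suc n)))) \<longlonglongrightarrow> ?J f * (m f / (?J f + 0))"
              using False by (intro tendsto_intros) auto
            then show ?thesis using False by (simp add: h_def)
          qed
        qed
      qed (use Ji Jm mm hm le in \<open>auto intro!: AE_I2 simp: space_C1[OF s]\<close>)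
    qed
    have "(\<integral>f. h n f \<partial>jac_measure A g p (\<mu> p 0)) = (\<integral>f. h n f \<partial>jac_measure A g p (\<mu>' p 0))" for n
    proof (rule isCont_eq_if_AE_eq[where x = 0 and P = "\<lambda>x. 0 < \<rho> p x"
          and F = "\<lambda>x. \<integral>f. h n f \<partial>jac_measure A g p (\<mu> p x)"
          and F' = "\<lambda>x. \<integral>f. h n f \<partial>jac_measure A g p (\<mu>' p x)"])
      have "isCont (\<lambda>x. \<integral>f. h n f \<partial>jac_measure A g p (\<mu> x)) 0" if "good \<rho> \<mu>" for \<rho> \<mu>
        using that unfolding good_def by (elim conjE) (drule spec[of _ "h n"], simp add: h_cont h_bounded)
      from this[OF G(1)] this[OF G(2)]
      show "isCont (\<lambda>x. \<integral>f. h n f \<partial>jac_measure A g p (\<mu> p x)) 0"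
        "isCont (\<lambda>x. \<integral>f. h n f \<partial>jac_measure A g p (\<mu>' p x)) 0" .
      have "(\<rho> p \<longlongrightarrow> \<rho> p 0) (nhds 0)"
        using G(1) unfolding good_def isCont_def by (intro tendsto_at_iff_tendsto_nhds[THEN iffD1]) (elim conjE)
      then show "\<forall>\<^sub>F x in nhds 0. 0 < \<rho> p x" using pos by (rule order_tendstoD)
      \<comment> \<open>Uniqueness of conditional laws is applied to this product because its
        conditional integral is the integral of \<open>h n\<close> against the measure with density
        the Jacobian.\<close>
      have "(\<lambda>f. ennreal (?J f * h n f)) \<in> borel_measurable (C1_borel A)"
        by (intro measurable_compose[OF _ measurable_ennreal] borel_measurable_times borel_measurable_jac
            borel_measurable_continuous_map[OF h_cont sets_C1] refl)
      then have ae: "AE x in distr P borel (\<lambda>\<omega>. X \<omega> p).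
          (\<integral>\<^sup>+ f. ennreal (?J f * h n f) \<partial>\<mu> p x) = (\<integral>\<^sup>+ f. ennreal (?J f * h n f) \<partial>\<mu>' p x)"
        using G unfolding good_def by (intro regular_cond_prob_unique[OF P _ _ X Y]) auto
      have law: "distr P borel (\<lambda>\<omega>. X \<omega> p) = density lborel (\<lambda>x. ennreal (\<rho> p x))"
        using G(1) unfolding good_def distributed_def by (simp cong: distr_cong)
      have "(\<lambda>x. ennreal (\<rho> p x)) \<in> borel_measurable lborel"
        using G(1) unfolding good_def distributed_def by blast
      from ae[unfolded law AE_density[OF this]] have "AE x in lborel. 0 < ennreal (\<rho> p x) \<longrightarrow>
          (\<integral>\<^sup>+ f. ennreal (?J f * h n f) \<partial>\<mu> p x) = (\<integral>\<^sup>+ f. ennreal (?J f * h n f) \<partial>\<mu>' p x)"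
        .
      then show "AE x in lborel. 0 < \<rho> p x \<longrightarrow>
          (\<integral>f. h n f \<partial>jac_measure A g p (\<mu> p x)) = (\<integral>f. h n f \<partial>jac_measure A g p (\<mu>' p x))"
      proof eventually_elim
        case (elim x)
        have nn: "0 \<le> (\<integral>f. ?J f * h n f \<partial>\<mu> x)" if "good \<rho> \<mu>" for \<rho> \<mu>
          using h_bound J by (intro Bochner_Integration.integral_nonneg_AE AE_I2) (auto simp: space_C1[OF sets[OF that]])
        show ?case
        proof
          assume "0 < \<rho> p x"
          with elim have "ennreal (\<integral>f. ?J f * h n f \<partial>\<mu> p x) = ennreal (\<integral>f. ?J f * h n f \<partial>\<mu>' p x)"
            unfolding ennreal_h[OF G(1)] ennreal_h[OF G(2)] by simp
          then show "(\<integral>f. h n f \<partial>jac_measure A g p (\<mu> p x)) = (\<integral>f. h n f \<partial>jac_measure A g p (\<mu>' p x))"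
            unfolding int_h[OF G(1)] int_h[OF G(2)] using nn[OF G(1)] nn[OF G(2)] by simp
        qed
      qed
    qed
    then have "(\<lambda>n. \<integral>f. ?J f * h n f \<partial>\<mu> p 0) = (\<lambda>n. \<integral>f. ?J f * h n f \<partial>\<mu>' p 0)"
      by (simp add: int_h[OF G(1)] int_h[OF G(2)])
    then have "(\<integral>f. m f \<partial>\<mu> p 0) = (\<integral>f. m f \<partial>\<mu>' p 0)"
      using LIMSEQ_unique[OF lim_h[OF G(1), of 0]] lim_h[OF G(2), of 0] by simp
    then show ?thesis using \<rho>_eq by (simp add: m_def)
  qed
qed

end

section \<open>The composed field: its conditional laws and its zonoid section\<close>

definition compose_kernel ::
  "('s::topological_space, 'f::real_normed_vector) chart set \<Rightarrow> ('s \<Rightarrow> 'a) \<Rightarrow>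
   ('a \<Rightarrow> 'y \<Rightarrow> ('a \<Rightarrow> 'v::real_normed_vector) measure) \<Rightarrow> 's \<Rightarrow> 'y \<Rightarrow> ('s \<Rightarrow> 'v) measure" where
  "compose_kernel A' \<phi> \<mu> q x = distr (\<mu> (\<phi> q) x) (C1_borel A') (\<lambda>f. f \<circ> \<phi>)"

context
  fixes A :: "('a::{t2_space, second_countable_topology}, 'e::finite_dim_inner) chart set"
    and g :: "'a \<Rightarrow> 'e \<Rightarrow> 'e \<Rightarrow> real" and P :: "'w measure"
    and X :: "'w \<Rightarrow> 'a \<Rightarrow> real ^ 'k::finite" and \<rho> \<mu>
  assumes A: "smooth_atlas A" and g: "riemannian_metric A g" and P: "prob_space P"
    and z: "zKROK_with A g P X \<rho> \<mu>"
begin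

lemma sets_cond: "sets (\<mu> p x) = sets (C1_borel A)"
  and prob_space_cond: "prob_space (\<mu> p x)"
  and integrable_jac_cond: "integrable (\<mu> p x) (jac A g p)"
  and density_nonneg: "0 \<le> \<rho> p x"
proof -
  show sets: "sets (\<mu> p x) = sets (C1_borel A)" and "prob_space (\<mu> p x)" and "0 \<le> \<rho> p x"
    using z unfolding zKROK_with_def regular_cond_prob_def by blast+
  have "finite_measure (jac_measure A g p (\<mu> p x))" using z unfolding zKROK_with_def by blast
  then show "integrable (\<mu> p x) (jac A g p)" using finite_jac_measure_iff[OF A g sets] by blast
qed

lemma zonoid_section_unique:
  fixes K L :: "('e, 'k) altform set"
  assumes "zonoid K" "zonoid L" "\<And>u. support_function K u = support_function L u"
  shows "K = L"
proof -
  obtain E :: "'e set" where E: "orthonormal_basis (inner) E" using orthonormal_basis_exists[OF inner_form_inner] .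
  obtain d :: "('k \<Rightarrow> 'e) \<Rightarrow> ('e, 'k) altform" where d: "finite_coordinates (tuples E) (\<lambda>I \<omega>. altform_apply \<omega> I) d"
    using altform_coordinates[OF E] .
  show ?thesis by (rule finite_coordinates.support_function_inject[OF d assms])
qed

text \<open>\<open>zKROK_support_unique\<close> carries the formula from the given witnesses to all
  others, and a zonoid is determined by its support function; so the \<open>THE\<close> has exactly
  one solution.\<close>

lemma zonoid_section_eqI:
  assumes K: "zonoid K" and sK: "\<And>u. support_function K u =
    \<rho> p 0 * (\<integral>f. max 0 (blinfun_apply u (wedge (dcomp A f p))) \<partial>\<mu> p 0)"
  shows "zonoid_section A g P X p = K"
  unfolding zonoid_section_def
proof (rule the_equality)
  show "zonoid K \<and> (\<forall>\<rho> \<mu>. zKROK_with A g P X \<rho> \<mu> \<longrightarrow> (\<forall>u. support_function K u =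
      \<rho> p 0 * (\<integral>f. max 0 (blinfun_apply u (wedge (dcomp A f p))) \<partial>\<mu> p 0)))"
    using K sK zKROK_support_unique[OF A g P z] by simp
  fix L assume L: "zonoid L \<and> (\<forall>\<rho> \<mu>. zKROK_with A g P X \<rho> \<mu> \<longrightarrow> (\<forall>u. support_function L u =
      \<rho> p 0 * (\<integral>f. max 0 (blinfun_apply u (wedge (dcomp A f p))) \<partial>\<mu> p 0)))"
  show "L = K"
    by (rule zonoid_section_unique) (use L z K sK in auto)
qed

lemma zonoid_section_support:
  shows "zonoid (zonoid_section A g P X p)" (is ?zonoid)
    and "support_function (zonoid_section A g P X p) u =
      \<rho> p 0 * (\<integral>f. max 0 (blinfun_apply u (wedge (dcomp A f p))) \<partial>\<mu> p 0)"
proof -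
  obtain E where E: "orthonormal_basis (g p) E" using orthonormal_basis_exists[OF inner_form_metric[OF g]] .
  obtain d :: "('k \<Rightarrow> 'e) \<Rightarrow> ('e, 'k) altform" where d: "finite_coordinates (tuples E) (\<lambda>I \<omega>. altform_apply \<omega> I) d"
    using altform_coordinates[OF E] .
  note s = sets_cond[of p 0]
  \<comment> \<open>The density is absorbed into the vectors, so that the existence lemma applies to
    a probability measure; being nonnegative it comes out of the maximum again.\<close>
  let ?w = "\<lambda>f. \<rho> p 0 *\<^sub>R wedge (dcomp A f p) :: ('e, 'k) altform"
  have int: "integrable (\<mu> p 0) (\<lambda>f. altform_apply (?w f) I)" if I: "I \<in> tuples E" for I
  proof -
    have "integrable (\<mu> p 0) (\<lambda>f. altform_apply (wedge (dcomp A f p)) I)"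
    proof (rule Bochner_Integration.integrable_bound)
      show "integrable (\<mu> p 0) (\<lambda>f. sqrt (fact CARD('k)) * jac A g p f)"
        by (intro integrable_mult_right integrable_jac_cond)
      show "(\<lambda>f. altform_apply (wedge (dcomp A f p)) I) \<in> borel_measurable (\<mu> p 0)"
        by (rule borel_measurable_continuous_map[OF continuous_map_wedge_det[OF A] sets_C1[OF A g s]])
      show "AE f in \<mu> p 0. norm (altform_apply (wedge (dcomp A f p)) I) \<le> norm (sqrt (fact CARD('k)) * jac A g p f)"
        using wedge_dcomp_le_jac[OF A g E I]
        by (intro AE_I2) (simp add: space_C1[OF A g s] abs_mult jac_nonneg[OF A g])
    qed
    then show ?thesis by (simp add: scaleR_altform.rep_eq)
  qed
  have "finite_measure (\<mu> p 0)" using prob_space_cond by (simp add: prob_space.finite_measure)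
  from finite_coordinates.zonoid_exists[OF d this int]
  obtain K where K: "zonoid K" "\<And>u. support_function K u = (\<integral>f. max 0 (blinfun_apply u (?w f)) \<partial>\<mu> p 0)"
    by blast
  have "max 0 (blinfun_apply u (?w f)) = \<rho> p 0 * max 0 (blinfun_apply u (wedge (dcomp A f p)))" for u :: "('e, 'k) altform \<Rightarrow>\<^sub>L real" and f
    using density_nonneg[of p 0] by (simp add: blinfun.scaleR_right max_mult_distrib_left)
  then have sK: "support_function K u = \<rho> p 0 * (\<integral>f. max 0 (blinfun_apply u (wedge (dcomp A f p))) \<partial>\<mu> p 0)" for u
    using K(2) by simp
  show ?zonoid and "support_function (zonoid_section A g P X p) u =
      \<rho> p 0 * (\<integral>f. max 0 (blinfun_apply u (wedge (dcomp A f p))) \<partial>\<mu> p 0)"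
    unfolding zonoid_section_eqI[OF K(1) sK] by (rule K(1)) (rule sK)
qed

context
  fixes A' :: "('s::{t2_space, second_countable_topology}, 'f::finite_dim_inner) chart set"
    and g' :: "'s \<Rightarrow> 'f \<Rightarrow> 'f \<Rightarrow> real" and \<phi> :: "'s \<Rightarrow> 'a"
  assumes A': "smooth_atlas A'" and g': "riemannian_metric A' g'" and \<phi>: "smooth_map A' A \<phi>"
begin

lemma isCont_smooth_map_pair: "isCont (\<lambda>z :: 's \<times> (real ^ 'k). (\<phi> (fst z), snd z)) (q, x)"
proof -
  have id: "((\<lambda>z. z) \<longlongrightarrow> (q, x)) (at (q, x))" by (rule tendsto_ident_at)
  have "((\<lambda>z :: 's \<times> (real ^ 'k). \<phi> (fst z)) \<longlongrightarrow> \<phi> q) (at (q, x))"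
    by (rule filterlim_compose[OF tendsto_smooth_map[OF A A' \<phi>]]) (use tendsto_fst[OF id] in simp)
  from tendsto_Pair[OF this tendsto_snd[OF id]] show ?thesis by (simp add: isCont_def)
qed

lemma measurable_compose_C1: "(\<lambda>f :: 'a \<Rightarrow> real ^ 'k. f \<circ> \<phi>) \<in> C1_borel A \<rightarrow>\<^sub>M C1_borel A'"
  unfolding C1_borel_eq[OF A] C1_borel_eq[OF A']
  by (rule measurable_continuous_map[OF continuous_map_weak_whitney_compose[OF A A' \<phi>]])

lemma measurable_compose_cond: "(\<lambda>f. f \<circ> \<phi>) \<in> \<mu> p x \<rightarrow>\<^sub>M C1_borel A'"
  using measurable_compose_C1 by (simp cong: measurable_cong_sets add: sets_cond)

lemma integral_cond_compose:
  fixes h :: "('s \<Rightarrow> real ^ 'k) \<Rightarrow> real"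
  assumes "continuous_map (weak_whitney A') euclideanreal h"
  shows "(\<integral>f. h f \<partial>compose_kernel A' \<phi> \<mu> q x) = (\<integral>f. h (f \<circ> \<phi>) \<partial>\<mu> (\<phi> q) x)"
  unfolding compose_kernel_def
  by (rule integral_distr[OF measurable_compose_cond])
    (rule borel_measurable_continuous_map[OF assms], simp add: C1_borel_eq[OF A'])

lemma borel_measurable_cond:
  "continuous_map (weak_whitney A) euclideanreal h \<Longrightarrow> h \<in> borel_measurable (\<mu> p x)"
  by (rule borel_measurable_continuous_map[OF _ sets_C1[OF A g sets_cond]])

lemma continuous_map_compose_real:
  fixes h :: "('s \<Rightarrow> real ^ 'k) \<Rightarrow> real"
  assumes "continuous_map (weak_whitney A') euclideanreal h"
  shows "continuous_map (weak_whitney A) euclideanreal (\<lambda>f. h (f \<circ> \<phi>))"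
  using continuous_map_compose[OF continuous_map_weak_whitney_compose[OF A A' \<phi>] assms] by (simp add: o_def)

lemma finite_jac_measure_compose: "finite_measure (jac_measure A' g' q (compose_kernel A' \<phi> \<mu> q x))"
proof -
  have s: "sets (compose_kernel A' \<phi> \<mu> q x) = sets (C1_borel A')" by (simp add: compose_kernel_def)
  obtain C where C: "0 \<le> C" "\<forall>\<^sub>F q in nhds q. \<forall>f :: 'a \<Rightarrow> real ^ 'k. f \<in> C1_maps A \<longrightarrow> jac A' g' q (f \<circ> \<phi>) \<le> C * jac A g (\<phi> q) f"
    by (rule eventually_jac_compose_le[OF A A' \<phi> g g', of q]) blast
  from eventually_nhds_x_imp_x[OF C(2)] have le: "\<And>f :: 'a \<Rightarrow> real ^ 'k. f \<in> C1_maps A \<Longrightarrow> jac A' g' q (f \<circ> \<phi>) \<le> C * jac A g (\<phi> q) f"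
    by blast
  have "integrable (\<mu> (\<phi> q) x) (\<lambda>f. jac A' g' q (f \<circ> \<phi>))"
  proof (rule Bochner_Integration.integrable_bound)
    show "integrable (\<mu> (\<phi> q) x) (\<lambda>f. C * jac A g (\<phi> q) f)" by (intro integrable_mult_right integrable_jac_cond)
    show "(\<lambda>f. jac A' g' q (f \<circ> \<phi>)) \<in> borel_measurable (\<mu> (\<phi> q) x)"
      by (intro borel_measurable_cond continuous_map_compose_real continuous_map_jac A' g')
    show "AE f in \<mu> (\<phi> q) x. norm (jac A' g' q (f \<circ> \<phi>)) \<le> norm (C * jac A g (\<phi> q) f)"
      using le C(1) by (intro AE_I2) (simp add: space_C1[OF A g sets_cond] abs_mult jac_nonneg[OF A g]
          jac_nonneg[OF A' g' compose_in_C1_maps[OF A' A \<phi>]])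
  qed
  then have "integrable (compose_kernel A' \<phi> \<mu> q x) (jac A' g' q)"
    unfolding compose_kernel_def
    by (subst integrable_distr_eq[OF measurable_compose_cond])
      (auto intro: borel_measurable_continuous_map[OF continuous_map_jac[OF A' g']] simp: C1_borel_eq[OF A'])
  then show ?thesis unfolding finite_jac_measure_iff[OF A' g' s] .
qed

text \<open>The value of \<open>X \<circ> \<phi>\<close> at \<open>q\<close> is that of
  \<open>X\<close> at \<open>\<phi> q\<close>, so the conditioning variable and its law stay the
  same and only the event is pulled back.\<close>

lemma regular_cond_prob_compose:
  "regular_cond_prob P (C1_borel A') (\<lambda>\<omega>. X \<omega> \<circ> \<phi>) (\<lambda>\<omega>. (X \<omega> \<circ> \<phi>) q) (compose_kernel A' \<phi> \<mu> q)"
  unfolding regular_cond_prob_def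
proof (intro conjI allI ballI)
  have rcp: "regular_cond_prob P (C1_borel A) X (\<lambda>\<omega>. X \<omega> (\<phi> q)) (\<mu> (\<phi> q))"
    and X: "X \<in> P \<rightarrow>\<^sub>M C1_borel A"
    using z unfolding zKROK_with_def by blast+
  show "prob_space (compose_kernel A' \<phi> \<mu> q x)" for x
    unfolding compose_kernel_def by (rule prob_space.prob_space_distr[OF prob_space_cond measurable_compose_cond])
  show "sets (compose_kernel A' \<phi> \<mu> q x) = sets (C1_borel A')" for x by (simp add: compose_kernel_def)
  fix B :: "('s \<Rightarrow> real ^ 'k) set" assume B: "B \<in> sets (C1_borel A')"
  let ?B = "(\<lambda>f. f \<circ> \<phi>) -` B \<inter> space (C1_borel A)"
  have B': "?B \<in> sets (C1_borel A)" by (rule measurable_sets[OF measurable_compose_C1 B])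
  have eq: "emeasure (compose_kernel A' \<phi> \<mu> q x) B = emeasure (\<mu> (\<phi> q) x) ?B" for x
    unfolding compose_kernel_def emeasure_distr[OF measurable_compose_cond B]
    using sets_eq_imp_space_eq[OF sets_cond] by simp
  show "(\<lambda>x. emeasure (compose_kernel A' \<phi> \<mu> q x) B) \<in> borel_measurable borel"
    unfolding eq using rcp B' unfolding regular_cond_prob_def by blast
  fix V :: "(real ^ 'k) set" assume V: "V \<in> sets borel"
  have set_eq: "{\<omega> \<in> space P. X \<omega> \<circ> \<phi> \<in> B \<and> (X \<omega> \<circ> \<phi>) q \<in> V} = {\<omega> \<in> space P. X \<omega> \<in> ?B \<and> X \<omega> (\<phi> q) \<in> V}"
    using measurable_space[OF X] by auto
  have "emeasure P {\<omega> \<in> space P. X \<omega> \<in> ?B \<and> X \<omega> (\<phi> q) \<in> V} =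
      (\<integral>\<^sup>+ y\<in>V. emeasure (\<mu> (\<phi> q) y) ?B \<partial>distr P borel (\<lambda>\<omega>. X \<omega> (\<phi> q)))"
    using rcp B' V unfolding regular_cond_prob_def by blast
  then show "emeasure P {\<omega> \<in> space P. X \<omega> \<circ> \<phi> \<in> B \<and> (X \<omega> \<circ> \<phi>) q \<in> V} =
      (\<integral>\<^sup>+ y\<in>V. emeasure (compose_kernel A' \<phi> \<mu> q y) B \<partial>distr P borel (\<lambda>\<omega>. (X \<omega> \<circ> \<phi>) q))"
    unfolding set_eq eq by (simp only: o_apply)
qed

lemma weakly_isCont_compose:
  "weakly_isCont (weak_whitney A') (\<lambda>(q, x). jac_measure A' g' q (compose_kernel A' \<phi> \<mu> q x)) (q0, 0)"
  unfolding weakly_isCont_def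
proof (intro allI impI)
  fix h :: "('s \<Rightarrow> real ^ 'k) \<Rightarrow> real"
  assume "continuous_map (weak_whitney A') euclideanreal h \<and> bounded (h ` topspace (weak_whitney A'))"
  then have h: "continuous_map (weak_whitney A') euclideanreal h" and "bounded (h ` topspace (weak_whitney A'))" by auto
  then obtain H0 where H0: "\<And>f. f \<in> C1_maps A' \<Longrightarrow> \<bar>h f\<bar> \<le> H0"
    unfolding topspace_weak_whitney[OF A'] bounded_iff by auto
  define H where "H = max 0 H0"
  have H: "0 \<le> H" "\<And>f. f \<in> C1_maps A \<Longrightarrow> \<bar>h (f \<circ> \<phi>)\<bar> \<le> H"
    using H0[OF compose_in_C1_maps[OF A' A \<phi>]] by (auto simp: H_def le_max_iff_disj)
  let ?T = "weak_whitney A :: ('a \<Rightarrow> real ^ 'k) topology"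
  let ?\<mu> = "\<lambda>z. \<mu> (\<phi> (fst z)) (snd z)"
  let ?\<nu> = "\<lambda>z. jac_measure A g (\<phi> (fst z)) (?\<mu> z)"
  let ?a = "\<lambda>q f. jac A' g' q (f \<circ> \<phi>)" and ?j = "\<lambda>q f. jac A g (\<phi> q) f"
  \<comment> \<open>The integral whose continuity is claimed, moved back to the conditional laws of
    \<open>X\<close>. In the quotient \<open>R \<delta>\<close> the test function \<open>h\<close>
    is kept as a factor.\<close>
  define I where "I z = (\<integral>f. ?a (fst z) f * h (f \<circ> \<phi>) \<partial>?\<mu> z)" for z
  define R where "R \<delta> q f = h (f \<circ> \<phi>) * ?a q f / (?j q f + \<delta>)" for \<delta> q f
  have space: "space (?\<mu> z) = C1_maps A" for z by (rule space_C1[OF A g sets_cond])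
  have a0: "0 \<le> ?a q f" and j0: "0 \<le> ?j q f" if "f \<in> C1_maps A" for q and f :: "'a \<Rightarrow> real ^ 'k"
    using jac_nonneg[OF A' g' compose_in_C1_maps[OF A' A \<phi> that]] jac_nonneg[OF A g that] by auto
  obtain C where C: "0 \<le> C" "\<forall>\<^sub>F q in nhds q0. \<forall>f :: 'a \<Rightarrow> real ^ 'k. f \<in> C1_maps A \<longrightarrow> ?a q f \<le> C * ?j q f"
    by (rule eventually_jac_compose_le[OF A A' \<phi> g g', of q0]) blast
  have R_tendsto: "((\<lambda>z. R \<delta> (fst z) (snd z)) \<longlongrightarrow> R \<delta> q f) (nhds q \<times>\<^sub>F nhdsin ?T f)"
    if \<delta>: "0 < \<delta>" and f: "f \<in> topspace ?T" for \<delta> q f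
  proof -
    let ?G = "nhds q \<times>\<^sub>F nhdsin ?T f"
    have f1: "f \<in> C1_maps A" using f topspace_weak_whitney[OF A] by blast
    have "((\<lambda>z. h (snd z \<circ> \<phi>)) \<longlongrightarrow> h (f \<circ> \<phi>)) ?G"
      using continuous_map_compose_real[OF h] f unfolding continuous_map_real_iff_nhdsin
      by (intro filterlim_compose[OF _ filterlim_snd_prod]) blast
    moreover have "((\<lambda>z. ?j (fst z) (snd z)) \<longlongrightarrow> ?j q f) ?G"
      using filterlim_compose[OF tendsto_jac[OF A g f1] filterlim_smooth_map_prod[OF A A' \<phi>]] by simp
    moreover have "?j q f + \<delta> \<noteq> 0" using j0[OF f1, of q] \<delta> by linarith
    ultimately show ?thesis
      unfolding R_def by (intro tendsto_divide tendsto_mult tendsto_add tendsto_const tendsto_jac_compose[OF A A' \<phi> g' f1])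
  qed
  have R_bound: "\<bar>R \<delta> q f\<bar> \<le> H * C" if \<delta>: "0 < \<delta>" and f: "f \<in> C1_maps A" and le: "?a q f \<le> C * ?j q f" for \<delta> q f
  proof -
    have d: "0 < ?j q f + \<delta>" using j0[OF f, of q] \<delta> by linarith
    have "?a q f \<le> C * (?j q f + \<delta>)" using le C(1) \<delta> by (intro order_trans[OF le] mult_left_mono) auto
    then have "\<bar>?a q f / (?j q f + \<delta>)\<bar> \<le> C" using d a0[OF f, of q] by (simp add: pos_divide_le_eq)
    then have "\<bar>h (f \<circ> \<phi>)\<bar> * \<bar>?a q f / (?j q f + \<delta>)\<bar> \<le> H * C" using H(1) H(2)[OF f] by (intro mult_mono) auto
    then show ?thesis by (simp add: R_def abs_mult)
  qed
  have R_cont: "continuous_map ?T euclideanreal (R \<delta> q)" if "0 < \<delta>" for \<delta> q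
    unfolding continuous_map_real_iff_nhdsin using tendsto_apply_at[OF R_tendsto[OF that]] by blast
  have lim: "((\<lambda>z. \<integral>f. R \<delta> (fst z) f \<partial>?\<nu> z) \<longlongrightarrow> (\<integral>f. R \<delta> q0 f \<partial>?\<nu> (q0, 0))) (at (q0, 0))" if \<delta>: "0 < \<delta>" for \<delta>
  proof -
    obtain U :: "nat \<Rightarrow> 's set" where U: "\<And>n. compact (U n)" "\<And>n. \<forall>\<^sub>F q in nhds q0. q \<in> U n"
      "\<And>V. open V \<Longrightarrow> q0 \<in> V \<Longrightarrow> \<forall>\<^sub>F n in sequentially. U n \<subseteq> V"
      using compact_neighbourhood_basis[OF A'] by metis
    show ?thesis
    proof (rule tendsto_integral_varying_integrand[where T = ?T and C = "H * C" and U = U])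
      show "sets (?\<nu> z) = sets (top_borel ?T)" for z
        unfolding jac_measure_def using sets_C1[OF A g sets_cond] by simp
      then show "sets (?\<nu> (q0, 0)) = sets (top_borel ?T)" .
      show fin: "finite_measure (?\<nu> z)" for z using z unfolding zKROK_with_def by blast
      then show "finite_measure (?\<nu> (q0, 0))" .
      show "((\<lambda>z. \<integral>f. h f \<partial>?\<nu> z) \<longlongrightarrow> (\<integral>f. h f \<partial>?\<nu> (q0, 0))) (at (q0, 0))"
        if h: "continuous_map ?T euclideanreal h" "bounded (h ` topspace ?T)" for h
      proof -
        \<comment> \<open>The assumed weak continuity at \<open>(\<phi> q0, 0)\<close> is composed
          with \<open>(q, x) \<mapsto> (\<phi> q, x)\<close>, which is continuous and keeps the
          second argument.\<close>
        have "weakly_isCont ?T (\<lambda>(p, x). jac_measure A g p (\<mu> p x)) (\<phi> q0, 0)"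
          using z unfolding zKROK_with_def by blast
        then have "isCont (\<lambda>z. \<integral>f. h f \<partial>(case z of (p, x) \<Rightarrow> jac_measure A g p (\<mu> p x))) (\<phi> q0, 0)"
          using h unfolding weakly_isCont_def by blast
        then have "isCont (\<lambda>z. \<integral>f. h f \<partial>?\<nu> z) (q0, 0)"
          using isCont_o2[OF isCont_smooth_map_pair[of q0 0],
              of "\<lambda>z. \<integral>f. h f \<partial>(case z of (p, x) \<Rightarrow> jac_measure A g p (\<mu> p x))"] by simp
        then show ?thesis unfolding isCont_def .
      qed
      show "(fst \<longlongrightarrow> q0) (at (q0, 0))" using tendsto_fst[OF tendsto_ident_at, of "(q0, 0)"] by simp
      show "\<forall>\<^sub>F q in nhds q0. \<forall>f\<in>topspace ?T. \<bar>R \<delta> q f\<bar> \<le> H * C"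
        using C(2)
      proof eventually_elim
        case (elim q)
        then show ?case using R_bound[OF \<delta>] topspace_weak_whitney[OF A] by blast
      qed
    qed (use R_tendsto[OF \<delta>] U in blast)+
  qed
  have close: "\<bar>I z - (\<integral>f. R \<delta> (fst z) f \<partial>?\<nu> z)\<bar> \<le> H * C * \<delta>"
    if \<delta>: "0 < \<delta>" and le: "\<And>f :: 'a \<Rightarrow> real ^ 'k. f \<in> C1_maps A \<Longrightarrow> ?a (fst z) f \<le> C * ?j (fst z) f" for \<delta> z
  proof -
    let ?q = "fst z"
    have R_int: "(\<integral>f. R \<delta> ?q f \<partial>?\<nu> z) = (\<integral>f. ?j ?q f * R \<delta> ?q f \<partial>?\<mu> z)"
      by (rule integral_jac_measure[OF A g sets_cond borel_measurable_cond[OF R_cont[OF \<delta>]]])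
    have a_m: "(\<lambda>f. ?a ?q f) \<in> borel_measurable (?\<mu> z)" and h_m: "(\<lambda>f. h (f \<circ> \<phi>)) \<in> borel_measurable (?\<mu> z)"
      by (intro borel_measurable_cond continuous_map_compose_real continuous_map_jac A' g' h)+
    have i: "integrable (?\<mu> z) (\<lambda>f. H * C * ?j ?q f)" by (intro integrable_mult_right integrable_jac_cond)
    have 1: "integrable (?\<mu> z) (\<lambda>f. ?a ?q f * h (f \<circ> \<phi>))"
    proof (rule Bochner_Integration.integrable_bound[OF i])
      show "AE f in ?\<mu> z. norm (?a ?q f * h (f \<circ> \<phi>)) \<le> norm (H * C * ?j ?q f)"
      proof (rule AE_I2)
        fix f assume "f \<in> space (?\<mu> z)"
        then have f: "f \<in> C1_maps A" by (simp add: space)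
        have "?a ?q f * \<bar>h (f \<circ> \<phi>)\<bar> \<le> (C * ?j ?q f) * H"
          using le[OF f] H(2)[OF f] H(1) C(1) a0[OF f] j0[OF f] by (intro mult_mono) auto
        then show "norm (?a ?q f * h (f \<circ> \<phi>)) \<le> norm (H * C * ?j ?q f)"
          using a0[OF f] j0[OF f] H(1) C(1) by (simp add: abs_mult mult_ac)
      qed
    qed (use a_m h_m in measurable)
    have 2: "integrable (?\<mu> z) (\<lambda>f. ?j ?q f * R \<delta> ?q f)"
    proof (rule Bochner_Integration.integrable_bound[OF i])
      show "(\<lambda>f. ?j ?q f * R \<delta> ?q f) \<in> borel_measurable (?\<mu> z)"
        by (intro borel_measurable_times borel_measurable_cond R_cont \<delta> continuous_map_jac A g)
      show "AE f in ?\<mu> z. norm (?j ?q f * R \<delta> ?q f) \<le> norm (H * C * ?j ?q f)"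
      proof (rule AE_I2)
        fix f assume "f \<in> space (?\<mu> z)"
        then have f: "f \<in> C1_maps A" by (simp add: space)
        show "norm (?j ?q f * R \<delta> ?q f) \<le> norm (H * C * ?j ?q f)"
          using mult_left_mono[OF R_bound[OF \<delta> f le[OF f]] j0[OF f, of ?q]] j0[OF f, of ?q] H(1) C(1)
          by (simp add: abs_mult mult_ac)
      qed
    qed
    have "I z - (\<integral>f. R \<delta> ?q f \<partial>?\<nu> z) = (\<integral>f. ?a ?q f * h (f \<circ> \<phi>) - ?j ?q f * R \<delta> ?q f \<partial>?\<mu> z)"
      unfolding I_def R_int using 1 2 by simp
    also have "\<bar>\<dots>\<bar> \<le> (\<integral>f. H * C * \<delta> \<partial>?\<mu> z)"
    proof (rule order_trans[OF integral_abs_bound], rule integral_mono_AE)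
      show "integrable (?\<mu> z) (\<lambda>f. \<bar>?a ?q f * h (f \<circ> \<phi>) - ?j ?q f * R \<delta> ?q f\<bar>)" using 1 2 by auto
      show "integrable (?\<mu> z) (\<lambda>f. H * C * \<delta>)"
        by (intro finite_measure.integrable_const prob_space.finite_measure prob_space_cond)
      show "AE f in ?\<mu> z. \<bar>?a ?q f * h (f \<circ> \<phi>) - ?j ?q f * R \<delta> ?q f\<bar> \<le> H * C * \<delta>"
      proof (rule AE_I2)
        fix f assume "f \<in> space (?\<mu> z)"
        then have f: "f \<in> C1_maps A" by (simp add: space)
        have d: "0 < ?j ?q f + \<delta>" using j0[OF f, of ?q] \<delta> by linarith
        \<comment> \<open>Multiplying out the denominator of \<open>R \<delta>\<close> leaves
          exactly \<open>\<delta>\<close> times the quotient, which is bounded by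
          \<open>H * C\<close> wherever the Jacobian comparison holds.\<close>
        have "?a ?q f * h (f \<circ> \<phi>) - ?j ?q f * R \<delta> ?q f = \<delta> * R \<delta> ?q f"
          unfolding R_def using d by (simp add: field_simps)
        then show "\<bar>?a ?q f * h (f \<circ> \<phi>) - ?j ?q f * R \<delta> ?q f\<bar> \<le> H * C * \<delta>"
          using mult_left_mono[OF R_bound[OF \<delta> f le[OF f]], of \<delta>] \<delta> by (simp add: abs_mult mult_ac)
      qed
    qed
    \<comment> \<open>The conditional laws have total mass 1, which makes the error uniform in
      \<open>z\<close>.\<close>
    also have "\<dots> = H * C * \<delta>" using prob_space.prob_space[OF prob_space_cond] by simp
    finally show ?thesis .
  qed
  have near: "\<forall>\<^sub>F z :: 's \<times> (real ^ 'k) in at (q0, 0). \<forall>f :: 'a \<Rightarrow> real ^ 'k. f \<in> C1_maps A \<longrightarrow> ?a (fst z) f \<le> C * ?j (fst z) f"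
  proof (rule eventually_compose_filterlim[OF C(2)])
    show "(fst \<longlongrightarrow> q0) (at (q0, 0 :: real ^ 'k))"
      using tendsto_fst[OF tendsto_ident_at, of "(q0, 0 :: real ^ 'k)"] by simp
  qed
  have "(I \<longlongrightarrow> I (q0, 0)) (at (q0, 0))"
  proof (rule tendstoI)
    fix \<epsilon> :: real assume \<epsilon>: "0 < \<epsilon>"
    \<comment> \<open>A third of \<open>\<epsilon>\<close> each for the replacement error at
      \<open>z\<close>, the one at \<open>(q0, 0)\<close>, and the limit at fixed
      \<open>\<delta>\<close>. The added 1 covers \<open>H * C = 0\<close>.\<close>
    define \<delta> where "\<delta> = \<epsilon> / (3 * (H * C + 1))"
    have D: "0 \<le> H * C" using H(1) C(1) by simp
    have \<delta>: "0 < \<delta>" using \<epsilon> D by (simp add: \<delta>_def)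
    have HC: "H * C * \<delta> < \<epsilon> / 3"
    proof -
      have "H * C * \<delta> < (H * C + 1) * \<delta>" using \<delta> by (simp add: distrib_right)
      also have "\<dots> = \<epsilon> / 3"
      proof -
        have "H * C + 1 \<noteq> 0" using D by linarith
        then show ?thesis unfolding \<delta>_def by (simp add: divide_simps mult.commute)
      qed
      finally show ?thesis .
    qed
    have "\<forall>\<^sub>F z in at (q0, 0). dist (\<integral>f. R \<delta> (fst z) f \<partial>?\<nu> z) (\<integral>f. R \<delta> q0 f \<partial>?\<nu> (q0, 0)) < \<epsilon> / 3"
      using \<epsilon> by (intro tendstoD[OF lim[OF \<delta>]]) simp
    with near show "\<forall>\<^sub>F z in at (q0, 0). dist (I z) (I (q0, 0)) < \<epsilon>"
    proof eventually_elim
      case (elim z)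
      have c1: "\<bar>I z - (\<integral>f. R \<delta> (fst z) f \<partial>?\<nu> z)\<bar> \<le> H * C * \<delta>" using elim(1) by (intro close[OF \<delta>]) blast
      have c2: "\<bar>I (q0, 0) - (\<integral>f. R \<delta> q0 f \<partial>?\<nu> (q0, 0))\<bar> \<le> H * C * \<delta>"
        using close[OF \<delta>, of "(q0, 0)"] eventually_nhds_x_imp_x[OF C(2)] by simp
      show ?case using c1 c2 elim(2) HC unfolding dist_real_def by linarith
    qed
  qed
  moreover have "(\<integral>f. h f \<partial>jac_measure A' g' q (compose_kernel A' \<phi> \<mu> q x)) = I (q, x)" for q x
  proof -
    have s: "sets (compose_kernel A' \<phi> \<mu> q x) = sets (C1_borel A')" by (simp add: compose_kernel_def)
    have "(\<integral>f. h f \<partial>jac_measure A' g' q (compose_kernel A' \<phi> \<mu> q x)) = (\<integral>f. jac A' g' q f * h f \<partial>compose_kernel A' \<phi> \<mu> q x)"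
      by (rule integral_jac_measure[OF A' g' s borel_measurable_continuous_map[OF h sets_C1[OF A' g' s]]])
    also have "\<dots> = I (q, x)"
      unfolding I_def fst_conv snd_conv
    proof (rule integral_cond_compose)
      show "continuous_map (weak_whitney A') euclideanreal (\<lambda>f. jac A' g' q f * h f)"
        by (intro continuous_map_real_mult continuous_map_jac A' g' h)
    qed
    finally show ?thesis .
  qed
  ultimately show "isCont (\<lambda>z. \<integral>f. h f \<partial>(case z of (q, x) \<Rightarrow> jac_measure A' g' q (compose_kernel A' \<phi> \<mu> q x))) (q0, 0)"
    unfolding isCont_def by (simp add: case_prod_unfold)
qed

text \<open>The density of the composed field at \<open>q\<close> is that of \<open>X\<close> at
  \<open>\<phi> q\<close>, continuous by composition with
  \<open>(q, x) \<mapsto> (\<phi> q, x)\<close>. Transversality enters through the regularity of the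
  value 0.\<close>

lemma zKROK_with_compose:
  assumes trans: "AE \<omega> in P. transverse A' A \<phi> (X \<omega> -` {0})"
  shows "zKROK_with A' g' P (\<lambda>\<omega>. X \<omega> \<circ> \<phi>) (\<lambda>q. \<rho> (\<phi> q)) (compose_kernel A' \<phi> \<mu>)"
  unfolding zKROK_with_def
proof (intro conjI allI)
  have X: "X \<in> P \<rightarrow>\<^sub>M C1_borel A" using z unfolding zKROK_with_def by blast
  show "(\<lambda>\<omega>. X \<omega> \<circ> \<phi>) \<in> P \<rightarrow>\<^sub>M C1_borel A'"
    by (rule measurable_compose[OF X measurable_compose_C1])
  have "AE \<omega> in P. regular_value A (X \<omega>) 0" using z unfolding zKROK_with_def by blast
  with trans AE_space show "AE \<omega> in P. regular_value A' (X \<omega> \<circ> \<phi>) 0"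
  proof eventually_elim
    case (elim \<omega>)
    have "X \<omega> \<in> space (C1_borel A)" by (rule measurable_space[OF X elim(2)])
    then have "X \<omega> \<in> C1_maps A" by (simp add: space_C1[OF A g refl])
    then show ?case by (rule regular_value_compose[OF A A' \<phi> _ elim(3,1)])
  qed
  show "0 \<le> \<rho> (\<phi> q) x" for q x by (rule density_nonneg)
  show "distributed P lborel (\<lambda>\<omega>. (X \<omega> \<circ> \<phi>) q) (\<lambda>x. ennreal (\<rho> (\<phi> q) x))" for q
    using z unfolding zKROK_with_def by simp
  show "isCont (\<lambda>(q, x). \<rho> (\<phi> q) x) (q, 0)" for q
  proof -
    have "isCont (\<lambda>(p, x). \<rho> p x) (\<phi> q, 0)" using z unfolding zKROK_with_def by blast
    then show ?thesis
      using isCont_o2[OF isCont_smooth_map_pair[of q 0], of "\<lambda>(p, x). \<rho> p x"] by (simp add: case_prod_unfold)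
  qed
qed (rule regular_cond_prob_compose finite_jac_measure_compose weakly_isCont_compose)+

end

end

lemma zonoid_section_compose:
  fixes A :: "('a::{t2_space, second_countable_topology}, 'e::finite_dim_inner) chart set"
    and A' :: "('s::{t2_space, second_countable_topology}, 'f::finite_dim_inner) chart set"
    and X :: "'w \<Rightarrow> 'a \<Rightarrow> real ^ 'k::finite"
  assumes A: "smooth_atlas A" and g: "riemannian_metric A g" and P: "prob_space P"
    and z: "zKROK_with A g P X \<rho> \<mu>"
    and A': "smooth_atlas A'" and g': "riemannian_metric A' g'" and \<phi>: "smooth_map A' A \<phi>"
    and trans: "AE \<omega> in P. transverse A' A \<phi> (X \<omega> -` {0})"
  shows "zonoid_section A' g' P (\<lambda>\<omega>. X \<omega> \<circ> \<phi>) q = pullback_form (dmap A' A \<phi> q) ` zonoid_section A g P X (\<phi> q)"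
proof -
  let ?L = "pullback_form (dmap A' A \<phi> q) :: ('e, 'k) altform \<Rightarrow> ('f, 'k) altform"
  have lin: "linear (dmap A' A \<phi> q)" by (rule linear_dmap[OF A' A \<phi>])
  have L: "bounded_linear ?L" by (rule bounded_linear_pullback_form[OF lin])
  note image = zonoid_linear_image[OF L zonoid_section_support(1)[OF A g P z, of "\<phi> q"]]
  have "support_function (?L ` zonoid_section A g P X (\<phi> q)) u =
      \<rho> (\<phi> q) 0 * (\<integral>f. max 0 (blinfun_apply u (wedge (dcomp A' f q))) \<partial>compose_kernel A' \<phi> \<mu> q 0)" for u
  proof -
    have "(\<integral>f. max 0 (blinfun_apply u (wedge (dcomp A' f q))) \<partial>compose_kernel A' \<phi> \<mu> q 0)
        = (\<integral>f. max 0 (blinfun_apply u (wedge (dcomp A' (f \<circ> \<phi>) q))) \<partial>\<mu> (\<phi> q) 0)"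
    proof (rule integral_cond_compose[OF A g P z A' g' \<phi>])
      show "continuous_map (weak_whitney A') euclideanreal (\<lambda>f. max 0 (blinfun_apply u (wedge (dcomp A' f q))))"
        using continuous_map_wedge_functional[OF A' g', of u q]
        unfolding continuous_map_real_iff_nhdsin by (intro ballI tendsto_max tendsto_const) blast
    qed
    also have "\<dots> = (\<integral>f. max 0 (blinfun_apply (u o\<^sub>L Blinfun ?L) (wedge (dcomp A f (\<phi> q)))) \<partial>\<mu> (\<phi> q) 0)"
    proof (intro Bochner_Integration.integral_cong refl)
      fix f assume "f \<in> space (\<mu> (\<phi> q) 0)"
      then have f: "f \<in> C1_maps A" by (simp add: space_C1[OF A g sets_cond[OF A g P z]])
      have "?L (wedge (dcomp A f (\<phi> q))) = wedge (\<lambda>i v. dcomp A f (\<phi> q) i (dmap A' A \<phi> q v))"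
        by (rule pullback_form_wedge[OF lin linear_dcomp[OF A f]])
      then show "max 0 (blinfun_apply u (wedge (dcomp A' (f \<circ> \<phi>) q)))
          = max 0 (blinfun_apply (u o\<^sub>L Blinfun ?L) (wedge (dcomp A f (\<phi> q))))"
        by (simp add: bounded_linear_Blinfun_apply[OF L] dcomp_compose[OF A' A \<phi> f])
    qed
    finally show ?thesis using image(2) zonoid_section_support(2)[OF A g P z] by simp
  qed
  from zonoid_section_eqI[OF A' g' P zKROK_with_compose[OF A g P z A' g' \<phi> trans] image(1) this] show ?thesis .
qed

theorem theorem2:
  fixes A :: "('a::{t2_space, second_countable_topology}, 'e::finite_dim_inner) chart set"
    and g :: "'a \<Rightarrow> 'e \<Rightarrow> 'e \<Rightarrow> real"
    and A' :: "('s::{t2_space, second_countable_topology}, 'f::finite_dim_inner) chart set"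
    and g' :: "'s \<Rightarrow> 'f \<Rightarrow> 'f \<Rightarrow> real"
    and P :: "'w measure"
    and X :: "'w \<Rightarrow> 'a \<Rightarrow> real ^ 'k::finite"
    and \<phi> :: "'s \<Rightarrow> 'a"
  assumes "smooth_atlas A" and "riemannian_metric A g"
    and "smooth_atlas A'" and "riemannian_metric A' g'"
    and "prob_space P"
    and "zKROK A g P X"
    and "smooth_map A' A \<phi>"
    and "AE \<omega> in P. transverse A' A \<phi> (X \<omega> -` {0})"
  shows "zKROK A' g' P (\<lambda>\<omega>. X \<omega> \<circ> \<phi>) \<and>
    (\<forall>q. zonoid_section A' g' P (\<lambda>\<omega>. X \<omega> \<circ> \<phi>) q =
       pullback_form (dmap A' A \<phi> q) ` zonoid_section A g P X (\<phi> q))"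
proof -
  obtain \<rho> \<mu> where z: "zKROK_with A g P X \<rho> \<mu>" using assms(6) unfolding zKROK_def by blast
  note setting = assms(1,2,5) z assms(3,4,7,8)
  show ?thesis
    unfolding zKROK_def using zKROK_with_compose[OF setting] zonoid_section_compose[OF setting] by blast
qed

end
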